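(* Let $(G,P)$ be a quasi-lattice ordered group and let $X$ be a product system over $P$ of essential Hilbert $A$--$A$ bimodules. (1) If $(L,\psi)$ is a covariant representation of $(B_P,P,\tau,X)$, then $\psi$ is a nondegenerate Nica-covariant Toeplitz representation of $X$ and $L(1_s)=\alpha^\psi_s(1)$ for all $s\in P$. (2) If $\psi$ is a nondegenerate Nica-covariant Toeplitz representation of $X$ on a Hilbert space $\mathcal H$, then there is a representation $L^\psi:B_P\to B(\mathcal H)$ such that $L^\psi(1_s)=\alpha^\psi_s(1)$ for all $s\in P$; moreover, $(L^\psi,\psi)$ is then a covariant representation of $(B_P,P,\tau,X)$.
   Context: Standing assumptions: $A$ is a separable $C^*$-algebra, $P$ is a countable semigroup with identity $e$. A Hilbert bimodule over $A$ is a right Hilbert $A$-module $Y$ with a $*$-homomorphism $\phi:A\to\mathcal L(Y)$ (adjointable operators) giving the left action. It is essential if $Y=\overline{\mathrm{span}}\{\phi(a)y\}$. A product system over $P$ of Hilbert $A$--$A$ bimodules is a semigroup $X$ with a semigroup homomorphism $p:X\to P$ such that each fibre $X_s=p^{-1}(s)$ is a Hilbert bimodule over $A$ (left action $\phi_s$); for $s,t\ne e$ multiplication $X_s\times X_t\to X_{st}$ extends to an isomorphism of Hilbert bimodules $X_s\otimes_AX_t\to X_{st}$; $X_e=A$ with its usual bimodule structure; and $ax=\phi_s(a)x$, $xa=x\cdot a$ for $a\in X_e$, $x\in X_s$. A Toeplitz representation of $X$ on a Hilbert space $\mathcal H$ is a map $\psi:X\to B(\mathcal H)$ whose restrictions $\psi_s=\psi|_{X_s}$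 are linear, with $\psi_e$ a $*$-homomorphism, $\psi(xy)=\psi(x)\psi(y)$, and $\psi_s(x)^*\psi_s(y)=\psi_e(\langle x,y\rangle_A)$ for $x,y\in X_s$. Since the fibres are essential, $\psi$ is nondegenerate iff $\psi_e$ is a nondegenerate representation of $A$. For $s\in P$, $\alpha^\psi_s$ is the unique endomorphism of the commutant $\psi_e(A)'$ with $\alpha^\psi_s(S)\psi_s(x)=\psi_s(x)S$ for all $S\in\psi_e(A)'$, $x\in X_s$, and with $\alpha^\psi_s(1)$ vanishing on $(\psi_s(X_s)\mathcal H)^\perp$; so $\alpha^\psi_s(1)$ is the projection onto $\overline{\mathrm{span}}\,\psi_s(X_s)\mathcal H$. $P$ is a subsemigroup of a group $G$ with $P\cap P^{-1}=\{e\}$; $s\le t$ iff $s^{-1}t\in P$. $(G,P)$ is quasi-lattice ordered if every finite subset of $G$ with an upper bound in $P$ has a least upper bound in $P$. $s\vee t$ is the least upper bound of $s,t\in P$ if they have a common upper bound; otherwise $s\vee t=\infty$. $\psi$ is Nica covariant if $\alpha^\psi_s(1)\alpha^\psi_t(1)$ equals $\alpha^\psi_{s\vee t}(1)$ when $s\vee t<\infty$ and $0$ otherwise. For $t\in P$, $1_t\in\ell^\infty(P)$ is the characteristic function of $tP$; $B_P=\overline{\mathrm{span}}\{1_t:t\in P\}$, a unital $C^*$-subalgebra of $\ell^\infty(P)$; $\tau_s(1_t)=1_{st}$ defines an action $\tau$ of $P$ by endomorphisms of $B_P$. A covariant representation of $(B_P,P,\tau,X)$ on $\mathcal H$ is a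 pair $(L,\psi)$ of a nondegenerate representation $L:B_P\to B(\mathcal H)$ and a nondegenerate Toeplitz representation $\psi:X\to B(\mathcal H)$ with $L(B_P)\subseteq\psi_e(A)'$ and $L\circ\tau_s=\alpha^\psi_s\circ L$ for all $s\in P$. *)

theory Defs
  imports "HOL-Analysis.Analysis" "HOL-Algebra.Coset"
begin

section \<open>Complex Hilbert spaces and $C^*$-algebras\<close>

class complex_vector = real_vector +
  fixes scaleC :: "complex \<Rightarrow> 'a \<Rightarrow> 'a"  (infixr "*\<^sub>C" 75)
  assumes scaleC_add_right: "c *\<^sub>C (x + y) = c *\<^sub>C x + c *\<^sub>C y"
    and scaleC_add_left: "(c + d) *\<^sub>C x = c *\<^sub>C x + d *\<^sub>C x"
    and scaleC_scaleC: "c *\<^sub>C (d *\<^sub>C x) = (c * d) *\<^sub>C x"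
    and scaleC_one: "1 *\<^sub>C x = x"
    and scaleR_scaleC: "r *\<^sub>R x = complex_of_real r *\<^sub>C x"

global_interpretation complex_vs: vector_space "scaleC :: complex \<Rightarrow> 'a \<Rightarrow> 'a::complex_vector"
  defines cspan = complex_vs.span
  by unfold_locales (simp_all add: scaleC_add_right scaleC_add_left scaleC_scaleC scaleC_one)

class complex_banach = complex_vector + banach +
  assumes norm_scaleC: "norm (c *\<^sub>C x) = cmod c * norm x"

text \<open>The inner product is linear in the second variable, like the inner products of Hilbert modules
  below. Positivity and definiteness follow from \<open>cinner_self\<close>.\<close>

class complex_hilbert = complex_banach +
  fixes cinner :: "'a \<Rightarrow> 'a \<Rightarrow> complex"
  assumes cinner_add_right: "cinner x (y + z) = cinner x y + cinner x z"
    and cinner_scaleC_right: "cinner x (c *\<^sub>C y) = c * cinner x y"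
    and cinner_commute: "cinner x y = cnj (cinner y x)"
    and cinner_self: "cinner x x = complex_of_real ((norm x)\<^sup>2)"

text \<open>$C^*$-algebras, not assumed to have a unit.\<close>

class cstar_algebra = complex_banach + real_normed_algebra +
  fixes star :: "'a \<Rightarrow> 'a"
  assumes mult_scaleC_left: "(c *\<^sub>C a) * b = c *\<^sub>C (a * b)"
    and mult_scaleC_right: "a * (c *\<^sub>C b) = c *\<^sub>C (a * b)"
    and star_add: "star (a + b) = star a + star b"
    and star_scaleC: "star (c *\<^sub>C a) = cnj c *\<^sub>C star a"
    and star_mult: "star (a * b) = star b * star a"
    and star_star: "star (star a) = a"
    and cstar_identity: "norm (star a * a) = (norm a)\<^sup>2"

definition cstar_pos :: "'a::cstar_algebra \<Rightarrow> bool" where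
  "cstar_pos a \<longleftrightarrow> (\<exists>b. a = star b * b)"


section \<open>Bounded operators\<close>

text \<open>$B(\mathcal H)$ is the set \<open>bounded_ops\<close> of functions; its product is composition and its unit
  is \<open>id\<close>.\<close>

definition bounded_ops :: "('h::complex_hilbert \<Rightarrow> 'h) set" where
  "bounded_ops = {T. (\<forall>x y. T (x + y) = T x + T y) \<and> (\<forall>c x. T (c *\<^sub>C x) = c *\<^sub>C T x) \<and>
                     (\<exists>K. \<forall>x. norm (T x) \<le> K * norm x)}"

definition adj :: "('h::complex_hilbert \<Rightarrow> 'h) \<Rightarrow> 'h \<Rightarrow> 'h" where
  "adj T = (THE S. S \<in> bounded_ops \<and> (\<forall>x y. cinner (T x) y = cinner x (S y)))"

definition op_add :: "('h::complex_hilbert \<Rightarrow> 'h) \<Rightarrow> ('h \<Rightarrow> 'h) \<Rightarrow> 'h \<Rightarrow> 'h" where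
  "op_add S T = (\<lambda>h. S h + T h)"

definition op_scale :: "complex \<Rightarrow> ('h::complex_hilbert \<Rightarrow> 'h) \<Rightarrow> 'h \<Rightarrow> 'h" where
  "op_scale c T = (\<lambda>h. c *\<^sub>C T h)"

text \<open>\<open>star_rep D ad sc mu st \<pi>\<close>: \<open>\<pi>\<close> is a \<open>*\<close>-homomorphism into $B(\mathcal H)$ of the
  \<open>*\<close>-algebra with carrier \<open>D\<close> and the given operations.\<close>

definition star_rep :: "'b set \<Rightarrow> ('b \<Rightarrow> 'b \<Rightarrow> 'b) \<Rightarrow> (complex \<Rightarrow> 'b \<Rightarrow> 'b) \<Rightarrow> ('b \<Rightarrow> 'b \<Rightarrow> 'b) \<Rightarrow>
    ('b \<Rightarrow> 'b) \<Rightarrow> ('b \<Rightarrow> 'h::complex_hilbert \<Rightarrow> 'h) \<Rightarrow> bool" where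
  "star_rep D ad sc mu st \<pi> \<longleftrightarrow>
     (\<forall>a\<in>D. \<pi> a \<in> bounded_ops) \<and>
     (\<forall>a\<in>D. \<forall>b\<in>D. \<pi> (ad a b) = op_add (\<pi> a) (\<pi> b)) \<and>
     (\<forall>c. \<forall>a\<in>D. \<pi> (sc c a) = op_scale c (\<pi> a)) \<and>
     (\<forall>a\<in>D. \<forall>b\<in>D. \<pi> (mu a b) = \<pi> a \<circ> \<pi> b) \<and>
     (\<forall>a\<in>D. \<pi> (st a) = adj (\<pi> a))"

definition nondegenerate :: "('h::complex_hilbert \<Rightarrow> 'h) set \<Rightarrow> bool" where
  "nondegenerate \<O> \<longleftrightarrow> closure (cspan {T h | T h. T \<in> \<O>}) = UNIV"


section \<open>Hilbert bimodules\<close>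

text \<open>\<open>lact M a\<close> is $\phi(a)$, \<open>ract M x a\<close> is $x\cdot a$, \<open>ip M x y\<close> is $\langle x,y\rangle_A$.\<close>

record ('a, 'y) hbimod = "'y partial_object" +
  hadd :: "'y \<Rightarrow> 'y \<Rightarrow> 'y"
  hzero :: 'y
  hscale :: "complex \<Rightarrow> 'y \<Rightarrow> 'y"
  ract :: "'y \<Rightarrow> 'a \<Rightarrow> 'y"
  ip :: "'y \<Rightarrow> 'y \<Rightarrow> 'a"
  lact :: "'a \<Rightarrow> 'y \<Rightarrow> 'y"

definition hdist :: "('a::cstar_algebra, 'y) hbimod \<Rightarrow> 'y \<Rightarrow> 'y \<Rightarrow> real" where
  "hdist M x y = (let z = hadd M x (hscale M (-1) y) in sqrt (norm (ip M z z)))"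

inductive_set hspan :: "('a, 'y) hbimod \<Rightarrow> 'y set \<Rightarrow> 'y set" for M S where
  zero: "hzero M \<in> hspan M S"
| step: "x \<in> S \<Longrightarrow> y \<in> hspan M S \<Longrightarrow> hadd M (hscale M c x) y \<in> hspan M S"

definition hclosure :: "('a::cstar_algebra, 'y) hbimod \<Rightarrow> 'y set \<Rightarrow> 'y set" where
  "hclosure M S = {x \<in> carrier M. \<forall>\<epsilon>>0. \<exists>y\<in>S. hdist M x y < \<epsilon>}"

text \<open>Additive inverses are \<open>hscale M (-1) x\<close>, by \<open>scale_zero\<close>.\<close>

locale right_hilbert_module =
  fixes M :: "('a::cstar_algebra, 'y) hbimod"
  assumes zero_closed: "hzero M \<in> carrier M"
    and add_closed: "\<lbrakk>x \<in> carrier M; y \<in> carrier M\<rbrakk> \<Longrightarrow> hadd M x y \<in> carrier M"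
    and scale_closed: "x \<in> carrier M \<Longrightarrow> hscale M c x \<in> carrier M"
    and add_assoc: "\<lbrakk>x \<in> carrier M; y \<in> carrier M; z \<in> carrier M\<rbrakk>
          \<Longrightarrow> hadd M (hadd M x y) z = hadd M x (hadd M y z)"
    and add_comm: "\<lbrakk>x \<in> carrier M; y \<in> carrier M\<rbrakk> \<Longrightarrow> hadd M x y = hadd M y x"
    and add_zero: "x \<in> carrier M \<Longrightarrow> hadd M (hzero M) x = x"
    and scale_zero: "x \<in> carrier M \<Longrightarrow> hscale M 0 x = hzero M"
    and scale_one: "x \<in> carrier M \<Longrightarrow> hscale M 1 x = x"
    and scale_scale: "x \<in> carrier M \<Longrightarrow> hscale M c (hscale M d x) = hscale M (c * d) x"
    and scale_add_right: "\<lbrakk>x \<in> carrier M; y \<in> carrier M\<rbrakk>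
          \<Longrightarrow> hscale M c (hadd M x y) = hadd M (hscale M c x) (hscale M c y)"
    and scale_add_left: "x \<in> carrier M
          \<Longrightarrow> hscale M (c + d) x = hadd M (hscale M c x) (hscale M d x)"
    and ract_closed: "x \<in> carrier M \<Longrightarrow> ract M x a \<in> carrier M"
    and ract_add_left: "\<lbrakk>x \<in> carrier M; y \<in> carrier M\<rbrakk>
          \<Longrightarrow> ract M (hadd M x y) a = hadd M (ract M x a) (ract M y a)"
    and ract_add_right: "x \<in> carrier M \<Longrightarrow> ract M x (a + b) = hadd M (ract M x a) (ract M x b)"
    and ract_mult: "x \<in> carrier M \<Longrightarrow> ract M x (a * b) = ract M (ract M x a) b"
    and ract_scale_left: "x \<in> carrier M \<Longrightarrow> ract M (hscale M c x) a = hscale M c (ract M x a)"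
    and ract_scale_right: "x \<in> carrier M \<Longrightarrow> ract M x (c *\<^sub>C a) = hscale M c (ract M x a)"
    and ip_add_right: "\<lbrakk>x \<in> carrier M; y \<in> carrier M; z \<in> carrier M\<rbrakk>
          \<Longrightarrow> ip M x (hadd M y z) = ip M x y + ip M x z"
    and ip_scale_right: "\<lbrakk>x \<in> carrier M; y \<in> carrier M\<rbrakk>
          \<Longrightarrow> ip M x (hscale M c y) = c *\<^sub>C ip M x y"
    and ip_ract: "\<lbrakk>x \<in> carrier M; y \<in> carrier M\<rbrakk> \<Longrightarrow> ip M x (ract M y a) = ip M x y * a"
    and ip_star: "\<lbrakk>x \<in> carrier M; y \<in> carrier M\<rbrakk> \<Longrightarrow> star (ip M x y) = ip M y x"
    and ip_pos: "x \<in> carrier M \<Longrightarrow> cstar_pos (ip M x x)"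
    and ip_definite: "\<lbrakk>x \<in> carrier M; ip M x x = 0\<rbrakk> \<Longrightarrow> x = hzero M"
    and complete: "\<lbrakk>\<And>n. u n \<in> carrier M;
            \<And>\<epsilon>::real. \<epsilon> > 0 \<Longrightarrow> \<exists>N. \<forall>m\<ge>N. \<forall>n\<ge>N. hdist M (u m) (u n) < \<epsilon>\<rbrakk>
          \<Longrightarrow> \<exists>x\<in>carrier M. (\<lambda>n. hdist M (u n) x) \<longlonglongrightarrow> 0"

text \<open>\<open>lact_adjoint\<close> says that $\phi(a)$ is adjointable, with adjoint $\phi(a^*)$; in particular $\phi(a)$
  is automatically linear, $A$-linear and bounded.\<close>

locale hilbert_bimodule = right_hilbert_module +
  assumes lact_closed: "x \<in> carrier M \<Longrightarrow> lact M a x \<in> carrier M"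
    and lact_adjoint: "\<lbrakk>x \<in> carrier M; y \<in> carrier M\<rbrakk>
          \<Longrightarrow> ip M (lact M a x) y = ip M x (lact M (star a) y)"
    and lact_add: "x \<in> carrier M \<Longrightarrow> lact M (a + b) x = hadd M (lact M a x) (lact M b x)"
    and lact_scale: "x \<in> carrier M \<Longrightarrow> lact M (c *\<^sub>C a) x = hscale M c (lact M a x)"
    and lact_mult: "x \<in> carrier M \<Longrightarrow> lact M (a * b) x = lact M a (lact M b x)"

definition essential :: "('a::cstar_algebra, 'y) hbimod \<Rightarrow> bool" where
  "essential M \<longleftrightarrow> hclosure M (hspan M {lact M a y | a y. y \<in> carrier M}) = carrier M"

definition bimod_iso ::
    "('a::cstar_algebra, 'y) hbimod \<Rightarrow> ('a, 'z) hbimod \<Rightarrow> ('y \<Rightarrow> 'z) \<Rightarrow> bool" where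
  "bimod_iso M N U \<longleftrightarrow> bij_betw U (carrier M) (carrier N) \<and>
     (\<forall>x\<in>carrier M. \<forall>y\<in>carrier M.
        U (hadd M x y) = hadd N (U x) (U y) \<and> ip N (U x) (U y) = ip M x y) \<and>
     (\<forall>x\<in>carrier M. (\<forall>c. U (hscale M c x) = hscale N c (U x)) \<and>
        (\<forall>a. U (ract M x a) = ract N (U x) a \<and> U (lact M a x) = lact N a (U x)))"

definition std_bimod :: "('a::cstar_algebra, 'a) hbimod" where
  "std_bimod = \<lparr>carrier = UNIV, hadd = (+), hzero = 0, hscale = scaleC, ract = (*),
                ip = (\<lambda>a b. star a * b), lact = (*)\<rparr>"

text \<open>The bimodule \<open>T\<close> together with $j(x,y)=x\otimes y$ is the (interior) tensor product
  $E\otimes_A F$, i.e. the completion of the algebraic tensor product in the \<open>A\<close>-valued inner product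
  $\langle x\otimes y,x'\otimes y'\rangle=\langle y,\phi_F(\langle x,x'\rangle)y'\rangle$, with
  $a(x\otimes y)=ax\otimes y$ and $(x\otimes y)a=x\otimes ya$. The pair is determined by these
  conditions up to a unique isomorphism.\<close>

definition interior_tensor_product :: "('a::cstar_algebra, 'y) hbimod \<Rightarrow> ('a, 'z) hbimod \<Rightarrow>
    ('a, 'w) hbimod \<Rightarrow> ('y \<Rightarrow> 'z \<Rightarrow> 'w) \<Rightarrow> bool" where
  "interior_tensor_product E F T j \<longleftrightarrow> hilbert_bimodule T \<and>
     (\<forall>x\<in>carrier E. \<forall>y\<in>carrier F. j x y \<in> carrier T) \<and>
     (\<forall>x\<in>carrier E. \<forall>x'\<in>carrier E. \<forall>y\<in>carrier F.
        j (hadd E x x') y = hadd T (j x y) (j x' y)) \<and>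
     (\<forall>x\<in>carrier E. \<forall>y\<in>carrier F. \<forall>y'\<in>carrier F.
        j x (hadd F y y') = hadd T (j x y) (j x y')) \<and>
     (\<forall>c. \<forall>x\<in>carrier E. \<forall>y\<in>carrier F.
        j (hscale E c x) y = hscale T c (j x y) \<and> j x (hscale F c y) = hscale T c (j x y)) \<and>
     (\<forall>a. \<forall>x\<in>carrier E. \<forall>y\<in>carrier F.
        j (ract E x a) y = j x (lact F a y) \<and>
        j (lact E a x) y = lact T a (j x y) \<and>
        j x (ract F y a) = ract T (j x y) a) \<and>
     (\<forall>x\<in>carrier E. \<forall>x'\<in>carrier E. \<forall>y\<in>carrier F. \<forall>y'\<in>carrier F.
        ip T (j x y) (j x' y') = ip F y (lact F (ip E x x') y')) \<and>
     hclosure T (hspan T {j x y | x y. x \<in> carrier E \<and> y \<in> carrier F}) = carrier T"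


section \<open>Quasi-lattice ordered groups\<close>

definition le_P :: "('g, 'm) monoid_scheme \<Rightarrow> 'g set \<Rightarrow> 'g \<Rightarrow> 'g \<Rightarrow> bool" where
  "le_P G P s t \<longleftrightarrow> inv\<^bsub>G\<^esub> s \<otimes>\<^bsub>G\<^esub> t \<in> P"

definition is_lub_P :: "('g, 'm) monoid_scheme \<Rightarrow> 'g set \<Rightarrow> 'g set \<Rightarrow> 'g \<Rightarrow> bool" where
  "is_lub_P G P F u \<longleftrightarrow> u \<in> P \<and> (\<forall>s\<in>F. le_P G P s u) \<and>
     (\<forall>v\<in>P. (\<forall>s\<in>F. le_P G P s v) \<longrightarrow> le_P G P u v)"

locale quasi_lattice_ordered = group G + submonoid P G for G (structure) and P +
  assumes cone_pointed: "P \<inter> m_inv G ` P = {\<one>}"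
    and lub_exists: "\<lbrakk>finite F; F \<subseteq> carrier G; u \<in> P; \<forall>s\<in>F. le_P G P s u\<rbrakk>
          \<Longrightarrow> \<exists>v. is_lub_P G P F v"

text \<open>$s\vee t$, with \<open>None\<close> for $\infty$.\<close>

definition join_P :: "('g, 'm) monoid_scheme \<Rightarrow> 'g set \<Rightarrow> 'g \<Rightarrow> 'g \<Rightarrow> 'g option" where
  "join_P G P s t =
     (if \<exists>u\<in>P. le_P G P s u \<and> le_P G P t u then Some (THE u. is_lub_P G P {s, t} u) else None)"


section \<open>Product systems\<close>

text \<open>\<open>deg\<close> is the homomorphism $p:X\to P$ and \<open>emb\<close> the identification of $A$ with $X_e$.
  Realizing the tensor product in \<open>fibre_tensor\<close> on the type of \<open>X\<close> is no restriction, since it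
  has to be isomorphic to a fibre.\<close>

record ('g, 'a, 'x) prodsys = "'x partial_object" +
  ptimes :: "'x \<Rightarrow> 'x \<Rightarrow> 'x"
  deg :: "'x \<Rightarrow> 'g"
  fibre :: "'g \<Rightarrow> ('a, 'x) hbimod"
  emb :: "'a \<Rightarrow> 'x"

locale product_system =
  fixes G :: "('g, 'm) monoid_scheme" (structure) and P :: "'g set"
    and X :: "('g, 'a::cstar_algebra, 'x) prodsys"
  assumes ptimes_closed: "\<lbrakk>x \<in> carrier X; y \<in> carrier X\<rbrakk> \<Longrightarrow> ptimes X x y \<in> carrier X"
    and ptimes_assoc: "\<lbrakk>x \<in> carrier X; y \<in> carrier X; z \<in> carrier X\<rbrakk>
          \<Longrightarrow> ptimes X (ptimes X x y) z = ptimes X x (ptimes X y z)"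
    and deg_closed: "x \<in> carrier X \<Longrightarrow> deg X x \<in> P"
    and deg_ptimes: "\<lbrakk>x \<in> carrier X; y \<in> carrier X\<rbrakk>
          \<Longrightarrow> deg X (ptimes X x y) = deg X x \<otimes> deg X y"
    and fibre_carrier: "s \<in> P \<Longrightarrow> carrier (fibre X s) = {x \<in> carrier X. deg X x = s}"
    and fibre_bimodule: "s \<in> P \<Longrightarrow> hilbert_bimodule (fibre X s)"
    and fibre_tensor: "\<lbrakk>s \<in> P; t \<in> P; s \<noteq> \<one>; t \<noteq> \<one>\<rbrakk>
          \<Longrightarrow> \<exists>(T :: ('a, 'x) hbimod) j U.
                interior_tensor_product (fibre X s) (fibre X t) T j \<and>
                bimod_iso T (fibre X (s \<otimes> t)) U \<and>
                (\<forall>x\<in>carrier (fibre X s). \<forall>y\<in>carrier (fibre X t). U (j x y) = ptimes X x y)"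
    and fibre_one: "bimod_iso std_bimod (fibre X \<one>) (emb X)"
    and emb_ptimes: "\<lbrakk>s \<in> P; x \<in> carrier (fibre X s)\<rbrakk>
          \<Longrightarrow> ptimes X (emb X a) x = lact (fibre X s) a x"
    and ptimes_emb: "\<lbrakk>s \<in> P; x \<in> carrier (fibre X s)\<rbrakk>
          \<Longrightarrow> ptimes X x (emb X a) = ract (fibre X s) x a"


section \<open>Toeplitz representations\<close>

definition toeplitz_rep :: "'g set \<Rightarrow> ('g, 'a::cstar_algebra, 'x) prodsys \<Rightarrow>
    ('x \<Rightarrow> 'h::complex_hilbert \<Rightarrow> 'h) \<Rightarrow> bool" where
  "toeplitz_rep P X \<psi> \<longleftrightarrow>
     (\<forall>x\<in>carrier X. \<psi> x \<in> bounded_ops) \<and>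
     (\<forall>s\<in>P. \<forall>x\<in>carrier (fibre X s).
        (\<forall>y\<in>carrier (fibre X s). \<psi> (hadd (fibre X s) x y) = op_add (\<psi> x) (\<psi> y)) \<and>
        (\<forall>c. \<psi> (hscale (fibre X s) c x) = op_scale c (\<psi> x))) \<and>
     star_rep UNIV (+) scaleC (*) star (\<psi> \<circ> emb X) \<and>
     (\<forall>x\<in>carrier X. \<forall>y\<in>carrier X. \<psi> (ptimes X x y) = \<psi> x \<circ> \<psi> y) \<and>
     (\<forall>s\<in>P. \<forall>x\<in>carrier (fibre X s). \<forall>y\<in>carrier (fibre X s).
        adj (\<psi> x) \<circ> \<psi> y = \<psi> (emb X (ip (fibre X s) x y)))"

definition nondegenerate_toeplitz_rep :: "'g set \<Rightarrow> ('g, 'a::cstar_algebra, 'x) prodsys \<Rightarrow>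
    ('x \<Rightarrow> 'h::complex_hilbert \<Rightarrow> 'h) \<Rightarrow> bool" where
  "nondegenerate_toeplitz_rep P X \<psi> \<longleftrightarrow> toeplitz_rep P X \<psi> \<and> nondegenerate (\<psi> ` carrier X)"

text \<open>The commutant $\psi_e(A)'$.\<close>

definition commutant :: "('g, 'a::cstar_algebra, 'x) prodsys \<Rightarrow>
    ('x \<Rightarrow> 'h::complex_hilbert \<Rightarrow> 'h) \<Rightarrow> ('h \<Rightarrow> 'h) set" where
  "commutant X \<psi> = {S \<in> bounded_ops. \<forall>a. S \<circ> \<psi> (emb X a) = \<psi> (emb X a) \<circ> S}"

definition commutant_endo :: "('g, 'a::cstar_algebra, 'x) prodsys \<Rightarrow>
    ('x \<Rightarrow> 'h::complex_hilbert \<Rightarrow> 'h) \<Rightarrow> (('h \<Rightarrow> 'h) \<Rightarrow> 'h \<Rightarrow> 'h) \<Rightarrow> bool" where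
  "commutant_endo X \<psi> \<alpha> \<longleftrightarrow> \<alpha> ` commutant X \<psi> \<subseteq> commutant X \<psi> \<and>
     star_rep (commutant X \<psi>) op_add op_scale (\<circ>) adj \<alpha>"

text \<open>$\alpha^\psi_s$; extensionality makes it unique as a total function.\<close>

definition alpha :: "('g, 'a::cstar_algebra, 'x) prodsys \<Rightarrow>
    ('x \<Rightarrow> 'h::complex_hilbert \<Rightarrow> 'h) \<Rightarrow> 'g \<Rightarrow> ('h \<Rightarrow> 'h) \<Rightarrow> 'h \<Rightarrow> 'h" where
  "alpha X \<psi> s = (THE \<alpha>. \<alpha> \<in> extensional (commutant X \<psi>) \<and> commutant_endo X \<psi> \<alpha> \<and>
     (\<forall>S\<in>commutant X \<psi>. \<forall>x\<in>carrier (fibre X s). \<alpha> S \<circ> \<psi> x = \<psi> x \<circ> S) \<and>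
     (\<forall>k. (\<forall>x\<in>carrier (fibre X s). \<forall>h. cinner (\<psi> x h) k = 0) \<longrightarrow> \<alpha> id k = 0))"

definition nica_covariant :: "('g, 'm) monoid_scheme \<Rightarrow> 'g set \<Rightarrow>
    ('g, 'a::cstar_algebra, 'x) prodsys \<Rightarrow> ('x \<Rightarrow> 'h::complex_hilbert \<Rightarrow> 'h) \<Rightarrow> bool" where
  "nica_covariant G P X \<psi> \<longleftrightarrow> (\<forall>s\<in>P. \<forall>t\<in>P. alpha X \<psi> s id \<circ> alpha X \<psi> t id =
     (case join_P G P s t of Some u \<Rightarrow> alpha X \<psi> u id | None \<Rightarrow> (\<lambda>_. 0)))"


section \<open>The $C^*$-algebra $B_P$ and its covariant representations\<close>

text \<open>Functions on $P$ are represented by functions on the type of elements of $G$ vanishing off $P$.\<close>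

definition linfty :: "'g set \<Rightarrow> ('g \<Rightarrow> complex) set" where
  "linfty P = {f. (\<forall>r. r \<notin> P \<longrightarrow> f r = 0) \<and> bounded (range f)}"

definition one_P :: "('g, 'm) monoid_scheme \<Rightarrow> 'g set \<Rightarrow> 'g \<Rightarrow> 'g \<Rightarrow> complex" where
  "one_P G P t = indicator (t <#\<^bsub>G\<^esub> P)"

definition span_one_P :: "('g, 'm) monoid_scheme \<Rightarrow> 'g set \<Rightarrow> ('g \<Rightarrow> complex) set" where
  "span_one_P G P = {\<lambda>r. \<Sum>t\<in>F. c t * one_P G P t r | F c. finite F \<and> F \<subseteq> P}"

text \<open>Closure of the span in the supremum norm.\<close>

definition B_P :: "('g, 'm) monoid_scheme \<Rightarrow> 'g set \<Rightarrow> ('g \<Rightarrow> complex) set" where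
  "B_P G P = {f \<in> linfty P. \<forall>\<epsilon>>0. \<exists>g\<in>span_one_P G P. \<forall>r\<in>P. cmod (f r - g r) \<le> \<epsilon>}"

text \<open>The action $\tau$ is translation; see \<open>tau_one_P\<close>, \<open>tau_B_P\<close> and \<open>tau_tau\<close> below, and
  \<open>tau_unique\<close> for the fact that it is determined by $\tau_s(1_t)=1_{st}$.\<close>

definition tau :: "('g, 'm) monoid_scheme \<Rightarrow> 'g set \<Rightarrow> 'g \<Rightarrow> ('g \<Rightarrow> complex) \<Rightarrow> 'g \<Rightarrow> complex" where
  "tau G P s f = (\<lambda>r. if r \<in> s <#\<^bsub>G\<^esub> P then f (inv\<^bsub>G\<^esub> s \<otimes>\<^bsub>G\<^esub> r) else 0)"

definition B_P_rep :: "('g, 'm) monoid_scheme \<Rightarrow> 'g set \<Rightarrow>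
    (('g \<Rightarrow> complex) \<Rightarrow> 'h::complex_hilbert \<Rightarrow> 'h) \<Rightarrow> bool" where
  "B_P_rep G P L \<longleftrightarrow> star_rep (B_P G P) (\<lambda>f g r. f r + g r) (\<lambda>c f r. c * f r)
     (\<lambda>f g r. f r * g r) (\<lambda>f r. cnj (f r)) L"

definition covariant_rep :: "('g, 'm) monoid_scheme \<Rightarrow> 'g set \<Rightarrow>
    ('g, 'a::cstar_algebra, 'x) prodsys \<Rightarrow>
    (('g \<Rightarrow> complex) \<Rightarrow> 'h::complex_hilbert \<Rightarrow> 'h) \<Rightarrow> ('x \<Rightarrow> 'h \<Rightarrow> 'h) \<Rightarrow> bool" where
  "covariant_rep G P X L \<psi> \<longleftrightarrow>
     B_P_rep G P L \<and> nondegenerate (L ` B_P G P) \<and>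
     nondegenerate_toeplitz_rep P X \<psi> \<and>
     L ` B_P G P \<subseteq> commutant X \<psi> \<and>
     (\<forall>s\<in>P. \<forall>f\<in>B_P G P. L (tau G P s f) = alpha X \<psi> s (L f))"

context quasi_lattice_ordered
begin

lemma P_carrier: "s \<in> P \<Longrightarrow> s \<in> carrier G"
  using subset by blast

lemma inv_mult_cancel: "\<lbrakk>s \<in> carrier G; t \<in> carrier G\<rbrakk> \<Longrightarrow> inv s \<otimes> (s \<otimes> t) = t"
  by (simp add: m_assoc[symmetric] l_inv)

lemma mult_inv_cancel: "\<lbrakk>s \<in> carrier G; t \<in> carrier G\<rbrakk> \<Longrightarrow> s \<otimes> (inv s \<otimes> t) = t"
  by (simp add: m_assoc[symmetric] r_inv)

lemma mem_coset_iff: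
  assumes "s \<in> P"
  shows "r \<in> s <# P \<longleftrightarrow> r \<in> carrier G \<and> inv s \<otimes> r \<in> P"
proof
  assume "r \<in> s <# P"
  then obtain p where "p \<in> P" "r = s \<otimes> p" by (auto simp: l_coset_def)
  with assms show "r \<in> carrier G \<and> inv s \<otimes> r \<in> P"
    by (simp add: P_carrier inv_mult_cancel)
next
  assume r: "r \<in> carrier G \<and> inv s \<otimes> r \<in> P"
  then have "r = s \<otimes> (inv s \<otimes> r)"
    using assms by (simp add: P_carrier mult_inv_cancel)
  with r show "r \<in> s <# P" by (auto simp: l_coset_def)
qed

lemma coset_subset: "s \<in> P \<Longrightarrow> s <# P \<subseteq> P"
  by (auto simp: l_coset_def)

lemma coset_mult_subset:
  assumes "s \<in> P" "t \<in> P"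
  shows "(s \<otimes> t) <# P \<subseteq> s <# P"
proof
  fix r assume "r \<in> (s \<otimes> t) <# P"
  then obtain p where p: "p \<in> P" "r = s \<otimes> t \<otimes> p" by (auto simp: l_coset_def)
  then have "r = s \<otimes> (t \<otimes> p)" using assms by (simp add: P_carrier m_assoc)
  moreover have "t \<otimes> p \<in> P" using assms p by simp
  ultimately show "r \<in> s <# P" unfolding l_coset_def by blast
qed

lemma inv_mult_mem_iff:
  assumes "s \<in> P" "t \<in> P" "r \<in> carrier G"
  shows "inv s \<otimes> r \<in> t <# P \<longleftrightarrow> r \<in> (s \<otimes> t) <# P"
  using assms by (simp add: mem_coset_iff P_carrier inv_mult_group m_assoc)

lemma tau_one_P:
  assumes "s \<in> P" "t \<in> P"
  shows "tau G P s (one_P G P t) = one_P G P (s \<otimes> t)"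
proof
  fix r
  have "r \<in> s <# P \<Longrightarrow> r \<in> carrier G"
    using coset_subset[OF assms(1)] P_carrier by blast
  then show "tau G P s (one_P G P t) r = one_P G P (s \<otimes> t) r"
    using inv_mult_mem_iff[OF assms] coset_mult_subset[OF assms]
    by (auto simp: tau_def one_P_def indicator_def)
qed

lemma one_P_B_P:
  assumes "t \<in> P"
  shows "one_P G P t \<in> B_P G P"
proof -
  have "one_P G P t \<in> span_one_P G P"
    unfolding span_one_P_def using assms
    by (intro CollectI exI[of _ "{t}"] exI[of _ "\<lambda>_. 1"]) auto
  moreover have "bounded (range (one_P G P t))"
    by (rule finite_imp_bounded) (rule finite_subset[of _ "{0, 1}"], auto simp: one_P_def indicator_def)
  moreover have "\<forall>r. r \<notin> P \<longrightarrow> one_P G P t r = 0"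
    using coset_subset[OF assms] by (auto simp: one_P_def indicator_def)
  ultimately show ?thesis
    unfolding B_P_def linfty_def by (auto intro!: bexI[of _ "one_P G P t"])
qed

lemma tau_B_P:
  assumes s: "s \<in> P" and f: "f \<in> B_P G P"
  shows "tau G P s f \<in> B_P G P"
proof -
  have mem: "inv s \<otimes> r \<in> P" if "r \<in> s <# P" for r
    using that s by (simp add: mem_coset_iff)
  have b: "bounded (range f)" and z: "\<And>r. r \<notin> P \<Longrightarrow> f r = 0"
    using f by (auto simp: B_P_def linfty_def)
  have "bounded (range (tau G P s f))"
    by (rule bounded_subset[of "insert 0 (range f)"]) (use b in \<open>auto simp: tau_def\<close>)
  moreover have "\<forall>r. r \<notin> P \<longrightarrow> tau G P s f r = 0"
    using coset_subset[OF s] by (auto simp: tau_def)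
  moreover have "\<exists>g\<in>span_one_P G P. \<forall>r\<in>P. cmod (tau G P s f r - g r) \<le> \<epsilon>" if e: "\<epsilon> > 0" for \<epsilon> :: real
  proof -
    obtain g where g: "g \<in> span_one_P G P" "\<And>r. r \<in> P \<Longrightarrow> cmod (f r - g r) \<le> \<epsilon>"
      using f e by (auto simp: B_P_def)
    then obtain F c where F: "finite F" "F \<subseteq> P" "g = (\<lambda>r. \<Sum>t\<in>F. c t * one_P G P t r)"
      by (auto simp: span_one_P_def)
    have sc: "s \<in> carrier G" using s subset by auto
    have inj: "inj_on ((\<otimes>) s) F"
      by (rule inj_onI) (use F(2) sc P_carrier in \<open>metis Units_eq Units_l_cancel subsetD\<close>)
    have "tau G P s g = (\<lambda>r. \<Sum>t\<in>F. c t * tau G P s (one_P G P t) r)"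
      by (auto simp: tau_def F(3) fun_eq_iff)
    also have "\<dots> = (\<lambda>r. \<Sum>t\<in>F. c t * one_P G P (s \<otimes> t) r)"
    proof (rule ext, rule sum.cong[OF refl])
      fix r t assume "t \<in> F"
      then have "t \<in> P" using F(2) by blast
      then show "c t * tau G P s (one_P G P t) r = c t * one_P G P (s \<otimes> t) r"
        by (simp add: tau_one_P[OF s])
    qed
    also have "\<dots> = (\<lambda>r. \<Sum>u\<in>(\<otimes>) s ` F. c (inv s \<otimes> u) * one_P G P u r)"
    proof -
      have "inv s \<otimes> (s \<otimes> t) = t" if "t \<in> F" for t
        using that F(2) sc P_carrier
        by (simp add: inv_mult_cancel subset_iff)
      then show ?thesis by (simp add: sum.reindex[OF inj] fun_eq_iff)
    qed
    finally have "tau G P s g \<in> span_one_P G P"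
      unfolding span_one_P_def using F(1,2) s
      by (intro CollectI exI[of _ "(\<otimes>) s ` F"] exI[of _ "\<lambda>u. c (inv s \<otimes> u)"]) auto
    then show ?thesis
      by (rule bexI[rotated]) (use g(2) mem e in \<open>auto simp: tau_def\<close>)
  qed
  ultimately show ?thesis by (auto simp: B_P_def linfty_def)
qed

lemma tau_star_hom:
  "tau G P s (\<lambda>r. f r + g r) = (\<lambda>r. tau G P s f r + tau G P s g r)"
  "tau G P s (\<lambda>r. c * f r) = (\<lambda>r. c * tau G P s f r)"
  "tau G P s (\<lambda>r. f r * g r) = (\<lambda>r. tau G P s f r * tau G P s g r)"
  "tau G P s (\<lambda>r. cnj (f r)) = (\<lambda>r. cnj (tau G P s f r))"
  by (auto simp: tau_def)

lemma tau_tau: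
  assumes s: "s \<in> P" and t: "t \<in> P"
  shows "tau G P s (tau G P t f) = tau G P (s \<otimes> t) f"
proof
  fix r
  have c: "r \<in> s <# P \<Longrightarrow> r \<in> carrier G" using mem_coset_iff[OF s] by blast
  moreover have "r \<in> carrier G \<Longrightarrow> inv t \<otimes> (inv s \<otimes> r) = inv (s \<otimes> t) \<otimes> r"
    using s t by (simp add: inv_mult_group m_assoc P_carrier)
  ultimately show "tau G P s (tau G P t f) r = tau G P (s \<otimes> t) f r"
    using inv_mult_mem_iff[OF s t, of r] coset_mult_subset[OF s t] by (auto simp: tau_def)
qed

lemma B_P_add:
  assumes "f \<in> B_P G P" "g \<in> B_P G P"
  shows "(\<lambda>r. f r + g r) \<in> B_P G P"
proof -
  have "bounded (range (\<lambda>r. f r + g r))"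
    using assms by (auto simp: B_P_def linfty_def intro: bounded_plus_comp)
  moreover have "\<exists>h\<in>span_one_P G P. \<forall>r\<in>P. cmod ((f r + g r) - h r) \<le> \<epsilon>" if e: "\<epsilon> > 0" for \<epsilon> :: real
  proof -
    have "\<exists>f'\<in>span_one_P G P. \<forall>r\<in>P. cmod (f r - f' r) \<le> \<epsilon>/2"
      using assms(1) half_gt_zero[OF e] unfolding B_P_def by blast
    then obtain f' where f': "f' \<in> span_one_P G P" "\<forall>r\<in>P. cmod (f r - f' r) \<le> \<epsilon>/2" ..
    have "\<exists>g'\<in>span_one_P G P. \<forall>r\<in>P. cmod (g r - g' r) \<le> \<epsilon>/2"
      using assms(2) half_gt_zero[OF e] unfolding B_P_def by blast
    then obtain g' where g': "g' \<in> span_one_P G P" "\<forall>r\<in>P. cmod (g r - g' r) \<le> \<epsilon>/2" ..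
    obtain F c F' c' where F: "finite F" "F \<subseteq> P" "f' = (\<lambda>r. \<Sum>t\<in>F. c t * one_P G P t r)"
      and F': "finite F'" "F' \<subseteq> P" "g' = (\<lambda>r. \<Sum>t\<in>F'. c' t * one_P G P t r)"
      using f'(1) g'(1) unfolding span_one_P_def by blast
    define d where "d t = (if t \<in> F then c t else 0) + (if t \<in> F' then c' t else 0)" for t
    have "(\<Sum>t\<in>F\<union>F'. d t * one_P G P t r) = f' r + g' r" for r
    proof -
      have "(\<Sum>t\<in>F\<union>F'. d t * one_P G P t r) =
          (\<Sum>t\<in>F\<union>F'. if t \<in> F then c t * one_P G P t r else 0) +
          (\<Sum>t\<in>F\<union>F'. if t \<in> F' then c' t * one_P G P t r else 0)"
        by (subst sum.distrib[symmetric], rule sum.cong) (auto simp: d_def algebra_simps)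
      also have "(\<Sum>t\<in>F\<union>F'. if t \<in> F then c t * one_P G P t r else 0) = f' r"
        unfolding F(3) by (rule sum.mono_neutral_cong_right) (use F(1) F'(1) in \<open>auto\<close>)
      also have "(\<Sum>t\<in>F\<union>F'. if t \<in> F' then c' t * one_P G P t r else 0) = g' r"
        unfolding F'(3) by (rule sum.mono_neutral_cong_right) (use F(1) F'(1) in \<open>auto\<close>)
      finally show ?thesis .
    qed
    then have "(\<lambda>r. f' r + g' r) \<in> span_one_P G P"
      unfolding span_one_P_def using F(1,2) F'(1,2)
      by (intro CollectI exI[of _ "F \<union> F'"] exI[of _ d]) auto
    moreover have "cmod ((f r + g r) - (f' r + g' r)) \<le> \<epsilon>" if "r \<in> P" for r
      using norm_diff_triangle_le[of "f r + g r" "f' r + g r" "\<epsilon>/2" "f' r + g' r" "\<epsilon>/2"]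
        bspec[OF f'(2) that] bspec[OF g'(2) that] by simp
    ultimately show ?thesis by (auto intro: rev_bexI)
  qed
  ultimately show ?thesis using assms by (simp add: B_P_def linfty_def)
qed

lemma B_P_scale:
  assumes "f \<in> B_P G P"
  shows "(\<lambda>r. c * f r) \<in> B_P G P"
proof -
  have "bounded (range (\<lambda>r. c * f r))"
  proof -
    obtain K where "\<And>r. cmod (f r) \<le> K"
      using assms by (auto simp: B_P_def linfty_def bounded_iff)
    then have "\<And>r. cmod (c * f r) \<le> cmod c * K" by (simp add: norm_mult mult_left_mono)
    then show ?thesis by (auto simp: bounded_iff)
  qed
  moreover have "\<exists>h\<in>span_one_P G P. \<forall>r\<in>P. cmod (c * f r - h r) \<le> \<epsilon>" if e: "\<epsilon> > 0" for \<epsilon> :: real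
  proof -
    have "\<epsilon> / (cmod c + 1) > 0" using e by (simp add: add_nonneg_pos)
    then obtain f' where f': "f' \<in> span_one_P G P"
        "\<And>r. r \<in> P \<Longrightarrow> cmod (f r - f' r) \<le> \<epsilon> / (cmod c + 1)"
      using assms by (auto simp: B_P_def)
    obtain F d where F: "finite F" "F \<subseteq> P" "f' = (\<lambda>r. \<Sum>t\<in>F. d t * one_P G P t r)"
      using f'(1) by (auto simp: span_one_P_def)
    have "(\<lambda>r. c * f' r) \<in> span_one_P G P"
      unfolding span_one_P_def using F
      by (intro CollectI exI[of _ F] exI[of _ "\<lambda>t. c * d t"]) (auto simp: sum_distrib_left mult.assoc)
    moreover have "cmod (c * f r - c * f' r) \<le> \<epsilon>" if "r \<in> P" for r
    proof -
      have "cmod (c * f r - c * f' r) = cmod c * cmod (f r - f' r)"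
        by (simp add: norm_mult[symmetric] algebra_simps)
      also have "\<dots> \<le> (cmod c + 1) * (\<epsilon> / (cmod c + 1))"
        using f'(2)[OF that] by (intro mult_mono) auto
      also have "\<dots> = \<epsilon>" by (simp add: add_nonneg_eq_0_iff)
      finally show ?thesis .
    qed
    ultimately show ?thesis by (auto intro: rev_bexI)
  qed
  ultimately show ?thesis using assms by (simp add: B_P_def linfty_def)
qed

lemma tau_unique:
  assumes s: "s \<in> P"
    and add: "\<And>f g. \<lbrakk>f \<in> B_P G P; g \<in> B_P G P\<rbrakk> \<Longrightarrow> \<sigma> (\<lambda>r. f r + g r) = (\<lambda>r. \<sigma> f r + \<sigma> g r)"
    and scale: "\<And>c f. f \<in> B_P G P \<Longrightarrow> \<sigma> (\<lambda>r. c * f r) = (\<lambda>r. c * \<sigma> f r)"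
    and cont: "\<And>f K. \<lbrakk>f \<in> B_P G P; \<And>r. cmod (f r) \<le> K\<rbrakk> \<Longrightarrow> \<forall>r. cmod (\<sigma> f r) \<le> C * K"
    and one: "\<And>t. t \<in> P \<Longrightarrow> \<sigma> (one_P G P t) = one_P G P (s \<otimes> t)"
    and f: "f \<in> B_P G P"
  shows "\<sigma> f = tau G P s f"
proof
  fix r
  have fin: "(\<lambda>r. \<Sum>t\<in>F. c t * one_P G P t r) \<in> B_P G P \<and>
      \<sigma> (\<lambda>r. \<Sum>t\<in>F. c t * one_P G P t r) = tau G P s (\<lambda>r. \<Sum>t\<in>F. c t * one_P G P t r)"
    if "finite F" "F \<subseteq> P" for F c
    using that
  proof (induction F rule: finite_induct)
    case empty
    have z: "(\<lambda>r. 0 * one_P G P \<one> r) \<in> B_P G P" by (intro B_P_scale one_P_B_P) simp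
    have "\<sigma> (\<lambda>r. 0 * one_P G P \<one> r) = (\<lambda>r. 0)" using scale[OF one_P_B_P[of \<one>], of 0] by simp
    with z show ?case by (simp add: tau_def)
  next
    case (insert t F)
    let ?g = "\<lambda>r. \<Sum>t\<in>F. c t * one_P G P t r" and ?h = "\<lambda>r. c t * one_P G P t r"
    have t: "t \<in> P" and IH: "?g \<in> B_P G P" "\<sigma> ?g = tau G P s ?g" using insert by auto
    have h: "?h \<in> B_P G P" by (intro B_P_scale one_P_B_P t)
    have "\<sigma> ?h = tau G P s ?h"
      using scale[OF one_P_B_P[OF t], of "c t"] one[OF t] tau_one_P[OF s t]
      by (simp add: tau_star_hom)
    then have "\<sigma> (\<lambda>r. ?h r + ?g r) = tau G P s (\<lambda>r. ?h r + ?g r)"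
      using add[OF h IH(1)] IH(2) by (simp add: tau_star_hom)
    then show ?case using insert B_P_add[OF h IH(1)] by simp
  qed
  have bound: "cmod (\<sigma> f r - tau G P s f r) \<le> (\<bar>C\<bar> + 1) * \<epsilon>" if e: "\<epsilon> > 0" for \<epsilon> :: real
  proof -
    obtain g where g: "g \<in> span_one_P G P" "\<And>r. r \<in> P \<Longrightarrow> cmod (f r - g r) \<le> \<epsilon>"
      using f e by (auto simp: B_P_def)
    then have gB: "g \<in> B_P G P" and gs: "\<sigma> g = tau G P s g"
      using fin by (auto simp: span_one_P_def)
    define d where "d = (\<lambda>r. f r + (-1) * g r)"
    have d: "d \<in> B_P G P" unfolding d_def by (intro B_P_add f B_P_scale gB)
    have de: "cmod (d r) \<le> \<epsilon>" for r
      using g(2)[of r] d e by (cases "r \<in> P") (auto simp: d_def B_P_def linfty_def)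
    have "cmod (\<sigma> d r) \<le> C * \<epsilon>" using cont[OF d de] by blast
    also have "\<dots> \<le> \<bar>C\<bar> * \<epsilon>" using e by (intro mult_right_mono) auto
    finally have 1: "cmod (\<sigma> d r) \<le> \<bar>C\<bar> * \<epsilon>" .
    have 2: "cmod (tau G P s d r) \<le> \<epsilon>" using de e by (auto simp: tau_def)
    have "\<sigma> d = (\<lambda>r. \<sigma> f r - \<sigma> g r)"
      unfolding d_def using add[OF f B_P_scale[OF gB, of "-1"]] scale[OF gB, of "-1"] by simp
    moreover have "tau G P s d = (\<lambda>r. tau G P s f r - tau G P s g r)"
      by (auto simp: tau_def d_def)
    ultimately have "\<sigma> f r - tau G P s f r = \<sigma> d r - tau G P s d r" using gs by simp
    also have "cmod \<dots> \<le> \<bar>C\<bar> * \<epsilon> + \<epsilon>" using norm_triangle_ineq4 1 2 by (smt (verit))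
    finally show ?thesis by (simp add: algebra_simps)
  qed
  have "cmod (\<sigma> f r - tau G P s f r) \<le> 0"
  proof (rule field_le_epsilon)
    fix e :: real assume e: "0 < e"
    have "\<bar>C\<bar> + 1 > 0" by simp
    then show "cmod (\<sigma> f r - tau G P s f r) \<le> 0 + e"
      using bound[of "e / (\<bar>C\<bar> + 1)"] e by simp
  qed
  then show "\<sigma> f r = tau G P s f r" by simp
qed

end

end

theory Submission
  imports Defs
begin

text \<open>
  The existence of the endomorphism $\alpha^\psi_s$ rests on the estimate
  $\|\sum\psi(x_i)Sh_i\|\le\|S\|\,\|\sum\psi(x_i)h_i\|$ for $S$ in the commutant. The operators
  $R=S^*S$ act symmetrically on the vectors $\xi=\sum\psi(x_i)h_i$, so the norms of $R^n\xi$ form a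
  log-convex sequence, which grows at most like $\|R\|^n$; hence $\|R\xi\|\le\|R\|\,\|\xi\|$.

  In (1), \<open>L\<close> is unital by nondegeneracy, so covariance at $1_e$ gives $L(1_s)=\alpha^\psi_s(1)$, and
  Nica covariance is the relation $1_s1_t=1_{s\vee t}$ in $B_P$. In (2), the projections
  $p_s=\alpha^\psi_s(1)$ satisfy $\|\sum c_tp_t\|\le\sup_r|\sum c_t1_t(r)|$: a joint eigenvector of the
  $p_t$ occurring in the sum lies in the range of some $p_u$ and is annihilated by the $p_t$ with
  $t\not\le u$, so its eigenvalue is the value of the step function at $u$. Covariance of the
  extension follows from $\alpha^\psi_s(p_t)=p_{st}$, which expresses $X_{st}=X_s\otimes_AX_t$.
\<close>

section \<open>Operators on Hilbert spaces\<close>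

text \<open>On the range of \<open>\<psi>\<close> over the fibre at \<open>s\<close>, the operator
  belonging to \<open>S\<close> should act as the identity tensor \<open>S\<close> on the tensor
  product of the fibre with the Hilbert space. A vector has many expressions as a sum, so a norm
  estimate must make this well defined. The usual source is positivity of the matrix of inner
  products over \<open>A\<close>; log-convexity needs only scalars and Cauchy-Schwarz, and
  \<open>S\<close> is replaced by its square \<open>R\<close> because symmetry of \<open>R\<close>
  is what relates three consecutive norms. Since \<open>alpha\<close> is a definite description,
  existence and uniqueness of the whole endomorphism precede any use of it. A second obstacle is
  density: \<open>essential\<close> and \<open>fibre_tensor\<close> speak of the norm of a module,
  the range projections of closed spans of vectors. The passage needs \<open>\<psi>\<close> to be
  contractive on fibres, hence contractivity of the representation of \<open>A\<close>, which
  \<open>star_rep\<close> does not include. Moreover \<open>fibre_tensor\<close> covers only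
  nontrivial degrees; at the identity, essential fibres and nondegeneracy together give that the
  projection is \<open>id\<close>.\<close>

lemma cinner_add_left: "cinner (x + y) z = cinner x z + cinner y (z::'h::complex_hilbert)"
  by (metis cinner_add_right cinner_commute complex_cnj_add)

lemma cinner_scaleC_left: "cinner (c *\<^sub>C x) z = cnj c * cinner x (z::'h::complex_hilbert)"
  by (metis cinner_commute cinner_scaleC_right complex_cnj_mult)

lemma cinner_zero [simp]: "cinner 0 x = 0" "cinner x 0 = (0::complex)" for x :: "'h::complex_hilbert"
  using cinner_scaleC_left[of 0 0 x] cinner_scaleC_right[of x 0 0] by simp_all

lemma cinner_minus [simp]: "cinner (- x) y = - cinner x y" "cinner x (- y) = - cinner x (y::'h::complex_hilbert)"
  using cinner_scaleC_left[of "-1" x y] cinner_scaleC_right[of x "-1" y] by simp_all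

lemma cinner_diff_left: "cinner (x - y) z = cinner x z - cinner y (z::'h::complex_hilbert)"
  using cinner_add_left[of x "- y" z] by simp

lemma cinner_diff_right: "cinner x (y - z) = cinner x y - cinner x (z::'h::complex_hilbert)"
  using cinner_add_right[of x y "- z"] by simp

lemma cinner_self_eq_0_iff [simp]: "cinner x x = 0 \<longleftrightarrow> x = (0::'h::complex_hilbert)"
  by (simp add: cinner_self)

lemma cinner_eqI:
  assumes "\<And>z. cinner z x = cinner z (y::'h::complex_hilbert)"
  shows "x = y"
  using assms[of "x - y"] cinner_self_eq_0_iff[of "x - y"] by (simp add: cinner_diff_right)

lemma norm_add_sq:
  "(norm (x + y))\<^sup>2 = (norm x)\<^sup>2 + 2 * Re (cinner x y) + (norm (y::'h::complex_hilbert))\<^sup>2"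
proof -
  have "complex_of_real ((norm (x + y))\<^sup>2) = cinner x x + (cinner x y + cinner y x) + cinner y y"
    by (simp add: cinner_self[symmetric] cinner_add_left cinner_add_right algebra_simps del: of_real_power)
  also have "cinner x y + cinner y x = complex_of_real (2 * Re (cinner x y))"
    by (subst cinner_commute[of y x]) (simp add: complex_add_cnj)
  finally have "complex_of_real ((norm (x + y))\<^sup>2) =
      complex_of_real ((norm x)\<^sup>2 + 2 * Re (cinner x y) + (norm y)\<^sup>2)"
    by (simp add: cinner_self)
  then show ?thesis by (simp only: of_real_eq_iff)
qed

lemma norm_diff_sq:
  "(norm (x - y))\<^sup>2 = (norm x)\<^sup>2 - 2 * Re (cinner x y) + (norm (y::'h::complex_hilbert))\<^sup>2"
  using norm_add_sq[of x "- y"] by simp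

lemma Re_cinner_le: "Re (cinner x y) \<le> norm x * norm (y::'h::complex_hilbert)"
proof (cases "x = 0 \<or> y = 0")
  case False
  then have pos: "norm x > 0" "norm y > 0" by auto
  have "0 \<le> (norm (norm y *\<^sub>R x - norm x *\<^sub>R y))\<^sup>2" by simp
  also have "\<dots> = 2 * (norm x * norm y) * (norm x * norm y - Re (cinner x y))"
    unfolding norm_diff_sq
    by (simp add: scaleR_scaleC cinner_scaleC_left cinner_scaleC_right norm_scaleC power2_eq_square algebra_simps)
  finally have "0 \<le> norm x * norm y - Re (cinner x y)"
    using pos mult_pos_pos[OF pos] by (simp add: zero_le_mult_iff del: mult_pos_pos)
  then show ?thesis by simp
qed auto

lemma cauchy_schwarz: "cmod (cinner x y) \<le> norm x * norm (y::'h::complex_hilbert)"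
proof (cases "cinner x y = 0")
  case False
  \<comment> \<open>The phase that turns the inner product into its modulus, so that the bound on
    real parts applies.\<close>
  define c where "c = cnj (cinner x y) / cmod (cinner x y)"
  have c: "cmod c = 1" using False by (simp add: c_def norm_divide)
  have "cinner x (c *\<^sub>C y) = cmod (cinner x y)"
    using False complex_norm_square[of "cinner x y"]
    by (simp add: c_def cinner_scaleC_right power2_eq_square mult.commute divide_eq_eq)
  then have "cmod (cinner x y) \<le> norm x * norm (c *\<^sub>C y)"
    using Re_cinner_le[of x "c *\<^sub>C y"] by simp
  then show ?thesis by (simp add: norm_scaleC c)
qed simp

lemma bounded_bilinear_cinner:
  "bounded_bilinear (cinner :: 'h::complex_hilbert \<Rightarrow> 'h \<Rightarrow> complex)"
proof
  show "\<exists>K. \<forall>a b::'h. norm (cinner a b) \<le> norm a * norm b * K"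
    by (rule exI[of _ 1]) (simp add: cauchy_schwarz)
qed (auto simp: cinner_add_left cinner_add_right scaleR_scaleC cinner_scaleC_left
      cinner_scaleC_right scaleR_conv_of_real)

lemmas continuous_on_cinner [continuous_intros] = bounded_bilinear.continuous_on[OF bounded_bilinear_cinner]

lemma tendsto_scaleC [tendsto_intros]:
  "f \<longlonglongrightarrow> l \<Longrightarrow> (\<lambda>n. c *\<^sub>C f n) \<longlonglongrightarrow> c *\<^sub>C (l::'h::complex_banach)"
proof -
  have "bounded_linear (scaleC c :: 'h \<Rightarrow> 'h)"
  proof
    show "\<exists>K. \<forall>x::'h. norm (c *\<^sub>C x) \<le> norm x * K"
      by (rule exI[of _ "cmod c"]) (simp add: norm_scaleC)
  qed (auto simp: scaleC_add_right scaleR_scaleC scaleC_scaleC mult.commute)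
  then show "f \<longlonglongrightarrow> l \<Longrightarrow> (\<lambda>n. c *\<^sub>C f n) \<longlonglongrightarrow> c *\<^sub>C l"
    by (rule bounded_linear.tendsto)
qed

section \<open>Orthogonal projection onto a closed subspace\<close>

lemma closure_csubspace:
  assumes "complex_vs.subspace (V::'h::complex_banach set)"
  shows "complex_vs.subspace (closure V)"
proof (rule complex_vs.subspaceI)
  show "0 \<in> closure V" using complex_vs.subspace_0[OF assms] closure_subset by blast
next
  fix x y assume "x \<in> closure V" "y \<in> closure V"
  then obtain f g where "\<And>n. f n \<in> V" "f \<longlonglongrightarrow> x" "\<And>n. g n \<in> V" "g \<longlonglongrightarrow> y"
    by (auto simp: closure_sequential)
  then have "\<And>n. f n + g n \<in> V" "(\<lambda>n. f n + g n) \<longlonglongrightarrow> x + y"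
    using complex_vs.subspace_add[OF assms] by (auto intro: tendsto_add)
  then show "x + y \<in> closure V" by (auto simp: closure_sequential intro!: exI[of _ "\<lambda>n. f n + g n"])
next
  fix c x assume "x \<in> closure V"
  then obtain f where "\<And>n. f n \<in> V" "f \<longlonglongrightarrow> x" by (auto simp: closure_sequential)
  then have "\<And>n. c *\<^sub>C f n \<in> V" "(\<lambda>n. c *\<^sub>C f n) \<longlonglongrightarrow> c *\<^sub>C x"
    using complex_vs.subspace_scale[OF assms] by (auto intro: tendsto_scaleC)
  then show "c *\<^sub>C x \<in> closure V" by (auto simp: closure_sequential intro!: exI[of _ "\<lambda>n. c *\<^sub>C f n"])
qed

text \<open>Subtracting from \<open>z\<close> its component along \<open>w\<close> lowers the
  squared norm by |<w,z>|^2 / |w|^2; minimality therefore forces <w,z> = 0. The constant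
  \<open>c\<close> in the proof is the coefficient of that component.\<close>

lemma min_norm_orthogonal:
  assumes V: "complex_vs.subspace (V::'h::complex_hilbert set)"
    and min: "\<And>w. w \<in> V \<Longrightarrow> norm z \<le> norm (z - w)" and w: "w \<in> V"
  shows "cinner w z = 0"
proof (cases "w = 0")
  case False
  define c where "c = cinner w z / (norm w)\<^sup>2"
  have "c *\<^sub>C w \<in> V" using complex_vs.subspace_scale[OF V w] .
  then have "(norm z)\<^sup>2 \<le> (norm (z - c *\<^sub>C w))\<^sup>2" using min by (simp add: power_mono)
  also have "\<dots> = (norm z)\<^sup>2 - 2 * Re (c * cinner z w) + (cmod c)\<^sup>2 * (norm w)\<^sup>2"
    unfolding norm_diff_sq by (simp add: cinner_scaleC_right norm_scaleC power_mult_distrib)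
  also have "c * cinner z w = complex_of_real ((cmod (cinner w z))\<^sup>2 / (norm w)\<^sup>2)"
    by (subst cinner_commute[of z w]) (simp add: c_def complex_norm_square[symmetric] del: complex_norm_square)
  also have "(cmod c)\<^sup>2 * (norm w)\<^sup>2 = (cmod (cinner w z))\<^sup>2 / (norm w)\<^sup>2"
    using False by (simp add: c_def norm_divide power_divide norm_mult power2_eq_square)
  finally have "(cmod (cinner w z))\<^sup>2 / (norm w)\<^sup>2 \<le> 0" by simp
  then show ?thesis using False by (simp add: divide_le_0_iff)
qed simp

text \<open>Midpoints of a minimizing sequence stay in \<open>V\<close>, hence at distance at least
  \<open>d\<close> from \<open>x\<close>; by the parallelogram law the sequence is Cauchy. Its limit
  attains the distance, and minimality gives orthogonality.\<close>

lemma orthogonal_projection: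
  assumes V: "complex_vs.subspace (V::'h::complex_hilbert set)" and cl: "closed V"
  shows "\<exists>v\<in>V. \<forall>w\<in>V. cinner w (x - v) = 0"
proof -
  define D where "D = (\<lambda>v. norm (x - v)) ` V"
  define d where "d = Inf D"
  have ne: "D \<noteq> {}" using complex_vs.subspace_0[OF V] by (auto simp: D_def)
  have bdd: "bdd_below D" by (rule bdd_belowI[of _ 0]) (auto simp: D_def)
  have d_le: "d \<le> norm (x - v)" if "v \<in> V" for v
    unfolding d_def using that bdd by (intro cInf_lower) (auto simp: D_def)
  have d0: "d \<ge> 0" unfolding d_def using ne by (intro cInf_greatest) (auto simp: D_def)
  have "\<exists>v\<in>V. norm (x - v) < d + 1 / (real n + 1)" for n
  proof -
    have "Inf D < d + 1 / (real n + 1)" by (simp add: d_def)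
    then show ?thesis using cInf_lessD[OF ne] by (auto simp: D_def)
  qed
  then obtain v where v: "\<And>n. v n \<in> V" "\<And>n. norm (x - v n) < d + 1 / (real n + 1)" by metis
  have lim: "(\<lambda>n. norm (x - v n)) \<longlonglongrightarrow> d"
  proof (rule tendsto_sandwich)
    show "(\<lambda>n. d) \<longlonglongrightarrow> d" by simp
    show "(\<lambda>n. d + 1 / (real n + 1)) \<longlonglongrightarrow> d"
      using tendsto_add[OF tendsto_const[of d] LIMSEQ_inverse_real_of_nat]
      by (simp add: inverse_eq_divide add.commute)
  qed (use d_le[OF v(1)] less_imp_le[OF v(2)] in \<open>auto intro!: always_eventually\<close>)
  have par: "(norm (v m - v n))\<^sup>2 \<le> 2 * (norm (x - v m))\<^sup>2 + 2 * (norm (x - v n))\<^sup>2 - 4 * d\<^sup>2" for m n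
  proof -
    have "(1/2) *\<^sub>C (v m + v n) \<in> V"
      using complex_vs.subspace_scale[OF V complex_vs.subspace_add[OF V v(1) v(1)]] .
    then have "d \<le> norm (x - (1/2) *\<^sub>C (v m + v n))" by (rule d_le)
    then have "2 * d \<le> 2 * norm (x - (1/2) *\<^sub>C (v m + v n))" by simp
    also have "\<dots> = norm (2 *\<^sub>C (x - (1/2) *\<^sub>C (v m + v n)))" by (simp add: norm_scaleC)
    also have "2 *\<^sub>C (x - (1/2) *\<^sub>C (v m + v n)) = (x - v m) + (x - v n)"
    proof -
      have "2 *\<^sub>C x = x + x" using scaleC_add_left[of 1 1 x] by (simp add: scaleC_one)
      then show ?thesis
        by (simp add: complex_vs.scale_right_diff_distrib scaleC_scaleC scaleC_one algebra_simps)
    qed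
    finally have "(2 * d)\<^sup>2 \<le> (norm ((x - v m) + (x - v n)))\<^sup>2" using d0 by (intro power_mono) auto
    moreover have "(norm ((x - v n) - (x - v m)))\<^sup>2 + (norm ((x - v m) + (x - v n)))\<^sup>2
        = 2 * (norm (x - v m))\<^sup>2 + 2 * (norm (x - v n))\<^sup>2"
      unfolding norm_diff_sq[of "x - v n" "x - v m"] norm_add_sq[of "x - v m" "x - v n"]
      by (subst cinner_commute) (simp add: algebra_simps)
    ultimately show ?thesis by (simp add: power_mult_distrib)
  qed
  have "Cauchy v"
  proof (rule metric_CauchyI)
    fix e :: real assume e: "e > 0"
    have "(\<lambda>n. (norm (x - v n))\<^sup>2) \<longlonglongrightarrow> d\<^sup>2" by (intro tendsto_power lim)
    then have "\<forall>\<^sub>F n in sequentially. (norm (x - v n))\<^sup>2 < d\<^sup>2 + e\<^sup>2 / 4"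
      by (rule order_tendstoD) (use e in simp)
    then obtain N where N: "\<And>n. n \<ge> N \<Longrightarrow> (norm (x - v n))\<^sup>2 < d\<^sup>2 + e\<^sup>2 / 4"
      by (auto simp: eventually_sequentially)
    have "dist (v m) (v n) < e" if "m \<ge> N" "n \<ge> N" for m n
    proof -
      have "(norm (v m - v n))\<^sup>2 < e\<^sup>2" using par[of m n] N[OF that(1)] N[OF that(2)] by simp
      then show ?thesis using e by (simp add: dist_norm power2_less_imp_less)
    qed
    then show "\<exists>M. \<forall>m\<ge>M. \<forall>n\<ge>M. dist (v m) (v n) < e" by blast
  qed
  then obtain u where u: "v \<longlonglongrightarrow> u" using Cauchy_convergent convergent_def by blast
  have uV: "u \<in> V" using cl u v(1) closed_sequentially by blast
  have nu: "norm (x - u) = d"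
    using LIMSEQ_unique[OF tendsto_norm[OF tendsto_diff[OF tendsto_const u]] lim] .
  have "cinner w (x - u) = 0" if "w \<in> V" for w
  proof (rule min_norm_orthogonal[OF V _ that])
    fix w' assume "w' \<in> V"
    from d_le[OF complex_vs.subspace_add[OF V uV this]] nu
    show "norm (x - u) \<le> norm ((x - u) - w')" by (simp add: diff_diff_eq)
  qed
  then show ?thesis using uV by blast
qed

section \<open>Bounded operators, Riesz representation and adjoints\<close>

lemma bounded_opsI:
  assumes "\<And>x y. T (x + y) = T x + T y" "\<And>c x. T (c *\<^sub>C x) = c *\<^sub>C T x"
    "\<And>x. norm (T x) \<le> K * norm x"
  shows "T \<in> bounded_ops"
  using assms by (auto simp: bounded_ops_def)

lemma bounded_ops_add: "T \<in> bounded_ops \<Longrightarrow> T (x + y) = T x + T y"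
  and bounded_ops_scaleC: "T \<in> bounded_ops \<Longrightarrow> T (c *\<^sub>C x) = c *\<^sub>C T x"
  by (auto simp: bounded_ops_def)

lemma bounded_ops_bound:
  assumes "T \<in> bounded_ops"
  obtains K where "K \<ge> 0" "\<And>x. norm (T x) \<le> K * norm x"
proof -
  from assms obtain K where K: "\<And>x. norm (T x) \<le> K * norm x" by (auto simp: bounded_ops_def)
  show ?thesis
    by (rule that[of "max K 0"], simp, rule order_trans[OF K], rule mult_right_mono) auto
qed

lemma bounded_ops_0: "T \<in> bounded_ops \<Longrightarrow> T 0 = 0"
  using bounded_ops_scaleC[of T 0 0] by simp

lemma bounded_ops_minus: "T \<in> bounded_ops \<Longrightarrow> T (- x) = - T x"
  using bounded_ops_scaleC[of T "-1" x] by simp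

lemma bounded_ops_diff: "T \<in> bounded_ops \<Longrightarrow> T (x - y) = T x - T y"
  using bounded_ops_add[of T x "- y"] by (simp add: bounded_ops_minus)

lemma bounded_ops_bounded_linear:
  assumes "T \<in> bounded_ops" shows "bounded_linear T"
proof -
  obtain K where "\<And>x. norm (T x) \<le> K * norm x" using bounded_ops_bound[OF assms] by blast
  then show ?thesis
    using assms by (intro bounded_linear_intro[of T K])
      (auto simp: bounded_ops_add scaleR_scaleC bounded_ops_scaleC mult.commute)
qed

lemma id_bounded_ops [simp]: "id \<in> bounded_ops" 
  by (rule bounded_opsI[where K = 1]) auto

lemma zero_bounded_ops [simp]: "(\<lambda>_. 0) \<in> bounded_ops"
  by (rule bounded_opsI[where K = 0]) auto

lemma comp_bounded_ops:
  assumes "S \<in> bounded_ops" "T \<in> bounded_ops" shows "S \<circ> T \<in> bounded_ops"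
proof -
  obtain K where K: "K \<ge> 0" "\<And>x. norm (S x) \<le> K * norm x" using bounded_ops_bound[OF assms(1)] by blast
  obtain M where M: "M \<ge> 0" "\<And>x. norm (T x) \<le> M * norm x" using bounded_ops_bound[OF assms(2)] by blast
  have "norm (S (T x)) \<le> K * M * norm x" for x
    using order_trans[OF K(2) mult_left_mono[OF M(2) K(1)]] by (simp add: mult.assoc)
  then show ?thesis
    using assms by (intro bounded_opsI[where K = "K * M"]) (auto simp: bounded_ops_add bounded_ops_scaleC)
qed

lemma op_add_bounded_ops:
  assumes "S \<in> bounded_ops" "T \<in> bounded_ops" shows "op_add S T \<in> bounded_ops"
proof -
  obtain K where K: "K \<ge> 0" "\<And>x. norm (S x) \<le> K * norm x" using bounded_ops_bound[OF assms(1)] by blast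
  obtain M where M: "M \<ge> 0" "\<And>x. norm (T x) \<le> M * norm x" using bounded_ops_bound[OF assms(2)] by blast
  have "norm (S x + T x) \<le> (K + M) * norm x" for x
    using norm_triangle_mono[OF K(2) M(2)] by (simp add: algebra_simps)
  then show ?thesis
    using assms unfolding op_add_def by (intro bounded_opsI[where K = "K + M"])
      (auto simp: bounded_ops_add bounded_ops_scaleC scaleC_add_right)
qed

lemma op_scale_bounded_ops:
  assumes "T \<in> bounded_ops" shows "op_scale c T \<in> bounded_ops"
proof -
  obtain M where M: "M \<ge> 0" "\<And>x. norm (T x) \<le> M * norm x" using bounded_ops_bound[OF assms(1)] by blast
  have "norm (c *\<^sub>C T x) \<le> cmod c * M * norm x" for x
    using mult_left_mono[OF M(2), of "cmod c" x] by (simp add: norm_scaleC mult.assoc)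
  then show ?thesis
    using assms unfolding op_scale_def by (intro bounded_opsI[where K = "cmod c * M"])
      (auto simp: bounded_ops_add bounded_ops_scaleC scaleC_add_right scaleC_scaleC mult.commute)
qed

text \<open>The component \<open>z\<close> of \<open>x1\<close> orthogonal to the kernel of
  \<open>\<phi>\<close> spans the orthogonal complement of the kernel, so \<open>\<phi>\<close> is a
  multiple of the inner product with \<open>z\<close>.\<close>

lemma riesz_representation:
  fixes \<phi> :: "'h::complex_hilbert \<Rightarrow> complex"
  assumes add: "\<And>x y. \<phi> (x + y) = \<phi> x + \<phi> y" and scale: "\<And>c x. \<phi> (c *\<^sub>C x) = c * \<phi> x"
    and bd: "\<And>x. cmod (\<phi> x) \<le> K * norm x"
  shows "\<exists>y. \<forall>x. \<phi> x = cinner y x"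
proof (cases "\<forall>x. \<phi> x = 0")
  case True
  then show ?thesis by (intro exI[of _ 0]) simp
next
  case False
  then obtain x1 where x1: "\<phi> x1 \<noteq> 0" by blast
  define V where "V = {x. \<phi> x = 0}"
  have bl: "bounded_linear \<phi>"
    by (rule bounded_linear_intro[of \<phi> K])
      (auto simp: add scaleR_scaleC scale bd mult.commute scaleR_conv_of_real)
  have V: "complex_vs.subspace V"
    using scale[of 0 0] by (intro complex_vs.subspaceI) (auto simp: V_def add scale)
  have "closed V" unfolding V_def
    using bounded_linear.continuous_on[OF bl continuous_on_id]
    by (intro closed_Collect_eq) auto
  then obtain v where v: "\<phi> v = 0" "\<And>w. \<phi> w = 0 \<Longrightarrow> cinner w (x1 - v) = 0"
    using orthogonal_projection[OF V, of x1] by (auto simp: V_def)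
  define z where "z = x1 - v"
  have phz: "\<phi> z = \<phi> x1" using add[of z v] v(1) by (simp add: z_def)
  then have z0: "z \<noteq> 0" using x1 scale[of 0 0] by auto
  have "\<phi> x * (norm z)\<^sup>2 = \<phi> z * cinner z x" for x
  proof -
    \<comment> \<open>This combination lies in the kernel for every \<open>x\<close>, so pairing it
      with \<open>z\<close> expresses \<open>\<phi> x\<close> through
      \<open>cinner z x\<close>.\<close>
    have "\<phi> (\<phi> z *\<^sub>C x - \<phi> x *\<^sub>C z) = 0"
      using add[of "\<phi> z *\<^sub>C x" "(- \<phi> x) *\<^sub>C z"] scale[of "- \<phi> x" z] by (simp add: scale)
    then have "cinner (\<phi> z *\<^sub>C x - \<phi> x *\<^sub>C z) z = 0" using v(2) by (simp add: z_def)
    then have "cnj (\<phi> z) * cinner x z = cnj (\<phi> x) * cinner z z"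
      by (simp add: cinner_diff_left cinner_scaleC_left)
    then have "cnj (cnj (\<phi> z) * cinner x z) = cnj (cnj (\<phi> x) * (norm z)\<^sup>2)"
      by (simp add: cinner_self)
    then show ?thesis by (simp add: cinner_commute[of z x])
  qed
  then have "\<phi> x = cinner (cnj (\<phi> z / (norm z)\<^sup>2) *\<^sub>C z) x" for x
    using z0 by (simp add: cinner_scaleC_left field_simps)
  then show ?thesis by blast
qed

lemma adj_eqI:
  assumes "S \<in> bounded_ops" "\<And>x y. cinner (T x) y = cinner x (S y)"
  shows "adj T = S"
  unfolding adj_def
proof (rule the_equality)
  fix S' assume S': "S' \<in> bounded_ops \<and> (\<forall>x y. cinner (T x) y = cinner x (S' y))"
  show "S' = S" by (rule ext, rule cinner_eqI) (use S' assms in metis)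
qed (use assms in blast)

lemma adj_exists:
  assumes T: "T \<in> bounded_ops"
  shows "\<exists>S\<in>bounded_ops. \<forall>x y. cinner (T x) y = cinner x (S y)"
proof -
  obtain K where K: "K \<ge> 0" "\<And>x. norm (T x) \<le> K * norm x" using bounded_ops_bound[OF T] by blast
  have "\<exists>w. \<forall>x. cinner y (T x) = cinner w x" for y
  proof (rule riesz_representation)
    fix x
    have "cmod (cinner y (T x)) \<le> norm y * norm (T x)" by (rule cauchy_schwarz)
    also have "\<dots> \<le> norm y * (K * norm x)" by (intro mult_left_mono K) simp
    finally show "cmod (cinner y (T x)) \<le> (norm y * K) * norm x" by (simp add: mult.assoc)
  qed (simp_all add: bounded_ops_add[OF T] bounded_ops_scaleC[OF T] cinner_add_right cinner_scaleC_right)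
  then obtain S where "\<And>x y. cinner y (T x) = cinner (S y) x" by metis
  then have S: "cinner (T x) y = cinner x (S y)" for x y
    by (metis cinner_commute)
  have "norm (S y) \<le> K * norm y" for y
  proof (cases "S y = 0")
    case False
    have "complex_of_real ((norm (S y))\<^sup>2) = cinner (T (S y)) y" using S[of "S y" y] by (simp add: cinner_self)
    then have "(norm (S y))\<^sup>2 \<le> norm (T (S y)) * norm y"
      using cauchy_schwarz[of "T (S y)" y] by (metis norm_of_real abs_of_nonneg zero_le_power2)
    also have "\<dots> \<le> K * norm (S y) * norm y" by (intro mult_right_mono K) simp
    finally show ?thesis using False by (simp add: power2_eq_square mult.assoc mult.left_commute)
  qed (use K in simp)
  moreover have "S (x + y) = S x + S y" for x y
    by (rule cinner_eqI) (simp add: S[symmetric] cinner_add_right)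
  moreover have "S (c *\<^sub>C x) = c *\<^sub>C S x" for c x
    by (rule cinner_eqI) (simp add: S[symmetric] cinner_scaleC_right)
  ultimately have "S \<in> bounded_ops" by (intro bounded_opsI)
  then show ?thesis using S by blast
qed

lemma adj_bounded_ops: "T \<in> bounded_ops \<Longrightarrow> adj T \<in> bounded_ops"
  and cinner_adj: "T \<in> bounded_ops \<Longrightarrow> cinner (T x) y = cinner x (adj T y)"
proof -
  assume "T \<in> bounded_ops"
  then obtain S where S: "S \<in> bounded_ops" "\<And>x y. cinner (T x) y = cinner x (S y)"
    using adj_exists by blast
  then have "adj T = S" by (rule adj_eqI)
  with S show "adj T \<in> bounded_ops" "cinner (T x) y = cinner x (adj T y)" by auto
qed

lemma cinner_adj_left: "T \<in> bounded_ops \<Longrightarrow> cinner (adj T x) y = cinner x (T y)"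
  by (metis cinner_adj cinner_commute)

lemma adj_id: "adj id = id"
  by (rule adj_eqI) auto

section \<open>Operators determined on a set of vectors and on its annihilator\<close>

lemma orthogonal_closure:
  assumes "\<And>u. u \<in> V \<Longrightarrow> cinner u z = 0" "u \<in> closure V"
  shows "cinner u (z::'h::complex_hilbert) = 0"
proof -
  have "closed {u. cinner u z = 0}"
    by (intro closed_Collect_eq continuous_intros)
  then have "closure V \<subseteq> {u. cinner u z = 0}" using assms(1) by (intro closure_minimal) auto
  then show ?thesis using assms(2) by auto
qed

text \<open>A relation instead of a function, because the vectors \<open>v\<close> will be sums with
  many expressions and single-valuedness only comes out of the bound. The operator is the closure of
  the relation on the closed domain and zero on its orthogonal complement. The last clause places
  its range in the closure of the second components.\<close>

lemma extend_linear_graph: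
  fixes Gr :: "('h::complex_hilbert \<times> 'h) set"
  assumes add: "\<And>v w v' w'. \<lbrakk>(v, w) \<in> Gr; (v', w') \<in> Gr\<rbrakk> \<Longrightarrow> (v + v', w + w') \<in> Gr"
    and scale: "\<And>v w c. (v, w) \<in> Gr \<Longrightarrow> (c *\<^sub>C v, c *\<^sub>C w) \<in> Gr"
    and zero: "(0, 0) \<in> Gr"
    and bd: "\<And>v w. (v, w) \<in> Gr \<Longrightarrow> norm w \<le> K * norm v" and K: "K \<ge> 0"
  shows "\<exists>T\<in>bounded_ops. (\<forall>v w. (v, w) \<in> Gr \<longrightarrow> T v = w) \<and>
      (\<forall>k. (\<forall>v w. (v, w) \<in> Gr \<longrightarrow> cinner v k = 0) \<longrightarrow> T k = 0) \<and>
      (\<forall>k. norm (T k) \<le> K * norm k) \<and>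
      (\<forall>z k. (\<forall>v w. (v, w) \<in> Gr \<longrightarrow> cinner w z = 0) \<longrightarrow> cinner (T k) z = 0)"
proof -
  define V where "V = fst ` Gr"
  \<comment> \<open>The sequential closure of the graph.\<close>
  define C where "C v w \<longleftrightarrow> (\<exists>f g. (\<forall>n. (f n, g n) \<in> Gr) \<and> f \<longlonglongrightarrow> v \<and> g \<longlonglongrightarrow> w)" for v w
  have Vmem: "x \<in> V \<longleftrightarrow> (\<exists>w. (x, w) \<in> Gr)" for x by (force simp: V_def)
  have V: "complex_vs.subspace V"
  proof (rule complex_vs.subspaceI)
    show "0 \<in> V" using zero Vmem by blast
    show "x + y \<in> V" if "x \<in> V" "y \<in> V" for x y
      using that add Vmem by blast
    show "c *\<^sub>C x \<in> V" if "x \<in> V" for c x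
      using that scale Vmem by blast
  qed
  have GC: "C v w" if "(v, w) \<in> Gr" for v w
    unfolding C_def using that by (intro exI[of _ "\<lambda>_::nat. v"] exI[of _ "\<lambda>_::nat. w"]) auto
  have Cadd: "C (v + v') (w + w')" if "C v w" "C v' w'" for v w v' w'
  proof -
    from that obtain f g f' g' where "\<forall>n. (f n, g n) \<in> Gr" "f \<longlonglongrightarrow> v" "g \<longlonglongrightarrow> w"
      "\<forall>n. (f' n, g' n) \<in> Gr" "f' \<longlonglongrightarrow> v'" "g' \<longlonglongrightarrow> w'" unfolding C_def by blast
    then show ?thesis unfolding C_def
      by (intro exI[of _ "\<lambda>n. f n + f' n"] exI[of _ "\<lambda>n. g n + g' n"])
        (auto intro: add tendsto_add)
  qed
  have Cscale: "C (c *\<^sub>C v) (c *\<^sub>C w)" if "C v w" for v w c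
  proof -
    from that obtain f g where "\<forall>n. (f n, g n) \<in> Gr" "f \<longlonglongrightarrow> v" "g \<longlonglongrightarrow> w" unfolding C_def by blast
    then show ?thesis unfolding C_def
      by (intro exI[of _ "\<lambda>n. c *\<^sub>C f n"] exI[of _ "\<lambda>n. c *\<^sub>C g n"])
        (auto intro: scale tendsto_scaleC)
  qed
  have Cdiff: "C (v - v') (w - w')" if "C v w" "C v' w'" for v w v' w'
    using Cadd[OF that(1) Cscale[OF that(2), of "-1"]] by simp
  have Cbd: "norm w \<le> K * norm v" if "C v w" for v w
  proof -
    from that obtain f g where *: "\<forall>n. (f n, g n) \<in> Gr" "f \<longlonglongrightarrow> v" "g \<longlonglongrightarrow> w" unfolding C_def by blast
    show ?thesis
      by (rule LIMSEQ_le[OF tendsto_norm[OF *(3)] tendsto_mult[OF tendsto_const tendsto_norm[OF *(2)]]])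
        (use * bd in auto)
  qed
  have CV: "v \<in> closure V" if "C v w" for v w
    proof -
    from that obtain f g where *: "\<forall>n. (f n, g n) \<in> Gr" "f \<longlonglongrightarrow> v" unfolding C_def by blast
    then have "\<forall>n. f n \<in> V" using Vmem by blast
    then show ?thesis using *(2) by (auto simp: closure_sequential)
  qed
  have Cex: "\<exists>w. C v w" if "v \<in> closure V" for v
  proof -
    from that obtain f where f: "\<And>n. f n \<in> V" "f \<longlonglongrightarrow> v" by (auto simp: closure_sequential)
    then have "\<forall>n. \<exists>w. (f n, w) \<in> Gr" using Vmem by blast
    then obtain g where g: "\<And>n. (f n, g n) \<in> Gr" by metis
    have gd: "norm (g m - g n) \<le> K * norm (f m - f n)" for m n
      using bd[OF add[OF g[of m] scale[OF g[of n], of "-1"]]] by simp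
    have "Cauchy g"
    proof (rule metric_CauchyI)
      fix e :: real assume e: "e > 0"
      then have "e / (K + 1) > 0" using K by simp
      then obtain M where M: "\<And>m n. m \<ge> M \<Longrightarrow> n \<ge> M \<Longrightarrow> dist (f m) (f n) < e / (K + 1)"
        using metric_CauchyD[OF LIMSEQ_imp_Cauchy[OF f(2)]] by blast
      have "dist (g m) (g n) < e" if "m \<ge> M" "n \<ge> M" for m n
      proof -
        have "dist (g m) (g n) \<le> K * dist (f m) (f n)" using gd by (simp add: dist_norm)
        also have "\<dots> \<le> K * (e / (K + 1))" using M[OF that] K by (intro mult_left_mono) auto
        also have "\<dots> < e" using K e by (simp add: divide_less_eq algebra_simps)
        finally show ?thesis .
      qed
      then show "\<exists>M. \<forall>m\<ge>M. \<forall>n\<ge>M. dist (g m) (g n) < e" by blast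
    qed
    then obtain w where "g \<longlonglongrightarrow> w" using Cauchy_convergent convergent_def by blast
    then show ?thesis unfolding C_def using f g by blast
  qed
  \<comment> \<open>Here \<open>v\<close> is the orthogonal projection of \<open>k\<close> onto the
    closed domain, and \<open>w\<close> the value there.\<close>
  define R where "R k w \<longleftrightarrow> (\<exists>v. C v w \<and> (\<forall>u\<in>closure V. cinner u (k - v) = 0))" for k w
  have Rex: "\<exists>w. R k w" for k
    using orthogonal_projection[OF closure_csubspace[OF V] closed_closure, of k] Cex
    unfolding R_def by meson
  have Runique: "w = w'" if R: "R k w" "R k w'" for k w w'
  proof -
    from R obtain v v' where v: "C v w" "\<And>u. u \<in> closure V \<Longrightarrow> cinner u (k - v) = 0"
      and v': "C v' w'" "\<And>u. u \<in> closure V \<Longrightarrow> cinner u (k - v') = 0" unfolding R_def by blast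
    have d: "C (v - v') (w - w')" using Cdiff v v' by blast
    \<comment> \<open>The vector \<open>v - v'\<close> lies in the closed domain, so both
      orthogonality relations may be tested against it; their difference gives
      \<open>v = v'\<close>.\<close>
    then have "cinner (v - v') (k - v') - cinner (v - v') (k - v) = 0" using v(2) v'(2) CV by simp
    then have "cinner (v - v') (v - v') = 0" by (simp add: cinner_diff_right)
    then have "v - v' = 0" by (simp only: cinner_self_eq_0_iff)
    then show ?thesis using Cbd[OF d] by simp
  qed
  define T where "T k = (THE w. R k w)" for k
  have RT: "R k (T k)" for k unfolding T_def by (rule theI') (use Rex Runique in blast)
  have TR: "T k = w" if "R k w" for k w using Runique[OF RT that] .
  have "T (x + y) = T x + T y" for x y
  proof -
    obtain v v' where "C v (T x)" "\<And>u. u \<in> closure V \<Longrightarrow> cinner u (x - v) = 0"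
      "C v' (T y)" "\<And>u. u \<in> closure V \<Longrightarrow> cinner u (y - v') = 0" using RT unfolding R_def by meson
    then show ?thesis
      by (intro TR, unfold R_def, intro exI[of _ "v + v'"])
        (auto simp: Cadd cinner_diff_right cinner_add_right)
  qed
  moreover have "T (c *\<^sub>C x) = c *\<^sub>C T x" for c x
  proof -
    obtain v where "C v (T x)" "\<And>u. u \<in> closure V \<Longrightarrow> cinner u (x - v) = 0"
      using RT unfolding R_def by meson
    then show ?thesis
      by (intro TR, unfold R_def, intro exI[of _ "c *\<^sub>C v"])
        (auto simp: Cscale cinner_diff_right cinner_scaleC_right)
  qed
  moreover have Tbd: "norm (T k) \<le> K * norm k" for k
  proof -
    obtain v where v: "C v (T k)" "\<And>u. u \<in> closure V \<Longrightarrow> cinner u (k - v) = 0"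
      using RT unfolding R_def by meson
    have "(norm k)\<^sup>2 = (norm v)\<^sup>2 + (norm (k - v))\<^sup>2"
      using norm_add_sq[of v "k - v"] v(2)[OF CV[OF v(1)]] by simp
    then have "norm v \<le> norm k" by (simp add: power2_le_imp_le)
    then show ?thesis using Cbd[OF v(1)] K by (meson mult_left_mono order_trans)
  qed
  ultimately have "T \<in> bounded_ops" by (intro bounded_opsI)
  moreover have "T v = w" if "(v, w) \<in> Gr" for v w
    by (rule TR, unfold R_def, rule exI[of _ v]) (use GC[OF that] in simp)
  moreover have "T k = 0" if k: "\<forall>v w. (v, w) \<in> Gr \<longrightarrow> cinner v k = 0" for k
  proof (rule TR, unfold R_def, intro exI[of _ 0] conjI ballI)
    fix u assume "u \<in> closure V"
    then show "cinner u (k - 0) = 0"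
      using orthogonal_closure[of V k u] k Vmem by fastforce
  qed (use GC[OF zero] in simp)
  moreover have "cinner (T k) z = 0" if z: "\<forall>v w. (v, w) \<in> Gr \<longrightarrow> cinner w z = 0" for z k
  proof -
    obtain v where "C v (T k)" using RT unfolding R_def by meson
    then obtain f g where fg: "\<And>n. (f n, g n) \<in> Gr" "g \<longlonglongrightarrow> T k" unfolding C_def by blast
    then have "\<forall>n. g n \<in> snd ` Gr" by (metis snd_conv image_eqI)
    then have "T k \<in> closure (snd ` Gr)" using fg(2) by (auto simp: closure_sequential)
    then show ?thesis by (rule orthogonal_closure[rotated]) (use z in auto)
  qed
  ultimately show ?thesis using Tbd by blast
qed

lemma eq_if_norm_diff_le:
  fixes x y :: "'b::real_normed_vector"
  assumes "\<And>\<epsilon>. \<epsilon> > 0 \<Longrightarrow> norm (x - y) \<le> \<epsilon> * M"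
  shows "x = y"
proof -
  have "norm (x - y) \<le> 0"
  proof (rule field_le_epsilon)
    fix e :: real assume e: "e > 0"
    have "norm (x - y) \<le> e / (\<bar>M\<bar> + 1) * M" using e by (intro assms) (simp add: add_nonneg_pos)
    also have "\<dots> \<le> e / (\<bar>M\<bar> + 1) * (\<bar>M\<bar> + 1)" using e by (intro mult_left_mono) auto
    also have "\<dots> = 0 + e" by (simp add: add_nonneg_eq_0_iff)
    finally show "norm (x - y) \<le> 0 + e" .
  qed
  then show ?thesis by simp
qed

text \<open>The space is the orthogonal sum of the closed span of \<open>W\<close> and the
  annihilator of \<open>W\<close>. The two conditions match the two ways in which the values of
  \<open>alpha\<close> are prescribed: on the range of \<open>\<psi>\<close>, and on its
  complement.\<close>

lemma op_eqI:
  assumes S: "S \<in> bounded_ops" and T: "T \<in> bounded_ops"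
    and W: "\<And>w. w \<in> W \<Longrightarrow> S w = T w"
    and perp: "\<And>k. (\<And>w. w \<in> W \<Longrightarrow> cinner w k = 0) \<Longrightarrow> S k = T k"
  shows "S = T"
proof
  fix k
  have "cspan W \<subseteq> {v. S v = T v}"
  proof (rule complex_vs.span_minimal)
    show "complex_vs.subspace {v. S v = T v}"
      by (rule complex_vs.subspaceI)
        (auto simp: bounded_ops_add[OF S] bounded_ops_add[OF T] bounded_ops_scaleC[OF S]
          bounded_ops_scaleC[OF T] bounded_ops_0[OF S] bounded_ops_0[OF T])
  qed (use W in auto)
  moreover have "closed {v. S v = T v}"
    using bounded_linear.continuous_on[OF bounded_ops_bounded_linear[OF S] continuous_on_id]
      bounded_linear.continuous_on[OF bounded_ops_bounded_linear[OF T] continuous_on_id]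
    by (intro closed_Collect_eq) auto
  ultimately have cl: "closure (cspan W) \<subseteq> {v. S v = T v}" by (intro closure_minimal)
  obtain v where v: "v \<in> closure (cspan W)" "\<forall>w\<in>closure (cspan W). cinner w (k - v) = 0"
    using orthogonal_projection[OF closure_csubspace[OF complex_vs.subspace_span] closed_closure] by blast
  have "W \<subseteq> closure (cspan W)" using complex_vs.span_superset closure_subset by blast
  then have "S (k - v) = T (k - v)" using v(2) by (intro perp) blast
  moreover have "S v = T v" using cl v(1) by blast
  ultimately show "S k = T k"
    by (simp add: bounded_ops_diff[OF S] bounded_ops_diff[OF T])
qed

lemma orthogonal_span_closure:
  assumes "\<And>w. w \<in> W \<Longrightarrow> cinner w k = 0" "v \<in> closure (cspan W)"
  shows "cinner v (k::'h::complex_hilbert) = 0"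
proof (rule orthogonal_closure[OF _ assms(2)])
  fix u assume u: "u \<in> cspan W"
  have "cspan W \<subseteq> {u. cinner u k = 0}"
    by (rule complex_vs.span_minimal, use assms(1) in blast, rule complex_vs.subspaceI)
      (simp_all add: cinner_add_left cinner_scaleC_left)
  then show "cinner u k = 0" using u by blast
qed

lemma adj_norm_le:
  assumes T: "T \<in> bounded_ops" and K: "\<And>x. norm (T x) \<le> K * norm x" "K \<ge> 0"
  shows "norm (adj T y) \<le> K * norm y"
proof (cases "adj T y = 0")
  case False
  have "(norm (adj T y))\<^sup>2 = cmod (cinner (T (adj T y)) y)"
    unfolding cinner_adj[OF T] cinner_self by (simp add: norm_power)
  also have "\<dots> \<le> norm (T (adj T y)) * norm y" by (rule cauchy_schwarz)
  also have "\<dots> \<le> K * norm (adj T y) * norm y" by (intro mult_right_mono K) simp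
  finally show ?thesis using False by (simp add: power2_eq_square mult.assoc mult.left_commute)
qed (use K in simp)

text \<open>Log-convexity makes the ratios of consecutive terms nondecreasing. A first ratio
  \<open>q > r\<close> would give \<open>q ^ n * a 0 \<le> a n\<close> for all \<open>n\<close>,
  which outgrows \<open>C * r ^ n\<close> whatever \<open>C\<close> is.\<close>

lemma log_convex_ratio_bound:
  fixes a :: "nat \<Rightarrow> real"
  assumes nonneg: "\<And>n. a n \<ge> 0" and convex: "\<And>n. (a (Suc n))\<^sup>2 \<le> a n * a (Suc (Suc n))"
    and growth: "\<And>n. a n \<le> C * r ^ n" and r: "r \<ge> 0"
  shows "a 1 \<le> r * a 0"
proof (rule ccontr)
  assume "\<not> a 1 \<le> r * a 0"
  then have gt: "r * a 0 < a 1" by simp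
  have a0: "a 0 > 0"
  proof (rule ccontr)
    assume "\<not> a 0 > 0"
    then have "a 0 = 0" using nonneg[of 0] by simp
    then show False using convex[of 0] gt by simp
  qed
  define q where "q = a 1 / a 0"
  have q: "q > r" "q > 0" "a 1 = q * a 0" using gt a0 r
    by (auto simp: q_def less_divide_eq intro: le_less_trans[OF mult_nonneg_nonneg[of r "a 0"]])
  have ratio: "a n > 0 \<and> q * a n \<le> a (Suc n)" for n
  proof (induction n)
    case (Suc n)
    then have pos: "a (Suc n) > 0" using q by (meson less_le_trans mult_pos_pos)
    have "q * a (Suc n) * a n \<le> a (Suc n) * a (Suc n)"
      using Suc pos by (simp add: mult.assoc mult.left_commute mult_left_mono)
    also have "\<dots> \<le> a (Suc (Suc n)) * a n" using convex[of n] by (simp add: power2_eq_square mult.commute)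
    finally show ?case using pos Suc by simp
  qed (use a0 q in simp)
  have pow: "q ^ n * a 0 \<le> a n" for n
  proof (induction n)
    case (Suc n)
    have "q ^ Suc n * a 0 \<le> q * a n" using mult_left_mono[OF Suc, of q] q by (simp add: mult.assoc)
    then show ?case using ratio[of n] by simp
  qed simp
  then have le: "q ^ n * a 0 \<le> C * r ^ n" for n using growth order_trans by blast
  show False
  \<comment> \<open>The comparison divides by \<open>r\<close>; for \<open>r = 0\<close> the bound
    at exponent 1 already fails.\<close>
  proof (cases "r = 0")
    case True
    then have "q * a 0 \<le> 0" using le[of 1] by simp
    moreover have "0 < q * a 0" using q(2) a0 by (rule mult_pos_pos)
    ultimately show False by linarith
  next
    case False
    then have rp: "r > 0" using r by simp
    then obtain n where "C / a 0 < (q / r) ^ n" using real_arch_pow[of "q / r" "C / a 0"] q by auto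
    then have "C * r ^ n < q ^ n * a 0" using rp a0 by (simp add: power_divide field_simps)
    then show False using le[of n] by simp
  qed
qed

section \<open>Contractivity of representations of $C^*$-algebras\<close>

lemma norm_star: "norm (star a) = norm (a::'a::cstar_algebra)"
proof -
  have le: "norm b \<le> norm (star b)" for b :: 'a
  proof (cases "b = 0")
    case False
    have "norm b * norm b \<le> norm (star b) * norm b"
      using norm_mult_ineq[of "star b" b] cstar_identity[of b] by (simp add: power2_eq_square)
    then show ?thesis using False by simp
  qed simp
  show ?thesis using le[of a] le[of "star a"] by (simp add: star_star)
qed

lemma star_diff: "star (a - b) = star a - star (b::'a::cstar_algebra)"
proof -
  have "star ((-1) *\<^sub>C b) = - star b" by (subst star_scaleC) simp
  then show ?thesis using star_add[of a "- b"] by simp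
qed

lemma closed_selfadjoint: "closed {y::'a::cstar_algebra. star y = y}"
proof -
  have "continuous_on UNIV (star :: 'a \<Rightarrow> 'a)"
    by (intro continuous_on_iff[THEN iffD2]) (auto simp: dist_norm star_diff[symmetric] norm_star)
  then show ?thesis by (intro closed_Collect_eq) auto
qed

text \<open>Then \<open>(1 - y)\<^sup>2 = 1 - a\<close> in the unitization, so that \<open>1 - a\<close> is positive.\<close>

lemma selfadjoint_square_root:
  fixes a :: "'a::cstar_algebra"
  assumes sa: "star a = a" and na: "norm a < 1"
  shows "\<exists>y. star y = y \<and> y + y - y * y = a"
proof -
  \<comment> \<open>The equation \<open>y + y - y * y = a\<close> is \<open>f y = y\<close>. On the
    ball of radius \<open>norm a\<close>, the map \<open>f\<close> contracts by the factor
    \<open>norm a\<close>.\<close>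
  define f where "f (y::'a) = (1/2) *\<^sub>R (a + y * y)" for y
  define S where "S = {y::'a. star y = y} \<inter> cball 0 (norm a)"
  have "complete S"
    unfolding complete_eq_closed S_def by (intro closed_Int closed_selfadjoint closed_cball)
  moreover have "a \<in> S" using sa by (simp add: S_def)
  then have "S \<noteq> {}" by blast
  moreover have "f y \<in> S" if y: "y \<in> S" for y
  proof -
    have "norm (y * y) \<le> norm a * 1"
      using y na by (intro order_trans[OF norm_mult_ineq] mult_mono) (auto simp: S_def)
    then have "norm (a + y * y) \<le> norm a + norm a" by (intro norm_triangle_mono) auto
    moreover have "star (f y) = f y"
      using y sa by (simp add: f_def scaleR_scaleC star_scaleC star_add star_mult S_def)
    ultimately show ?thesis by (simp add: S_def f_def)
  qed
  moreover have "dist (f x) (f y) \<le> norm a * dist x y" if xy: "x \<in> S" "y \<in> S" for x y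
  proof -
    \<comment> \<open>\<open>x\<close> and \<open>y\<close> need not commute, so the difference of
      squares is split in this order.\<close>
    have "f x - f y = (1/2) *\<^sub>R (x * (x - y) + (x - y) * y)"
    proof -
      have "x * (x - y) + (x - y) * y = (a + x * x) - (a + y * y)" by (simp add: algebra_simps)
      then show ?thesis by (simp only: f_def scaleR_diff_right)
    qed
    moreover have "norm (x * (x - y)) \<le> norm a * norm (x - y)"
      using xy by (intro order_trans[OF norm_mult_ineq] mult_right_mono) (auto simp: S_def)
    moreover have "norm ((x - y) * y) \<le> norm (x - y) * norm a"
      using xy by (intro order_trans[OF norm_mult_ineq] mult_left_mono) (auto simp: S_def)
    ultimately show ?thesis
      using norm_triangle_ineq[of "x * (x - y)" "(x - y) * y"] by (simp add: dist_norm mult.commute)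
  qed
  ultimately obtain y where y: "y \<in> S" "f y = y"
    using Banach_fix[of S "norm a" f] na by (auto simp: image_subset_iff)
  have "y + y = 2 *\<^sub>R f y" using y(2) by (simp add: scaleR_2)
  also have "\<dots> = a + y * y" by (simp add: f_def)
  finally show ?thesis using y by (auto simp: S_def)
qed

text \<open>For \<open>norm b < 1\<close>, take the self-adjoint \<open>y\<close> with
  \<open>y + y - y * y = star b * b\<close>. Expanding |h - \<pi>(y)h|^2 shows that it equals |h|^2
  - |\<pi>(b)h|^2, which is therefore nonnegative. Only operators on the Hilbert space are
  subtracted from the identity, so \<open>A\<close> may lack a unit.\<close>

lemma cstar_rep_contractive:
  fixes b :: "'a::cstar_algebra"
  assumes \<pi>: "star_rep UNIV (+) scaleC (*) star \<pi>"
  shows "norm (\<pi> b h) \<le> norm b * norm h"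
proof -
  have B: "\<pi> a \<in> bounded_ops" for a using \<pi> by (simp add: star_rep_def)
  have add: "\<pi> (a + b) h = \<pi> a h + \<pi> b h" for a b h using \<pi> by (simp add: star_rep_def op_add_def)
  have scale: "\<pi> (c *\<^sub>C a) h = c *\<^sub>C \<pi> a h" for a c h using \<pi> by (simp add: star_rep_def op_scale_def)
  have mult: "\<pi> (a * b) h = \<pi> a (\<pi> b h)" for a b h using \<pi> by (simp add: star_rep_def)
  have st: "cinner (\<pi> (star a) h) k = cinner h (\<pi> a k)" for a h k
    using \<pi> cinner_adj_left[OF B] by (simp add: star_rep_def)
  have unit: "norm (\<pi> b h) \<le> norm h" if "norm b < 1" for b h
  proof -
    have "norm (star b * b) < 1" using that by (simp add: cstar_identity power_less_one_iff)
    moreover have "star (star b * b) = star b * b" by (simp add: star_mult star_star)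
    ultimately obtain y where y: "star y = y" "y + y - y * y = star b * b"
      using selfadjoint_square_root by blast
    have "cinner h (\<pi> (star b * b) h) + cinner h (\<pi> (y * y) h) = cinner h (\<pi> (y + y) h)"
      using add[of "star b * b" "y * y" h] y(2) by (simp add: cinner_add_right[symmetric] algebra_simps)
    moreover have "cinner h (\<pi> (star b * b) h) = (norm (\<pi> b h))\<^sup>2"
      using st[of "star b" h "\<pi> b h"] by (simp add: mult star_star cinner_self)
    moreover have "cinner h (\<pi> (y * y) h) = (norm (\<pi> y h))\<^sup>2"
      using st[of y h "\<pi> y h"] y(1) by (simp add: mult cinner_self)
    ultimately have "complex_of_real ((norm (\<pi> b h))\<^sup>2 + (norm (\<pi> y h))\<^sup>2) = 2 * cinner h (\<pi> y h)"
      by (simp add: add cinner_add_right)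
    from arg_cong[OF this, of Re]
    have "(norm (\<pi> b h))\<^sup>2 + (norm (\<pi> y h))\<^sup>2 = 2 * Re (cinner h (\<pi> y h))"
      unfolding Re_complex_of_real by simp
    moreover have "0 \<le> (norm h)\<^sup>2 - 2 * Re (cinner h (\<pi> y h)) + (norm (\<pi> y h))\<^sup>2"
      unfolding norm_diff_sq[symmetric] by simp
    ultimately have "(norm (\<pi> b h))\<^sup>2 \<le> (norm h)\<^sup>2" by linarith
    then show ?thesis by (rule power2_le_imp_le) simp
  qed
  show ?thesis
  \<comment> \<open>The square root needs norm strictly below 1, so \<open>b\<close> is rescaled to
    norm \<open>z < 1\<close> and \<open>z\<close> tends to 1.\<close>
  proof (rule field_le_mult_one_interval)
    fix z :: real assume z: "0 < z" "z < 1"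
    show "z * norm (\<pi> b h) \<le> norm b * norm h"
    proof (cases "b = 0")
      case True
      then show ?thesis using scale[of 0 b h] by simp
    next
      case False
      define c where "c = complex_of_real (z / norm b)"
      have "cmod c = z / norm b" using z by (simp add: c_def norm_divide del: of_real_divide)
      moreover from this have "norm (c *\<^sub>C b) < 1" using z False by (simp add: norm_scaleC)
      ultimately have "z / norm b * norm (\<pi> b h) \<le> norm h"
        using unit[of "c *\<^sub>C b" h] by (simp add: scale norm_scaleC)
      then show ?thesis using False by (simp add: divide_le_eq mult.commute)
    qed
  qed
qed

section \<open>Joins and step functions\<close>

context quasi_lattice_ordered
begin

section \<open>The order of P in terms of its cosets\<close>

lemma le_P_iff_coset: "\<lbrakk>s \<in> P; u \<in> P\<rbrakk> \<Longrightarrow> le_P G P s u \<longleftrightarrow> u \<in> s <# P"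
  by (simp add: le_P_def mem_coset_iff P_carrier)

lemma le_P_antisym:
  assumes "u \<in> P" "v \<in> P" "le_P G P u v" "le_P G P v u"
  shows "u = v"
proof -
  have c: "u \<in> carrier G" "v \<in> carrier G" using assms P_carrier by auto
  have "inv u \<otimes> v = inv (inv v \<otimes> u)" using c by (simp add: inv_mult_group)
  then have "inv u \<otimes> v \<in> P \<inter> m_inv G ` P" using assms(3,4) by (auto simp: le_P_def)
  then have "inv u \<otimes> v = \<one>" using cone_pointed by auto
  then have "u \<otimes> (inv u \<otimes> v) = u" using c by simp
  then show ?thesis using mult_inv_cancel c by simp
qed

text \<open>An element lies above \<open>w\<close> exactly when it lies in the coset of
  \<open>w\<close>. Common upper bounds thus form the intersection of two cosets, and a least one
  generates it. Antisymmetry makes the description inside \<open>join_P\<close> denote this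
  generator.\<close>

lemma join_P_cosets:
  assumes s: "s \<in> P" and t: "t \<in> P"
  shows "case join_P G P s t of Some u \<Rightarrow> u \<in> P \<and> (s <# P) \<inter> (t <# P) = u <# P
    | None \<Rightarrow> (s <# P) \<inter> (t <# P) = {}"
proof (cases "\<exists>u\<in>P. le_P G P s u \<and> le_P G P t u")
  case True
  then obtain v where "v \<in> P" "\<forall>x\<in>{s, t}. le_P G P x v" by auto
  then obtain u where u: "is_lub_P G P {s, t} u"
    using lub_exists[of "{s, t}" v] s t P_carrier by auto
  have "(THE u. is_lub_P G P {s, t} u) = u"
    using u by (intro the_equality) (auto simp: is_lub_P_def intro!: le_P_antisym)
  then have j: "join_P G P s t = Some u" using True by (simp add: join_P_def)
  have uP: "u \<in> P" using u by (simp add: is_lub_P_def)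
  have us: "u \<in> s <# P" and ut: "u \<in> t <# P"
    using u s t uP by (auto simp: is_lub_P_def le_P_iff_coset)
  have "u <# P \<subseteq> w <# P" if "u \<in> w <# P" "w \<in> P" for w
  proof -
    from that obtain q where "q \<in> P" "u = w \<otimes> q" by (auto simp: l_coset_def)
    then show ?thesis using coset_mult_subset[of w q] that by simp
  qed
  moreover have "r \<in> u <# P" if r: "r \<in> s <# P" "r \<in> t <# P" for r
  proof -
    have rP: "r \<in> P" using r(1) coset_subset[OF s] by blast
    then have "le_P G P s r" "le_P G P t r" using r s t by (simp_all add: le_P_iff_coset)
    then have "le_P G P u r" using u rP by (simp add: is_lub_P_def)
    then show ?thesis using le_P_iff_coset[OF uP rP] by simp
  qed
  ultimately show ?thesis using j uP us ut s t by auto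
next
  case False
  have "r \<notin> (s <# P) \<inter> (t <# P)" for r
  proof
    assume r: "r \<in> (s <# P) \<inter> (t <# P)"
    then have "r \<in> P" using coset_subset[OF s] by blast
    with False r s t show False by (auto simp: le_P_iff_coset)
  qed
  then show ?thesis using False by (auto simp: join_P_def)
qed

lemma one_P_mult:
  assumes "s \<in> P" "t \<in> P"
  shows "one_P G P s r * one_P G P t r =
    (case join_P G P s t of Some u \<Rightarrow> one_P G P u r | None \<Rightarrow> 0)"
  using join_P_cosets[OF assms]
  by (cases "join_P G P s t") (auto simp: one_P_def indicator_def)

lemma mem_own_coset: "u \<in> P \<Longrightarrow> u \<in> u <# P"
  by (simp add: mem_coset_iff P_carrier)

lemma coset_one: "\<one> <# P = P"
  using P_carrier by (force simp: l_coset_def)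

text \<open>With this, the Nica relation says that \<open>p t\<close> fixes the range of
  \<open>p u\<close> whenever \<open>u\<close> lies above \<open>t\<close>; the case
  \<open>t = u\<close> gives idempotence.\<close>

lemma join_P_absorb:
  assumes "u \<in> P" "t \<in> P" "u \<in> t <# P"
  shows "join_P G P t u = Some u"
proof (cases "join_P G P t u")
  case None
  then show ?thesis using join_P_cosets[OF assms(2,1)] assms mem_own_coset by auto
next
  case (Some v)
  then have v: "v \<in> P" "(t <# P) \<inter> (u <# P) = v <# P" using join_P_cosets[OF assms(2,1)] by auto
  have "u \<in> v <# P" using v(2) assms mem_own_coset by blast
  moreover have "v \<in> u <# P" using v mem_own_coset by blast
  ultimately have "u = v" using assms v by (intro le_P_antisym) (auto simp: le_P_iff_coset)
  then show ?thesis using Some by simp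
qed

text \<open>Lists admit repeated elements, so sums are concatenations, products can be formed entry
  by entry without collecting terms, and induction can split off one entry.\<close>

definition step_fun :: "(complex \<times> 'a) list \<Rightarrow> 'a \<Rightarrow> complex" where
  "step_fun l r = (\<Sum>(c, t)\<leftarrow>l. c * one_P G P t r)"

lemma step_fun_simps [simp]:
  "step_fun [] r = 0"
  "step_fun ((c, t) # l) r = c * one_P G P t r + step_fun l r"
  "step_fun (l @ l') r = step_fun l r + step_fun l' r"
  by (simp_all add: step_fun_def)

text \<open>Products and conjugates of elements of \<open>B_P\<close> are later shown to satisfy
  this condition; it is what makes \<open>ext_op\<close> meaningful at them.\<close>

definition approximable :: "('a \<Rightarrow> complex) \<Rightarrow> bool" where
  "approximable f \<longleftrightarrow> (\<forall>\<epsilon>>0. \<exists>l. snd ` set l \<subseteq> P \<and> (\<forall>r\<in>P. cmod (f r - step_fun l r) \<le> \<epsilon>))"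

lemma B_P_approximable:
  assumes "f \<in> B_P G P"
  shows "approximable f"
  unfolding approximable_def
proof (intro allI impI)
  fix \<epsilon> :: real assume "\<epsilon> > 0"
  then obtain g where g: "g \<in> span_one_P G P" "\<forall>r\<in>P. cmod (f r - g r) \<le> \<epsilon>"
    using assms unfolding B_P_def by blast
  then obtain F c where F: "finite F" "F \<subseteq> P" "g = (\<lambda>r. \<Sum>t\<in>F. c t * one_P G P t r)"
    unfolding span_one_P_def by blast
  obtain ts where ts: "set ts = F" "distinct ts" using finite_distinct_list[OF F(1)] by blast
  have "step_fun (map (\<lambda>t. (c t, t)) ts) r = (\<Sum>t\<in>F. c t * one_P G P t r)" for r
    using ts sum.distinct_set_conv_list[OF ts(2), of "\<lambda>t. c t * one_P G P t r"]
    by (simp add: step_fun_def comp_def)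
  then show "\<exists>l. snd ` set l \<subseteq> P \<and> (\<forall>r\<in>P. cmod (f r - step_fun l r) \<le> \<epsilon>)"
    using F g ts by (intro exI[of _ "map (\<lambda>t. (c t, t)) ts"]) (auto simp: image_image)
qed

lemma B_P_bounded:
  assumes "f \<in> B_P G P"
  obtains K where "K \<ge> 0" "\<And>r. cmod (f r) \<le> K"
proof -
  obtain K where K: "\<And>r. cmod (f r) \<le> K"
    using assms by (auto simp: B_P_def linfty_def bounded_iff)
  show ?thesis using that[of K] K order_trans[OF norm_ge_zero K] by blast
qed

lemma one_P_one: "f \<in> B_P G P \<Longrightarrow> (\<lambda>r. one_P G P \<one> r * f r) = f"
  by (auto simp: one_P_def coset_one B_P_def linfty_def indicator_def fun_eq_iff)

lemma approximableD:
  assumes "approximable f" "\<epsilon> > 0"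
  obtains l where "snd ` set l \<subseteq> P" "\<And>r. r \<in> P \<Longrightarrow> cmod (f r - step_fun l r) \<le> \<epsilon>"
proof -
  from assms have "\<exists>l. snd ` set l \<subseteq> P \<and> (\<forall>r\<in>P. cmod (f r - step_fun l r) \<le> \<epsilon>)"
    unfolding approximable_def by simp
  then show ?thesis using that by auto
qed

lemma step_fun_scale: "step_fun (map (\<lambda>(d, t). (c * d, t)) l) r = c * step_fun l r"
  by (induction l) (auto simp: algebra_simps)

lemma step_fun_cnj: "step_fun (map (\<lambda>(d, t). (cnj d, t)) l) r = cnj (step_fun l r)"
  by (induction l) (auto simp: one_P_def indicator_def)

lemma snd_set_map_fst:
  "snd ` set (map (\<lambda>(d, t). (\<phi> d, t)) l) = snd ` set l"
  by (force simp: image_image case_prod_beta)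

lemma approximable_add:
  assumes "approximable f" "approximable g"
  shows "approximable (\<lambda>r. f r + g r)"
  unfolding approximable_def
proof (intro allI impI)
  fix \<epsilon> :: real assume "\<epsilon> > 0"
  then have e: "\<epsilon> / 2 > 0" by simp
  obtain l where l: "snd ` set l \<subseteq> P" "\<And>r. r \<in> P \<Longrightarrow> cmod (f r - step_fun l r) \<le> \<epsilon> / 2"
    by (rule approximableD[OF assms(1) e]) blast
  obtain m where m: "snd ` set m \<subseteq> P" "\<And>r. r \<in> P \<Longrightarrow> cmod (g r - step_fun m r) \<le> \<epsilon> / 2"
    by (rule approximableD[OF assms(2) e]) blast
  have "cmod ((f r + g r) - step_fun (l @ m) r) \<le> \<epsilon>" if "r \<in> P" for r
    using norm_triangle_mono[OF l(2)[OF that] m(2)[OF that]] by (simp add: algebra_simps)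
  then show "\<exists>l. snd ` set l \<subseteq> P \<and> (\<forall>r\<in>P. cmod (f r + g r - step_fun l r) \<le> \<epsilon>)"
    using l(1) m(1) by (intro exI[of _ "l @ m"]) auto
qed

end

section \<open>Representations of $B_P$ from Nica families of projections\<close>

text \<open>The case \<open>s = t\<close> of \<open>p_nica\<close> is idempotence, so with
  \<open>p_selfadjoint\<close> every \<open>p t\<close> is an orthogonal projection.\<close>

locale nica_projections = quasi_lattice_ordered G P for G (structure) and P +
  fixes p :: "'a \<Rightarrow> 'h::complex_hilbert \<Rightarrow> 'h"
  assumes p_op: "t \<in> P \<Longrightarrow> p t \<in> bounded_ops"
    and p_selfadjoint: "t \<in> P \<Longrightarrow> cinner (p t x) y = cinner x (p t y)"
    and p_one: "p \<one> = id"
    and p_nica: "\<lbrakk>s \<in> P; t \<in> P\<rbrakk> \<Longrightarrow> p s (p t x) =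
          (case join_P G P s t of Some u \<Rightarrow> p u x | None \<Rightarrow> 0)"
begin

section \<open>Finite linear combinations of the projections\<close>

lemma p_idem: "t \<in> P \<Longrightarrow> p t (p t x) = p t x"
  using p_nica[of t t x] join_P_absorb[of t t] mem_own_coset by simp

definition step_op :: "(complex \<times> 'a) list \<Rightarrow> 'h \<Rightarrow> 'h" where
  "step_op l h = (\<Sum>(c, t)\<leftarrow>l. c *\<^sub>C p t h)"

lemma step_op_simps [simp]:
  "step_op [] h = 0"
  "step_op ((c, t) # l) h = c *\<^sub>C p t h + step_op l h"
  "step_op (l @ l') h = step_op l h + step_op l' h"
  by (simp_all add: step_op_def)

lemma step_op_bounded_ops: "snd ` set l \<subseteq> P \<Longrightarrow> step_op l \<in> bounded_ops"
proof (induction l)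
  case (Cons a l)
  obtain c t where a: "a = (c, t)" by force
  have "step_op (a # l) = op_add (op_scale c (p t)) (step_op l)"
    by (simp add: a op_add_def op_scale_def fun_eq_iff)
  then show ?case using Cons a p_op by (simp add: op_add_bounded_ops op_scale_bounded_ops)
next
  case Nil
  have "step_op [] = (\<lambda>_. 0)" by (simp add: fun_eq_iff)
  then show ?case by simp
qed

text \<open>The projections commute because the join is symmetric in its two arguments.\<close>

lemma step_op_p: "\<lbrakk>snd ` set l \<subseteq> P; t \<in> P\<rbrakk> \<Longrightarrow> p t (step_op l h) = step_op l (p t h)"
proof (induction l)
  case Nil
  then show ?case using bounded_ops_0[OF p_op] by simp
next
  case (Cons a l)
  obtain c s where a: "a = (c, s)" by force
  have s: "s \<in> P" using Cons.prems a by auto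
  have "join_P G P t s = join_P G P s t" by (simp add: join_P_def conj_commute insert_commute)
  then have "p t (p s h) = p s (p t h)" using p_nica Cons.prems s by simp
  then show ?case using Cons a p_op[of t] by (simp add: bounded_ops_add bounded_ops_scaleC)
qed

text \<open>The induction splits \<open>h\<close> into \<open>p t h\<close> and \<open>h - p t h\<close> for the first entry \<open>t\<close> of the list. A
  vector in the range of \<open>p u\<close> and in the kernels of the \<open>p t\<close>, \<open>t \<in> N\<close>, that is nonzero forces
  \<open>u\<close> to lie outside the cosets \<open>tP\<close>; evaluating the step function at \<open>u\<close> bounds the
  coefficient reached.\<close>

lemma step_op_bound_aux:
  assumes "snd ` set l \<subseteq> P" "u \<in> P" "p u h = h" "\<And>t. t \<in> N \<Longrightarrow> t \<in> P \<and> p t h = 0" "K \<ge> 0"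
    "\<And>r. \<lbrakk>r \<in> u <# P; \<And>t. t \<in> N \<Longrightarrow> r \<notin> t <# P\<rbrakk> \<Longrightarrow> cmod (a + step_fun l r) \<le> K"
  shows "norm (a *\<^sub>C h + step_op l h) \<le> K * norm h"
  using assms
proof (induction l arbitrary: u h N a)
  case Nil
  show ?case
  proof (cases "h = 0")
    case False
    have "u \<notin> t <# P" if t: "t \<in> N" for t
    proof
      assume "u \<in> t <# P"
      moreover have tP: "t \<in> P" and "p t h = 0" using Nil.prems(4)[OF t] by auto
      moreover have "p t (p u h) = p u h"
        using p_nica[OF tP Nil.prems(2), of h] join_P_absorb[OF Nil.prems(2) tP] calculation by simp
      ultimately show False using Nil.prems(3) False by simp
    qed
    then have "cmod a \<le> K" using Nil.prems(6)[of u] mem_own_coset[OF Nil.prems(2)] by simp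
    then show ?thesis by (simp add: norm_scaleC mult_right_mono)
  qed simp
next
  case (Cons x l)
  obtain c t where x: "x = (c, t)" by force
  have t: "t \<in> P" and l: "snd ` set l \<subseteq> P" using Cons.prems(1) x by auto
  define q where "q = p t h"
  have pt: "p t \<in> bounded_ops" using p_op t .
  have comm: "p s q = p t (p s h)" if "s \<in> P" for s
    using step_op_p[of "[(1, s)]" t h] that t by (simp add: q_def scaleC_one)
  \<comment> \<open>The accumulator \<open>a\<close> holds the coefficients of the entries whose
    projections fix the current vector. Since \<open>p t\<close> fixes \<open>q\<close>, the
    coefficient \<open>c\<close> is added to it, and \<open>u\<close> is replaced by the join
    \<open>v\<close> with \<open>t\<close>, on whose coset the indicator of \<open>tP\<close> is
    1.\<close>
  have 1: "norm ((a + c) *\<^sub>C q + step_op l q) \<le> K * norm q"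
  proof (cases "join_P G P t u")
    case None
    then have "q = 0" using p_nica[OF t Cons.prems(2), of h] Cons.prems(3) by (simp add: q_def)
    then show ?thesis using bounded_ops_0[OF step_op_bounded_ops[OF l]] by simp
  next
    case (Some v)
    then have v: "v \<in> P" "(t <# P) \<inter> (u <# P) = v <# P" using join_P_cosets[OF t Cons.prems(2)] by auto
    have "p v h = q" using p_nica[OF t Cons.prems(2), of h] Cons.prems(3) Some by (simp add: q_def)
    then have "p v q = q" using p_idem[OF v(1), of h] by simp
    moreover have "s \<in> P \<and> p s q = 0" if "s \<in> N" for s
      using Cons.prems(4)[OF that] comm bounded_ops_0[OF pt] by simp
    moreover have "cmod ((a + c) + step_fun l r) \<le> K"
      if "r \<in> v <# P" "\<And>s. s \<in> N \<Longrightarrow> r \<notin> s <# P" for r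
    proof -
      have "r \<in> t <# P" "r \<in> u <# P" using v(2) that(1) by auto
      then show ?thesis using Cons.prems(6)[of r] that(2) by (simp add: x one_P_def add.assoc)
    qed
    ultimately show ?thesis using Cons.IH[OF l v(1)] Cons.prems(5) by blast
  qed
  \<comment> \<open>On \<open>h - q\<close> the entry \<open>t\<close> contributes nothing:
    \<open>p t\<close> annihilates the vector, and once \<open>t\<close> is in \<open>N\<close> only
    points outside \<open>tP\<close> are tested.\<close>
  have 2: "norm (a *\<^sub>C (h - q) + step_op l (h - q)) \<le> K * norm (h - q)"
  proof -
    have "p u (h - q) = h - q"
      using comm[OF Cons.prems(2)] Cons.prems(3) p_op[OF Cons.prems(2)]
      by (simp add: bounded_ops_diff q_def)
    moreover have "s \<in> P \<and> p s (h - q) = 0" if s: "s \<in> insert t N" for s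
    proof (cases "s = t")
      case True
      then show ?thesis using t p_idem[OF t, of h] pt by (simp add: bounded_ops_diff q_def)
    next
      case False
      then show ?thesis
        using Cons.prems(4)[of s] s comm bounded_ops_0[OF pt] p_op by (simp add: bounded_ops_diff)
    qed
    moreover have "cmod (a + step_fun l r) \<le> K"
      if "r \<in> u <# P" "\<And>s. s \<in> insert t N \<Longrightarrow> r \<notin> s <# P" for r
      using Cons.prems(6)[of r] that by (simp add: x one_P_def)
    ultimately show ?thesis using Cons.IH[OF l Cons.prems(2), of "h - q" "insert t N"] Cons.prems(5) by blast
  qed
  \<comment> \<open>The two pieces lie in the range and the kernel of the projection
    \<open>p t\<close>. The estimates thus combine by Pythagoras with the same \<open>K\<close>,
    whereas the triangle inequality would lose a factor at each entry.\<close>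
  let ?y = "(a + c) *\<^sub>C q + step_op l q" and ?z = "a *\<^sub>C (h - q) + step_op l (h - q)"
  have orth: "cinner y z = 0" if "p t y = y" "p t z = 0" for y z
    using p_selfadjoint[OF t, of y z] that by simp
  have sl: "step_op l \<in> bounded_ops" by (rule step_op_bounded_ops[OF l])
  have pq: "p t q = q" using p_idem[OF t] by (simp add: q_def)
  have phq: "p t (h - q) = 0" using pq pt by (simp add: bounded_ops_diff q_def)
  have "cinner ?y ?z = 0"
    by (rule orth) (simp_all add: bounded_ops_add[OF pt] bounded_ops_scaleC[OF pt] step_op_p[OF l t] pq phq bounded_ops_0[OF sl])
  then have "(norm (?y + ?z))\<^sup>2 = (norm ?y)\<^sup>2 + (norm ?z)\<^sup>2" by (simp add: norm_add_sq)
  also have "\<dots> \<le> (K * norm q)\<^sup>2 + (K * norm (h - q))\<^sup>2"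
    using 1 2 by (intro add_mono power_mono) auto
  also have "\<dots> = K\<^sup>2 * ((norm q)\<^sup>2 + (norm (h - q))\<^sup>2)" by (simp add: power_mult_distrib distrib_left)
  also have "(norm q)\<^sup>2 + (norm (h - q))\<^sup>2 = (norm h)\<^sup>2"
    using norm_add_sq[of q "h - q"] orth[OF pq phq] by simp
  also have "?y + ?z = a *\<^sub>C h + step_op (x # l) h"
  proof -
    have "step_op l h = step_op l q + step_op l (h - q)" using bounded_ops_add[OF sl, of q "h - q"] by simp
    moreover have "a *\<^sub>C h = a *\<^sub>C q + a *\<^sub>C (h - q)" using scaleC_add_right[of a q "h - q"] by simp
    ultimately show ?thesis by (simp add: x q_def[symmetric] scaleC_add_left)
  qed
  finally have "(norm (a *\<^sub>C h + step_op (x # l) h))\<^sup>2 \<le> (K * norm h)\<^sup>2" by (simp add: power_mult_distrib)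
  then show ?case by (rule power2_le_imp_le) (simp add: Cons.prems(5))
qed

text \<open>The induction starts at the identity, where the projection is \<open>id\<close> and the
  coset is all of \<open>P\<close>. The bound makes \<open>step_op\<close> depend on
  \<open>step_fun\<close> alone and be contractive for the supremum norm.\<close>

lemma step_op_bound:
  assumes "snd ` set l \<subseteq> P" "\<And>r. r \<in> P \<Longrightarrow> cmod (step_fun l r) \<le> K"
  shows "norm (step_op l h) \<le> K * norm h"
proof -
  have "K \<ge> 0" using assms(2)[OF one_closed] norm_ge_zero order_trans by blast
  then show ?thesis
    using step_op_bound_aux[of l \<one> h "{}" K 0] assms by (simp add: p_one coset_one)
qed

lemma step_op_scale: "step_op (map (\<lambda>(d, t). (c * d, t)) l) h = c *\<^sub>C step_op l h"
  by (induction l) (auto simp: scaleC_add_right scaleC_scaleC)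

lemma step_op_cnj:
  "snd ` set l \<subseteq> P \<Longrightarrow> cinner (step_op l h) k = cinner h (step_op (map (\<lambda>(d, t). (cnj d, t)) l) k)"
  by (induction l)
    (auto simp: cinner_add_left cinner_add_right cinner_scaleC_left cinner_scaleC_right p_selfadjoint)

text \<open>The same join governs products of indicators and products of projections, so one list
  realizes both. An entry whose join is infinite is dropped.\<close>

lemma step_mult_one:
  assumes "s \<in> P" "snd ` set l \<subseteq> P"
  shows "\<exists>m. snd ` set m \<subseteq> P \<and> (\<forall>r. step_fun m r = one_P G P s r * step_fun l r) \<and>
    (\<forall>h. step_op m h = p s (step_op l h))"
  using assms(2)
proof (induction l)
  case Nil
  then show ?case using bounded_ops_0[OF p_op[OF assms(1)]] by (intro exI[of _ "[]"]) simp
next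
  case (Cons x l)
  obtain c t where x: "x = (c, t)" by force
  have t: "t \<in> P" using Cons.prems x by simp
  obtain m where m: "snd ` set m \<subseteq> P" "\<And>r. step_fun m r = one_P G P s r * step_fun l r"
    "\<And>h. step_op m h = p s (step_op l h)" using Cons by auto
  have ps: "p s (c *\<^sub>C p t h + step_op l h) = c *\<^sub>C p s (p t h) + step_op m h" for h
    using m(3) p_op[OF assms(1)] by (simp add: bounded_ops_add bounded_ops_scaleC)
  have os: "one_P G P s r * (c * one_P G P t r + step_fun l r) =
      c * (one_P G P s r * one_P G P t r) + step_fun m r" for r
    using m(2) by (simp add: algebra_simps)
  show ?case
  proof (cases "join_P G P s t")
    case None
    then show ?thesis using m p_nica[OF assms(1) t] one_P_mult[OF assms(1) t]
      by (intro exI[of _ m]) (simp add: x ps os)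
  next
    case (Some u)
    then have "u \<in> P" using join_P_cosets[OF assms(1) t] by simp
    then show ?thesis using Some m p_nica[OF assms(1) t] one_P_mult[OF assms(1) t]
      by (intro exI[of _ "(c, u) # m"]) (simp add: x ps os)
  qed
qed

lemma step_mult:
  assumes "snd ` set l \<subseteq> P" "snd ` set l' \<subseteq> P"
  shows "\<exists>m. snd ` set m \<subseteq> P \<and> (\<forall>r. step_fun m r = step_fun l r * step_fun l' r) \<and>
    (\<forall>h. step_op m h = step_op l (step_op l' h))"
  using assms(1)
proof (induction l)
  case Nil
  then show ?case by (intro exI[of _ "[]"]) simp
next
  case (Cons x l)
  obtain c t where x: "x = (c, t)" by force
  have t: "t \<in> P" using Cons.prems x by simp
  obtain m where m: "snd ` set m \<subseteq> P" "\<And>r. step_fun m r = step_fun l r * step_fun l' r"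
    "\<And>h. step_op m h = step_op l (step_op l' h)" using Cons by auto
  obtain n where n: "snd ` set n \<subseteq> P" "\<And>r. step_fun n r = one_P G P t r * step_fun l' r"
    "\<And>h. step_op n h = p t (step_op l' h)" using step_mult_one[OF t assms(2)] by blast
  show ?case
    using m n
    by (intro exI[of _ "map (\<lambda>(d, t). (c * d, t)) n @ m"])
      (simp add: x step_fun_scale step_op_scale snd_set_map_fst image_Un distrib_right mult.assoc del: set_map)
qed

section \<open>Extension from step functions to their uniform limits\<close>

text \<open>\<open>w\<close> is the value at \<open>h\<close> of the operator assigned to \<open>f\<close>.\<close>

definition ext_value :: "('a \<Rightarrow> complex) \<Rightarrow> 'h \<Rightarrow> 'h \<Rightarrow> bool" where
  "ext_value f h w \<longleftrightarrow> (\<forall>l \<epsilon>. snd ` set l \<subseteq> P \<longrightarrow> (\<forall>r\<in>P. cmod (f r - step_fun l r) \<le> \<epsilon>) \<longrightarrow>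
     norm (w - step_op l h) \<le> \<epsilon> * norm h)"

lemma step_op_diff_bound:
  assumes "snd ` set l \<subseteq> P" "snd ` set m \<subseteq> P"
    "\<And>r. r \<in> P \<Longrightarrow> cmod (f r - step_fun l r) \<le> \<delta>" "\<And>r. r \<in> P \<Longrightarrow> cmod (f r - step_fun m r) \<le> \<epsilon>"
  shows "norm (step_op l h - step_op m h) \<le> (\<delta> + \<epsilon>) * norm h"
proof -
  let ?n = "l @ map (\<lambda>(d, t). (-1 * d, t)) m"
  have "cmod (step_fun l r - step_fun m r) \<le> \<delta> + \<epsilon>" if "r \<in> P" for r
    using assms(3)[OF that] assms(4)[OF that] norm_triangle_ineq4[of "f r - step_fun m r" "f r - step_fun l r"] by simp
  then have "norm (step_op ?n h) \<le> (\<delta> + \<epsilon>) * norm h"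
    using assms(1,2) unfolding step_fun_simps step_fun_scale
    by (intro step_op_bound)
      (simp_all only: step_fun_simps step_fun_scale set_append image_Un snd_set_map_fst, auto)
  then show ?thesis unfolding step_op_simps step_op_scale by simp
qed

text \<open>\<open>ext_value\<close> speaks of every approximating list, but one good list for each
  accuracy is enough: any other list is compared with it by \<open>step_op_diff_bound\<close>. Since
  the accuracy is arbitrary, any constant \<open>M\<close> may stand in place of
  \<open>norm h\<close>.\<close>

lemma ext_valueI:
  assumes "\<And>\<epsilon>. \<epsilon> > 0 \<Longrightarrow> \<exists>l. snd ` set l \<subseteq> P \<and> (\<forall>r\<in>P. cmod (f r - step_fun l r) \<le> \<epsilon>) \<and>
      norm (w - step_op l h) \<le> \<epsilon> * M"
  shows "ext_value f h w"
  unfolding ext_value_def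
proof (intro allI impI)
  fix m \<delta> assume m: "snd ` set m \<subseteq> P" "\<forall>r\<in>P. cmod (f r - step_fun m r) \<le> \<delta>"
  show "norm (w - step_op m h) \<le> \<delta> * norm h"
  proof (rule field_le_epsilon)
    fix e :: real assume e: "e > 0"
    \<comment> \<open>Chosen so that \<open>\<epsilon> * (M + norm h)\<close> is at most
      \<open>e\<close>; the summand 1 keeps the denominator positive.\<close>
    define \<epsilon> where "\<epsilon> = e / (\<bar>M\<bar> + norm h + 1)"
    have pos: "\<bar>M\<bar> + norm h + 1 > 0" by (simp add: add_nonneg_pos)
    then have "\<epsilon> > 0" using e by (simp add: \<epsilon>_def)
    then obtain l where l: "snd ` set l \<subseteq> P" "\<forall>r\<in>P. cmod (f r - step_fun l r) \<le> \<epsilon>"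
      "norm (w - step_op l h) \<le> \<epsilon> * M" using assms by blast
    have "norm (w - step_op m h) \<le> norm (w - step_op l h) + norm (step_op l h - step_op m h)"
      using norm_triangle_ineq[of "w - step_op l h" "step_op l h - step_op m h"] by simp
    also have "\<dots> \<le> \<epsilon> * M + (\<epsilon> + \<delta>) * norm h"
      using l m by (intro add_mono step_op_diff_bound) auto
    also have "\<dots> = \<delta> * norm h + \<epsilon> * (M + norm h)" by (simp add: algebra_simps)
    also have "\<epsilon> * (M + norm h) \<le> \<epsilon> * (\<bar>M\<bar> + norm h + 1)"
      using \<open>\<epsilon> > 0\<close> by (intro mult_left_mono) auto
    also have "\<dots> = e" using pos by (simp add: \<epsilon>_def)
    finally show "norm (w - step_op m h) \<le> \<delta> * norm h + e" by simp
  qed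
qed

lemma ext_valueD:
  assumes "ext_value f h w" "snd ` set l \<subseteq> P" "\<And>r. r \<in> P \<Longrightarrow> cmod (f r - step_fun l r) \<le> \<epsilon>"
  shows "norm (w - step_op l h) \<le> \<epsilon> * norm h"
  by (rule assms(1)[unfolded ext_value_def, rule_format, OF assms(2,3)])

lemma ext_value_unique:
  assumes "approximable f" "ext_value f h w" "ext_value f h w'"
  shows "w = w'"
proof (rule eq_if_norm_diff_le)
  fix \<epsilon> :: real assume "\<epsilon> > 0"
  then obtain l where l: "snd ` set l \<subseteq> P" "\<And>r. r \<in> P \<Longrightarrow> cmod (f r - step_fun l r) \<le> \<epsilon>"
    by (rule approximableD[OF assms(1)]) blast
  have "norm (w - w') \<le> norm (w - step_op l h) + norm (w' - step_op l h)"
    using norm_triangle_ineq4[of "w - step_op l h" "w' - step_op l h"] by simp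
  also have "\<dots> \<le> \<epsilon> * norm h + \<epsilon> * norm h"
    by (intro add_mono ext_valueD[of f] assms l)
  finally show "norm (w - w') \<le> \<epsilon> * (norm h + norm h)" by (simp add: distrib_left)
qed

lemma ext_value_exists:
  assumes f: "approximable f"
  shows "\<exists>w. ext_value f h w"
proof -
  have "\<exists>l. snd ` set l \<subseteq> P \<and> (\<forall>r\<in>P. cmod (f r - step_fun l r) \<le> inverse (real (Suc n)))" for n
  proof -
    have "inverse (real (Suc n)) > 0" by simp
    then show ?thesis using f unfolding approximable_def by blast
  qed
  then obtain l where l: "\<And>n. snd ` set (l n) \<subseteq> P"
    "\<And>n r. r \<in> P \<Longrightarrow> cmod (f r - step_fun (l n) r) \<le> inverse (real (Suc n))" by metis
  define v where "v n = step_op (l n) h" for n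
  have vd: "norm (v m - v n) \<le> (inverse (real (Suc m)) + inverse (real (Suc n))) * norm h" for m n
    unfolding v_def by (rule step_op_diff_bound[of _ _ f]) (use l in auto)
  have "Cauchy v"
  proof (rule metric_CauchyI)
    fix e :: real assume e: "e > 0"
    have "(\<lambda>n. inverse (real (Suc n)) * norm h) \<longlonglongrightarrow> 0 * norm h"
      by (intro tendsto_mult LIMSEQ_inverse_real_of_nat tendsto_const)
    then have "\<forall>\<^sub>F n in sequentially. inverse (real (Suc n)) * norm h < e / 2"
      by (rule order_tendstoD) (use e in simp)
    then obtain N where N: "\<And>n. n \<ge> N \<Longrightarrow> inverse (real (Suc n)) * norm h < e / 2"
      unfolding eventually_sequentially by blast
    have "dist (v m) (v n) < e" if "m \<ge> N" "n \<ge> N" for m n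
      using vd[of m n] N[OF that(1)] N[OF that(2)] unfolding dist_norm distrib_right by linarith
    then show "\<exists>M. \<forall>m\<ge>M. \<forall>n\<ge>M. dist (v m) (v n) < e" by blast
  qed
  then obtain w where w: "v \<longlonglongrightarrow> w" using Cauchy_convergent convergent_def by blast
  have "ext_value f h w" unfolding ext_value_def
  proof (intro allI impI)
    fix m \<epsilon> assume m: "snd ` set m \<subseteq> P" "\<forall>r\<in>P. cmod (f r - step_fun m r) \<le> \<epsilon>"
    have "(\<lambda>n. norm (v n - step_op m h)) \<longlonglongrightarrow> norm (w - step_op m h)"
      by (intro tendsto_intros w)
    moreover have "(\<lambda>n. (inverse (real (Suc n)) + \<epsilon>) * norm h) \<longlonglongrightarrow> (0 + \<epsilon>) * norm h"
      by (intro tendsto_intros LIMSEQ_inverse_real_of_nat)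
    moreover have "norm (v n - step_op m h) \<le> (inverse (real (Suc n)) + \<epsilon>) * norm h" for n
      unfolding v_def by (rule step_op_diff_bound[of _ _ f]) (use l m in auto)
    ultimately have "norm (w - step_op m h) \<le> (0 + \<epsilon>) * norm h" by (intro LIMSEQ_le) auto
    then show "norm (w - step_op m h) \<le> \<epsilon> * norm h" by simp
  qed
  then show ?thesis ..
qed

definition ext_op :: "('a \<Rightarrow> complex) \<Rightarrow> 'h \<Rightarrow> 'h" where
  "ext_op f h = (THE w. ext_value f h w)"

lemma ext_op_value: "approximable f \<Longrightarrow> ext_value f h (ext_op f h)"
  unfolding ext_op_def by (rule theI') (use ext_value_exists ext_value_unique in blast)

lemma ext_op_eqI: "\<lbrakk>approximable f; ext_value f h w\<rbrakk> \<Longrightarrow> ext_op f h = w"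
  using ext_value_unique ext_op_value by blast

lemmas ext_op_approx = ext_valueD[OF ext_op_value]

lemma ext_op_bound:
  assumes "approximable f" "\<And>r. r \<in> P \<Longrightarrow> cmod (f r) \<le> K"
  shows "norm (ext_op f h) \<le> K * norm h"
  \<comment> \<open>The empty list approximates \<open>f\<close> by 0 with error
    \<open>K\<close>.\<close>
  using ext_op_approx[OF assms(1), of "[]" K h] by (simp add: assms(2))

lemma ext_op_one_P:
  assumes "t \<in> P" shows "ext_op (one_P G P t) = p t"
proof
  fix h
  have *: "snd ` set [(1, t)] \<subseteq> P" "step_fun [(1, t)] r = one_P G P t r" "step_op [(1, t)] h = p t h" for r
    using assms by (simp_all add: scaleC_one)
  have "approximable (one_P G P t)" unfolding approximable_def
    by (intro allI impI exI[of _ "[(1, t)]"]) (use * in auto)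
  moreover have "ext_value (one_P G P t) h (p t h)"
    \<comment> \<open>The one-entry list is exact, so the constant may be 0.\<close>
    by (rule ext_valueI[of _ _ _ 0], rule exI[of _ "[(1, t)]"]) (use * in auto)
  ultimately show "ext_op (one_P G P t) h = p t h" by (rule ext_op_eqI)
qed

lemma ext_op_add:
  assumes f: "approximable f" and g: "approximable g"
  shows "ext_op (\<lambda>r. f r + g r) h = ext_op f h + ext_op g h"
proof (rule ext_op_eqI[OF approximable_add[OF assms]], rule ext_valueI[where M = "norm h"])
  fix \<epsilon> :: real assume "\<epsilon> > 0"
  then have e: "\<epsilon> / 2 > 0" by simp
  obtain l where l: "snd ` set l \<subseteq> P" "\<And>r. r \<in> P \<Longrightarrow> cmod (f r - step_fun l r) \<le> \<epsilon> / 2"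
    by (rule approximableD[OF f e]) blast
  obtain m where m: "snd ` set m \<subseteq> P" "\<And>r. r \<in> P \<Longrightarrow> cmod (g r - step_fun m r) \<le> \<epsilon> / 2"
    by (rule approximableD[OF g e]) blast
  have "cmod ((f r + g r) - step_fun (l @ m) r) \<le> \<epsilon>" if "r \<in> P" for r
    using norm_triangle_mono[OF l(2)[OF that] m(2)[OF that]] by (simp add: algebra_simps)
  moreover have "norm (ext_op f h + ext_op g h - step_op (l @ m) h) \<le> \<epsilon> * norm h"
    using norm_triangle_mono[OF ext_op_approx[OF f l] ext_op_approx[OF g m], of h h]
    by (simp add: algebra_simps)
  ultimately show "\<exists>l. snd ` set l \<subseteq> P \<and> (\<forall>r\<in>P. cmod (f r + g r - step_fun l r) \<le> \<epsilon>) \<and>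
      norm (ext_op f h + ext_op g h - step_op l h) \<le> \<epsilon> * norm h"
    using l(1) m(1) by (intro exI[of _ "l @ m"]) auto
qed

lemma ext_op_scale:
  assumes f: "approximable f" and cf: "approximable (\<lambda>r. c * f r)"
  shows "ext_op (\<lambda>r. c * f r) h = c *\<^sub>C ext_op f h"
proof (rule ext_op_eqI[OF cf], rule ext_valueI[where M = "norm h"])
  fix \<epsilon> :: real assume e: "\<epsilon> > 0"
  have pos: "cmod c + 1 > 0" by (simp add: add_nonneg_pos)
  define \<delta> where "\<delta> = \<epsilon> / (cmod c + 1)"
  have d: "\<delta> > 0" "cmod c * \<delta> \<le> \<epsilon>" using e pos by (auto simp: \<delta>_def field_simps)
  obtain l where l: "snd ` set l \<subseteq> P" "\<And>r. r \<in> P \<Longrightarrow> cmod (f r - step_fun l r) \<le> \<delta>"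
    by (rule approximableD[OF f d(1)]) blast
  let ?l = "map (\<lambda>(d, t). (c * d, t)) l"
  have "cmod (c * f r - step_fun ?l r) \<le> \<epsilon>" if "r \<in> P" for r
    unfolding step_fun_scale right_diff_distrib[symmetric] norm_mult
    using mult_left_mono[OF l(2)[OF that], of "cmod c"] d(2) by simp
  moreover have "norm (c *\<^sub>C ext_op f h - step_op ?l h) \<le> \<epsilon> * norm h"
  proof -
    have "norm (c *\<^sub>C ext_op f h - step_op ?l h) = cmod c * norm (ext_op f h - step_op l h)"
      by (simp add: step_op_scale complex_vs.scale_right_diff_distrib[symmetric] norm_scaleC
          del: complex_vs.scale_right_diff_distrib)
    also have "\<dots> \<le> cmod c * (\<delta> * norm h)" by (intro mult_left_mono ext_op_approx f l) auto
    also have "\<dots> \<le> \<epsilon> * norm h" using d(2) by (simp add: mult.assoc[symmetric] mult_right_mono)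
    finally show ?thesis .
  qed
  ultimately show "\<exists>l. snd ` set l \<subseteq> P \<and> (\<forall>r\<in>P. cmod (c * f r - step_fun l r) \<le> \<epsilon>) \<and>
      norm (c *\<^sub>C ext_op f h - step_op l h) \<le> \<epsilon> * norm h"
    using l(1) by (intro exI[of _ ?l]) (auto simp: snd_set_map_fst simp del: set_map)
qed

lemma ext_op_bounded_ops:
  assumes f: "approximable f" and K: "\<And>r. r \<in> P \<Longrightarrow> cmod (f r) \<le> K"
  shows "ext_op f \<in> bounded_ops"
proof (rule bounded_opsI)
  show "norm (ext_op f h) \<le> K * norm h" for h using ext_op_bound[OF f K] .
next
  fix x y
  show "ext_op f (x + y) = ext_op f x + ext_op f y"
  proof (rule eq_if_norm_diff_le)
    fix \<epsilon> :: real assume "\<epsilon> > 0"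
    then obtain l where l: "snd ` set l \<subseteq> P" "\<And>r. r \<in> P \<Longrightarrow> cmod (f r - step_fun l r) \<le> \<epsilon>"
      by (rule approximableD[OF f]) blast
    have "ext_op f (x + y) - (ext_op f x + ext_op f y) =
      (ext_op f (x + y) - step_op l (x + y)) - ((ext_op f x - step_op l x) + (ext_op f y - step_op l y))"
      by (simp add: bounded_ops_add[OF step_op_bounded_ops[OF l(1)]])
    also have "norm \<dots> \<le> \<epsilon> * norm (x + y) + (\<epsilon> * norm x + \<epsilon> * norm y)"
      by (intro order_trans[OF norm_triangle_ineq4] add_mono norm_triangle_mono ext_op_approx f l)
    finally show "norm (ext_op f (x + y) - (ext_op f x + ext_op f y)) \<le>
        \<epsilon> * (norm (x + y) + norm x + norm y)" by (simp add: algebra_simps)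
  qed
next
  fix c x
  show "ext_op f (c *\<^sub>C x) = c *\<^sub>C ext_op f x"
  proof (rule eq_if_norm_diff_le)
    fix \<epsilon> :: real assume "\<epsilon> > 0"
    then obtain l where l: "snd ` set l \<subseteq> P" "\<And>r. r \<in> P \<Longrightarrow> cmod (f r - step_fun l r) \<le> \<epsilon>"
      by (rule approximableD[OF f]) blast
    have "ext_op f (c *\<^sub>C x) - c *\<^sub>C ext_op f x =
      (ext_op f (c *\<^sub>C x) - step_op l (c *\<^sub>C x)) - c *\<^sub>C (ext_op f x - step_op l x)"
      by (simp add: bounded_ops_scaleC[OF step_op_bounded_ops[OF l(1)]] complex_vs.scale_right_diff_distrib)
    also have "norm \<dots> \<le> \<epsilon> * norm (c *\<^sub>C x) + cmod c * (\<epsilon> * norm x)"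
      unfolding norm_scaleC[of c "ext_op f x - step_op l x", symmetric]
      by (intro order_trans[OF norm_triangle_ineq4] add_mono ext_op_approx f l)
        (simp_all add: norm_scaleC mult_left_mono ext_op_approx f l)
    finally show "norm (ext_op f (c *\<^sub>C x) - c *\<^sub>C ext_op f x) \<le>
        \<epsilon> * (norm (c *\<^sub>C x) + cmod c * norm x)" by (simp add: algebra_simps)
  qed
qed

lemma ext_op_cnj:
  assumes f: "approximable f" and K: "\<And>r. r \<in> P \<Longrightarrow> cmod (f r) \<le> K"
  shows "ext_op (\<lambda>r. cnj (f r)) = adj (ext_op f)"
proof -
  have d: "cmod (cnj (f r) - step_fun (map (\<lambda>(d, t). (cnj d, t)) l) r) = cmod (f r - step_fun l r)" for l r
    unfolding step_fun_cnj complex_cnj_diff[symmetric] complex_mod_cnj ..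
  have cf: "approximable (\<lambda>r. cnj (f r))"
    unfolding approximable_def
  proof (intro allI impI)
    fix \<epsilon> :: real assume "\<epsilon> > 0"
    then obtain l where l: "snd ` set l \<subseteq> P" "\<And>r. r \<in> P \<Longrightarrow> cmod (f r - step_fun l r) \<le> \<epsilon>"
      by (rule approximableD[OF f]) blast
    then show "\<exists>l. snd ` set l \<subseteq> P \<and> (\<forall>r\<in>P. cmod (cnj (f r) - step_fun l r) \<le> \<epsilon>)"
      by (intro exI[of _ "map (\<lambda>(d, t). (cnj d, t)) l"]) (simp add: d snd_set_map_fst del: set_map)
  qed
  show ?thesis
  proof (rule adj_eqI[symmetric])
    show "ext_op (\<lambda>r. cnj (f r)) \<in> bounded_ops"
      using cf K by (intro ext_op_bounded_ops) auto
  next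
    fix x y
    show "cinner (ext_op f x) y = cinner x (ext_op (\<lambda>r. cnj (f r)) y)"
    proof (rule eq_if_norm_diff_le)
      fix \<epsilon> :: real assume "\<epsilon> > 0"
      then obtain l where l: "snd ` set l \<subseteq> P" "\<And>r. r \<in> P \<Longrightarrow> cmod (f r - step_fun l r) \<le> \<epsilon>"
        by (rule approximableD[OF f]) blast
      let ?l = "map (\<lambda>(d, t). (cnj d, t)) l"
      have "cinner (ext_op f x) y - cinner x (ext_op (\<lambda>r. cnj (f r)) y) =
        cinner (ext_op f x - step_op l x) y - cinner x (ext_op (\<lambda>r. cnj (f r)) y - step_op ?l y)"
        using step_op_cnj[OF l(1)] by (simp add: cinner_diff_left cinner_diff_right)
      also have "cmod \<dots> \<le> norm (ext_op f x - step_op l x) * norm y +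
          norm x * norm (ext_op (\<lambda>r. cnj (f r)) y - step_op ?l y)"
        by (intro order_trans[OF norm_triangle_ineq4] add_mono cauchy_schwarz)
      also have "\<dots> \<le> (\<epsilon> * norm x) * norm y + norm x * (\<epsilon> * norm y)"
        by (intro add_mono mult_right_mono mult_left_mono ext_op_approx f l cf)
          (simp_all add: d l snd_set_map_fst del: set_map)
      finally show "norm (cinner (ext_op f x) y - cinner x (ext_op (\<lambda>r. cnj (f r)) y)) \<le>
          \<epsilon> * (norm x * norm y + norm x * norm y)" by (simp add: algebra_simps)
    qed
  qed
qed

text \<open>A single list approximates both the product function and the composed operator. This
  yields approximability of the product together with the value of \<open>ext_op\<close> at
  it.\<close>

lemma step_mult_approx:
  assumes f: "approximable f" and g: "approximable g" and K: "K \<ge> 0"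
    and fK: "\<And>r. r \<in> P \<Longrightarrow> cmod (f r) \<le> K" and gK: "\<And>r. r \<in> P \<Longrightarrow> cmod (g r) \<le> K"
    and e: "\<epsilon> > 0"
  shows "\<exists>m. snd ` set m \<subseteq> P \<and> (\<forall>r\<in>P. cmod (f r * g r - step_fun m r) \<le> \<epsilon>) \<and>
    norm (ext_op f (ext_op g h) - step_op m h) \<le> \<epsilon> * norm h"
proof -
  \<comment> \<open>The error is at most \<open>K * \<delta>\<close> from replacing \<open>g\<close>
    plus \<open>\<delta> * (K + 1)\<close> from replacing \<open>f\<close>. The cap
    \<open>\<delta> \<le> 1\<close> is what bounds the step function near \<open>g\<close> by
    \<open>K + 1\<close>.\<close>
  define \<delta> where "\<delta> = min 1 (\<epsilon> / (2 * K + 1))"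
  have d: "\<delta> > 0" "\<delta> \<le> 1" using e K by (auto simp: \<delta>_def)
  have "2 * K + 1 > 0" "\<delta> \<le> \<epsilon> / (2 * K + 1)" using K by (simp_all add: \<delta>_def)
  then have "\<delta> * (2 * K + 1) \<le> \<epsilon>" by (simp only: pos_le_divide_eq)
  then have d3: "K * \<delta> + \<delta> * (K + 1) \<le> \<epsilon>" using K by (simp add: algebra_simps)
  obtain l where l: "snd ` set l \<subseteq> P" "\<And>r. r \<in> P \<Longrightarrow> cmod (f r - step_fun l r) \<le> \<delta>"
    by (rule approximableD[OF f d(1)]) blast
  obtain n where n: "snd ` set n \<subseteq> P" "\<And>r. r \<in> P \<Longrightarrow> cmod (g r - step_fun n r) \<le> \<delta>"
    by (rule approximableD[OF g d(1)]) blast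
  obtain m where m: "snd ` set m \<subseteq> P" "\<And>r. step_fun m r = step_fun l r * step_fun n r"
    "\<And>h. step_op m h = step_op l (step_op n h)" using step_mult[OF l(1) n(1)] by blast
  have nK: "cmod (step_fun n r) \<le> K + 1" if "r \<in> P" for r
    using norm_triangle_ineq4[of "g r" "g r - step_fun n r"] gK[OF that] n(2)[OF that] d(2) by simp
  have "cmod (f r * g r - step_fun m r) \<le> \<epsilon>" if r: "r \<in> P" for r
  proof -
    have "f r * g r - step_fun m r = f r * (g r - step_fun n r) + (f r - step_fun l r) * step_fun n r"
      by (simp add: m(2) algebra_simps)
    also have "cmod \<dots> \<le> K * \<delta> + \<delta> * (K + 1)"
      using K d by (intro norm_triangle_mono; unfold norm_mult; intro mult_mono) (auto simp: fK l n nK r)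
    finally show ?thesis using d3 by simp
  qed
  moreover have "norm (ext_op f (ext_op g h) - step_op m h) \<le> \<epsilon> * norm h"
  proof -
    have "ext_op f (ext_op g h) - step_op m h = ext_op f (ext_op g h - step_op n h) +
        (ext_op f (step_op n h) - step_op l (step_op n h))"
      using bounded_ops_diff[OF ext_op_bounded_ops[OF f fK]] by (simp add: m(3))
    also have "norm \<dots> \<le> K * (\<delta> * norm h) + \<delta> * ((K + 1) * norm h)"
    proof (rule norm_triangle_mono)
      show "norm (ext_op f (ext_op g h - step_op n h)) \<le> K * (\<delta> * norm h)"
        using K by (intro order_trans[OF ext_op_bound[OF f fK]] mult_left_mono ext_op_approx g n) auto
      show "norm (ext_op f (step_op n h) - step_op l (step_op n h)) \<le> \<delta> * ((K + 1) * norm h)"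
        using d by (intro order_trans[OF ext_op_approx[OF f l]] mult_left_mono step_op_bound n nK) auto
    qed
    also have "\<dots> = (K * \<delta> + \<delta> * (K + 1)) * norm h" by (simp add: algebra_simps)
    also have "\<dots> \<le> \<epsilon> * norm h" using d3 by (intro mult_right_mono) auto
    finally show ?thesis .
  qed
  ultimately show ?thesis using m(1) by blast
qed

lemma ext_op_mult:
  assumes "approximable f" "approximable g" "K \<ge> 0"
    "\<And>r. r \<in> P \<Longrightarrow> cmod (f r) \<le> K" "\<And>r. r \<in> P \<Longrightarrow> cmod (g r) \<le> K"
  shows "ext_op (\<lambda>r. f r * g r) h = ext_op f (ext_op g h)"
proof (rule ext_op_eqI)
  show "ext_value (\<lambda>r. f r * g r) h (ext_op f (ext_op g h))"
    by (rule ext_valueI, rule step_mult_approx) (use assms in auto)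
  show "approximable (\<lambda>r. f r * g r)"
    unfolding approximable_def using step_mult_approx[OF assms] by blast
qed

lemma ext_op_B_P_rep: "B_P_rep G P ext_op"
  unfolding B_P_rep_def star_rep_def
proof (intro conjI ballI allI)
  fix f g assume f: "f \<in> B_P G P" and g: "g \<in> B_P G P"
  note ap = B_P_approximable
  obtain K where K: "\<And>r. cmod (f r) \<le> K" "K \<ge> 0" using B_P_bounded[OF f] by blast
  obtain M where M: "\<And>r. cmod (g r) \<le> M" "M \<ge> 0" using B_P_bounded[OF g] by blast
  show "ext_op (\<lambda>r. f r + g r) = op_add (ext_op f) (ext_op g)"
    using ext_op_add[OF ap ap] f g by (simp add: op_add_def fun_eq_iff)
  show "ext_op (\<lambda>r. f r * g r) = ext_op f \<circ> ext_op g"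
    using ext_op_mult[OF ap[OF f] ap[OF g], of "max K M"] K M by (simp add: fun_eq_iff le_max_iff_disj)
next
  fix f assume f: "f \<in> B_P G P"
  note ap = B_P_approximable[OF f]
  obtain K where K: "\<And>r. cmod (f r) \<le> K" "K \<ge> 0" using B_P_bounded[OF f] by blast
  show "ext_op f \<in> bounded_ops" using ext_op_bounded_ops[OF ap K(1)] .
  show "ext_op (\<lambda>r. cnj (f r)) = adj (ext_op f)" using ext_op_cnj[OF ap K(1)] .
  show "ext_op (\<lambda>r. c * f r) = op_scale c (ext_op f)" for c
    using ext_op_scale[OF ap B_P_approximable[OF B_P_scale[OF f]]] by (simp add: op_scale_def fun_eq_iff)
qed

end

section \<open>The endomorphisms of the commutant\<close>

locale toeplitz_representation = quasi_lattice_ordered G P + product_system G P X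
  for G :: "('g, 'm) monoid_scheme" (structure) and P
    and X :: "('g, 'a::cstar_algebra, 'x) prodsys" +
  fixes \<psi> :: "'x \<Rightarrow> 'h::complex_hilbert \<Rightarrow> 'h"
  assumes toeplitz: "toeplitz_rep P X \<psi>"
begin

abbreviation \<pi> :: "'a \<Rightarrow> 'h \<Rightarrow> 'h" where "\<pi> a \<equiv> \<psi> (emb X a)"

section \<open>Toeplitz relations in terms of vectors\<close>

lemma fibre_carrierD:
  assumes "s \<in> P" "x \<in> carrier (fibre X s)" shows "x \<in> carrier X" "deg X x = s"
  using assms fibre_carrier by auto

lemma \<psi>_bounded_ops: "\<lbrakk>s \<in> P; x \<in> carrier (fibre X s)\<rbrakk> \<Longrightarrow> \<psi> x \<in> bounded_ops"
  using toeplitz fibre_carrierD unfolding toeplitz_rep_def by blast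

lemma emb_fibre: "emb X a \<in> carrier (fibre X \<one>)"
  using fibre_one by (auto simp: bimod_iso_def bij_betw_def std_bimod_def)

lemma fibre_one_emb: "x \<in> carrier (fibre X \<one>) \<Longrightarrow> \<exists>a. x = emb X a"
  using fibre_one by (auto simp: bimod_iso_def bij_betw_def std_bimod_def)

lemma \<pi>_bounded_ops: "\<pi> a \<in> bounded_ops"
  using \<psi>_bounded_ops[OF one_closed emb_fibre] .

lemma \<pi>_star_rep: "star_rep UNIV (+) scaleC (*) star (\<psi> \<circ> emb X)"
  using toeplitz by (simp add: toeplitz_rep_def)

lemma \<pi>_star: "\<pi> (star a) = adj (\<pi> a)"
  using \<pi>_star_rep by (simp add: star_rep_def)

lemma \<psi>_add: "\<lbrakk>s \<in> P; x \<in> carrier (fibre X s); y \<in> carrier (fibre X s)\<rbrakk>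
    \<Longrightarrow> \<psi> (hadd (fibre X s) x y) h = \<psi> x h + \<psi> y h"
  using toeplitz by (simp add: toeplitz_rep_def op_add_def)

lemma \<psi>_scale: "\<lbrakk>s \<in> P; x \<in> carrier (fibre X s)\<rbrakk>
    \<Longrightarrow> \<psi> (hscale (fibre X s) c x) h = c *\<^sub>C \<psi> x h"
  using toeplitz by (simp add: toeplitz_rep_def op_scale_def)

lemma \<psi>_ptimes: "\<lbrakk>x \<in> carrier X; y \<in> carrier X\<rbrakk> \<Longrightarrow> \<psi> (ptimes X x y) h = \<psi> x (\<psi> y h)"
  using toeplitz by (simp add: toeplitz_rep_def)

lemma \<psi>_lact:
  assumes "s \<in> P" "x \<in> carrier (fibre X s)"
  shows "\<psi> (lact (fibre X s) a x) h = \<pi> a (\<psi> x h)"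
  using \<psi>_ptimes[of "emb X a" x h] emb_ptimes[OF assms] fibre_carrierD[OF assms]
    fibre_carrierD[OF one_closed emb_fibre] by simp

lemma lact_fibre: "\<lbrakk>s \<in> P; x \<in> carrier (fibre X s)\<rbrakk> \<Longrightarrow> lact (fibre X s) a x \<in> carrier (fibre X s)"
  using hilbert_bimodule.lact_closed[OF fibre_bimodule] .

lemma \<psi>_ip:
  assumes "s \<in> P" "x \<in> carrier (fibre X s)" "y \<in> carrier (fibre X s)"
  shows "cinner (\<psi> x h) (\<psi> y k) = cinner h (\<pi> (ip (fibre X s) x y) k)"
proof -
  have "adj (\<psi> x) \<circ> \<psi> y = \<pi> (ip (fibre X s) x y)"
    using toeplitz assms by (simp add: toeplitz_rep_def)
  then have "adj (\<psi> x) (\<psi> y k) = \<pi> (ip (fibre X s) x y) k" by (metis comp_apply)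
  then show ?thesis using cinner_adj[OF \<psi>_bounded_ops[OF assms(1,2)]] by simp
qed

text \<open>The squared norm of \<open>\<psi> x h\<close> is the inner product of \<open>h\<close>
  with the image of \<open>ip x x\<close> applied to \<open>h\<close>, and the representation of
  \<open>A\<close> is contractive. Through this bound density in a module norm becomes density of
  vectors.\<close>

lemma \<psi>_norm_le:
  assumes "s \<in> P" "x \<in> carrier (fibre X s)"
  shows "norm (\<psi> x h) \<le> sqrt (norm (ip (fibre X s) x x)) * norm h"
proof -
  let ?b = "ip (fibre X s) x x"
  have "complex_of_real ((norm (\<psi> x h))\<^sup>2) = cinner h (\<pi> ?b h)"
    using \<psi>_ip[OF assms assms(2), of h h] by (simp add: cinner_self)
  then have "(norm (\<psi> x h))\<^sup>2 = cmod (cinner h (\<pi> ?b h))"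
    by (metis abs_of_nonneg norm_of_real zero_le_power2)
  also have "\<dots> \<le> norm h * norm (\<pi> ?b h)" by (rule cauchy_schwarz)
  also have "\<dots> \<le> norm h * (norm ?b * norm h)"
    using cstar_rep_contractive[OF \<pi>_star_rep] by (intro mult_left_mono) auto
  also have "\<dots> = (sqrt (norm ?b) * norm h)\<^sup>2" by (simp add: power_mult_distrib power2_eq_square[of "norm h"])
  finally show ?thesis by (rule power2_le_imp_le) simp
qed

section \<open>The commutant, and the estimate for finite sums\<close>

lemma commutantI:
  assumes "S \<in> bounded_ops" "\<And>a h. S (\<pi> a h) = \<pi> a (S h)" shows "S \<in> commutant X \<psi>"
  using assms by (auto simp: commutant_def)

lemma commutantD:
  assumes "S \<in> commutant X \<psi>" shows "S \<in> bounded_ops" "S (\<pi> a h) = \<pi> a (S h)"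
  using assms by (auto simp: commutant_def fun_eq_iff)

lemma commutant_id: "id \<in> commutant X \<psi>"
  by (rule commutantI) auto

lemma commutant_comp: "\<lbrakk>S \<in> commutant X \<psi>; T \<in> commutant X \<psi>\<rbrakk> \<Longrightarrow> S \<circ> T \<in> commutant X \<psi>"
  by (rule commutantI) (simp_all add: comp_bounded_ops commutantD)

lemma commutant_add: "\<lbrakk>S \<in> commutant X \<psi>; T \<in> commutant X \<psi>\<rbrakk> \<Longrightarrow> op_add S T \<in> commutant X \<psi>"
  by (rule commutantI)
    (simp_all add: op_add_bounded_ops commutantD, simp add: op_add_def commutantD bounded_ops_add[OF \<pi>_bounded_ops])

lemma commutant_scale: "S \<in> commutant X \<psi> \<Longrightarrow> op_scale c S \<in> commutant X \<psi>"
  by (rule commutantI)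
    (simp_all add: op_scale_bounded_ops commutantD, simp add: op_scale_def commutantD bounded_ops_scaleC[OF \<pi>_bounded_ops])

lemma commutant_adj:
  assumes S: "S \<in> commutant X \<psi>" shows "adj S \<in> commutant X \<psi>"
proof (rule commutantI)
  note SB = commutantD(1)[OF S]
  show "adj S \<in> bounded_ops" using adj_bounded_ops[OF SB] .
  fix a h
  show "adj S (\<pi> a h) = \<pi> a (adj S h)"
  proof (rule cinner_eqI)
    fix z
    have "cinner z (adj S (\<pi> a h)) = cinner (\<pi> (star a) (S z)) h"
      by (simp only: cinner_adj[OF SB, symmetric] \<pi>_star cinner_adj_left[OF \<pi>_bounded_ops])
    also have "\<dots> = cinner (\<pi> (star a) z) (adj S h)"
      by (simp only: commutantD(2)[OF S, symmetric] cinner_adj[OF SB])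
    also have "\<dots> = cinner z (\<pi> a (adj S h))"
      by (simp only: \<pi>_star cinner_adj_left[OF \<pi>_bounded_ops])
    finally show "cinner z (adj S (\<pi> a h)) = cinner z (\<pi> a (adj S h))" .
  qed
qed

text \<open>A list of pairs stands for an element of the algebraic tensor product of a fibre with
  the Hilbert space, and \<open>ev\<close> is the canonical map from there. Accordingly
  \<open>map (apsnd S)\<close> is the identity tensor \<open>S\<close>, defined on lists before it
  is known to be defined on vectors.\<close>

definition ev :: "('x \<times> 'h) list \<Rightarrow> 'h" where
  "ev l = (\<Sum>(x, h)\<leftarrow>l. \<psi> x h)"

lemma ev_simps [simp]: "ev [] = 0" "ev ((x, h) # l) = \<psi> x h + ev l" "ev (l @ m) = ev l + ev m"
  by (simp_all add: ev_def)

text \<open>Inner products of vectors \<open>\<psi> x h\<close> involve \<open>x\<close> and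
  \<open>y\<close> only through an element of \<open>A\<close>, whose image commutes with
  \<open>S\<close>. So \<open>S\<close> can be moved across as its adjoint.\<close>

lemma cinner_ev_map_commutant:
  assumes s: "s \<in> P" and S: "S \<in> commutant X \<psi>"
    and l: "fst ` set l \<subseteq> carrier (fibre X s)" and m: "fst ` set m \<subseteq> carrier (fibre X s)"
  shows "cinner (ev (map (apsnd S) l)) (ev m) = cinner (ev l) (ev (map (apsnd (adj S)) m))"
proof -
  have one: "cinner (\<psi> x (S h)) (\<psi> y k) = cinner (\<psi> x h) (\<psi> y (adj S k))"
    if "x \<in> carrier (fibre X s)" "y \<in> carrier (fibre X s)" for x y h k
    unfolding \<psi>_ip[OF s that] cinner_adj[OF commutantD(1)[OF S]]
    by (simp add: commutantD(2)[OF commutant_adj[OF S]])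
  have "cinner (\<psi> x (S h)) (ev m) = cinner (\<psi> x h) (ev (map (apsnd (adj S)) m))"
    if x: "x \<in> carrier (fibre X s)" for x h
    using m by (induction m) (auto simp: cinner_add_right one x)
  then show ?thesis using l by (induction l) (auto simp: cinner_add_left)
qed

text \<open>In particular lists with equal \<open>ev\<close> are sent to equal vectors, by applying
  the bound to their difference; this is why the induced operator is well defined.\<close>

lemma ev_map_bound:
  assumes s: "s \<in> P" and S: "S \<in> commutant X \<psi>" and K: "K \<ge> 0" "\<And>h. norm (S h) \<le> K * norm h"
    and l: "fst ` set l \<subseteq> carrier (fibre X s)"
  shows "norm (ev (map (apsnd S) l)) \<le> K * norm (ev l)"
proof -
  note SB = commutantD(1)[OF S]
  define R where "R = adj S \<circ> S"
  have R: "R \<in> commutant X \<psi>" unfolding R_def by (intro commutant_comp commutant_adj S)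
  have adjR: "adj R = R"
    by (rule adj_eqI) (use commutantD(1)[OF R] in \<open>simp_all add: R_def cinner_adj_left[OF SB] cinner_adj[OF SB]\<close>)
  have Rle: "norm (R h) \<le> K\<^sup>2 * norm h" for h
  proof -
    have "norm (R h) \<le> K * norm (S h)" using adj_norm_le[OF SB K(2,1)] by (simp add: R_def)
    also have "\<dots> \<le> K * (K * norm h)" using K by (intro mult_left_mono) auto
    finally show ?thesis by (simp add: power2_eq_square mult.assoc)
  qed
  define l' where "l' n = map (apsnd (R ^^ n)) l" for n
  have l': "fst ` set (l' n) \<subseteq> carrier (fibre X s)" for n
    using l by (auto simp: l'_def)
  have l'Suc: "l' (Suc n) = map (apsnd R) (l' n)" for n by (simp add: l'_def apsnd_compose)
  define a where "a n = norm (ev (l' n))" for n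
  have Rn: "norm ((R ^^ n) h) \<le> (K\<^sup>2) ^ n * norm h" for n h
  proof (induction n)
    case (Suc n)
    have "norm ((R ^^ Suc n) h) \<le> K\<^sup>2 * norm ((R ^^ n) h)" using Rle by simp
    also have "\<dots> \<le> K\<^sup>2 * ((K\<^sup>2) ^ n * norm h)" using Suc by (intro mult_left_mono) auto
    finally show ?case by (simp add: mult.assoc)
  qed simp
  \<comment> \<open>A crude constant depending on the list, collecting bounds of the
    \<open>\<psi> x\<close> and norms of the \<open>h\<close>. The ratio bound depends only on the
    growth rate \<open>K\<^sup>2\<close>.\<close>
  have "\<exists>C. \<forall>n. norm (ev (map (apsnd (R ^^ n)) l)) \<le> C * (K\<^sup>2) ^ n"
    using l
  proof (induction l)
    case (Cons z l)
    obtain x h where z: "z = (x, h)" by force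
    obtain C where C: "\<And>n. norm (ev (map (apsnd (R ^^ n)) l)) \<le> C * (K\<^sup>2) ^ n" using Cons by auto
    have "\<psi> x \<in> bounded_ops" using Cons.prems z by (intro \<psi>_bounded_ops[OF s]) auto
    then obtain M where M: "M \<ge> 0" "\<And>h. norm (\<psi> x h) \<le> M * norm h" using bounded_ops_bound by blast
    have "norm (ev (map (apsnd (R ^^ n)) (z # l))) \<le> (M * norm h + C) * (K\<^sup>2) ^ n" for n
    proof -
      have "norm (\<psi> x ((R ^^ n) h)) \<le> M * ((K\<^sup>2) ^ n * norm h)"
        using M Rn by (meson mult_left_mono order_trans)
      then have "norm (\<psi> x ((R ^^ n) h) + ev (map (apsnd (R ^^ n)) l)) \<le>
          M * ((K\<^sup>2) ^ n * norm h) + C * (K\<^sup>2) ^ n"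
        using C by (rule norm_triangle_mono)
      then show ?thesis by (simp add: z algebra_simps)
    qed
    then show ?case by blast
  qed (auto intro: exI[of _ 0])
  then obtain C where C: "\<And>n. a n \<le> C * (K\<^sup>2) ^ n" unfolding a_def l'_def by blast
  have "a 1 \<le> K\<^sup>2 * a 0"
  proof (rule log_convex_ratio_bound[OF _ _ C])
    fix n
    \<comment> \<open>One self-adjoint factor \<open>R\<close> moves across the inner product;
      Cauchy-Schwarz then is exactly log-convexity.\<close>
    have "complex_of_real ((a (Suc n))\<^sup>2) = cinner (ev (l' n)) (ev (l' (Suc (Suc n))))"
      using cinner_ev_map_commutant[OF s R l' l', of n "Suc n"]
      by (simp add: a_def cinner_self adjR l'Suc)
    then have "(a (Suc n))\<^sup>2 = cmod (cinner (ev (l' n)) (ev (l' (Suc (Suc n)))))"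
      by (metis abs_of_nonneg norm_of_real zero_le_power2)
    then show "(a (Suc n))\<^sup>2 \<le> a n * a (Suc (Suc n))" using cauchy_schwarz by (simp add: a_def)
  qed (auto simp: a_def)
  have l0: "l' 0 = l" by (simp add: l'_def apsnd_def prod.map_id0)
  \<comment> \<open>Moving \<open>S\<close> across likewise returns from \<open>R\<close> to
    \<open>S\<close>: the squared norm of the image is the inner product with the
    \<open>R\<close>-image.\<close>
  have "map (apsnd (adj S)) (map (apsnd S) l) = l' 1" by (simp add: l'_def R_def apsnd_compose comp_def)
  then have "complex_of_real ((norm (ev (map (apsnd S) l)))\<^sup>2) = cinner (ev l) (ev (l' 1))"
    using cinner_ev_map_commutant[OF s S l, of "map (apsnd S) l"] l by (simp add: cinner_self image_image)
  then have "(norm (ev (map (apsnd S) l)))\<^sup>2 = cmod (cinner (ev l) (ev (l' 1)))"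
    by (metis abs_of_nonneg norm_of_real zero_le_power2)
  also have "\<dots> \<le> norm (ev l) * a 1" unfolding a_def by (rule cauchy_schwarz)
  also have "\<dots> \<le> norm (ev l) * (K\<^sup>2 * a 0)" using \<open>a 1 \<le> K\<^sup>2 * a 0\<close> by (intro mult_left_mono) auto
  also have "\<dots> = (K * norm (ev l))\<^sup>2" by (simp add: a_def l0 power2_eq_square)
  finally show ?thesis by (rule power2_le_imp_le) (simp add: K)
qed

text \<open>The value of the endomorphism at one \<open>S\<close>. The vanishing condition is asked
  for every \<open>S\<close>, while \<open>alpha\<close> asks it at \<open>id\<close> only;
  multiplicativity makes the two agree.\<close>

definition induced :: "'g \<Rightarrow> ('h \<Rightarrow> 'h) \<Rightarrow> ('h \<Rightarrow> 'h) \<Rightarrow> bool" where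
  "induced s S T \<longleftrightarrow> T \<in> bounded_ops \<and> (\<forall>x\<in>carrier (fibre X s). \<forall>h. T (\<psi> x h) = \<psi> x (S h)) \<and>
     (\<forall>k. (\<forall>x\<in>carrier (fibre X s). \<forall>h. cinner (\<psi> x h) k = 0) \<longrightarrow> T k = 0)"

lemma induced_unique: "\<lbrakk>induced s S T; induced s S T'\<rbrakk> \<Longrightarrow> T = T'"
  by (rule op_eqI[where W = "{\<psi> x h | x h. x \<in> carrier (fibre X s)}"]) (auto simp: induced_def, metis)

text \<open>The relation between sums and their images satisfies the hypotheses of the graph
  extension by \<open>ev_map_bound\<close>. The last clause, that the range of \<open>T\<close> lies
  in the closed span of the vectors \<open>\<psi> x (S h)\<close>, is what adjoints and compositions
  of degrees rely on.\<close>

lemma induced_exists: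
  assumes s: "s \<in> P" and S: "S \<in> commutant X \<psi>" and K: "K \<ge> 0" "\<And>h. norm (S h) \<le> K * norm h"
  shows "\<exists>T. induced s S T \<and> (\<forall>k. norm (T k) \<le> K * norm k) \<and>
    (\<forall>z k. (\<forall>x\<in>carrier (fibre X s). \<forall>h. cinner (\<psi> x (S h)) z = 0) \<longrightarrow> cinner (T k) z = 0)"
proof -
  let ?F = "carrier (fibre X s)"
  define Gr where "Gr = {(ev l, ev (map (apsnd S) l)) | l. fst ` set l \<subseteq> ?F}"
  have GrI: "(ev l, ev (map (apsnd S) l)) \<in> Gr" if "fst ` set l \<subseteq> ?F" for l using that by (auto simp: Gr_def)
  have Gr1: "(\<psi> x h, \<psi> x (S h)) \<in> Gr" if "x \<in> ?F" for x h using GrI[of "[(x, h)]"] that by simp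
  have ev_scale: "ev (map (apsnd (scaleC c)) l) = c *\<^sub>C ev l" if "fst ` set l \<subseteq> ?F" for c l
    using that by (induction l)
      (auto simp: scaleC_add_right bounded_ops_scaleC[OF \<psi>_bounded_ops[OF s]])
  have perp_ev: "cinner (ev l) z = 0" if "fst ` set l \<subseteq> ?F" "\<And>x h. (x, h) \<in> set l \<Longrightarrow> cinner (\<psi> x h) z = 0" for l z
    using that by (induction l) (auto simp: cinner_add_left)
  have "\<exists>T\<in>bounded_ops. (\<forall>v w. (v, w) \<in> Gr \<longrightarrow> T v = w) \<and>
      (\<forall>k. (\<forall>v w. (v, w) \<in> Gr \<longrightarrow> cinner v k = 0) \<longrightarrow> T k = 0) \<and>
      (\<forall>k. norm (T k) \<le> K * norm k) \<and>
      (\<forall>z k. (\<forall>v w. (v, w) \<in> Gr \<longrightarrow> cinner w z = 0) \<longrightarrow> cinner (T k) z = 0)"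
  proof (rule extend_linear_graph)
    fix v w v' w' assume "(v, w) \<in> Gr" "(v', w') \<in> Gr"
    then obtain l l' where "fst ` set l \<subseteq> ?F" "v = ev l" "w = ev (map (apsnd S) l)"
      "fst ` set l' \<subseteq> ?F" "v' = ev l'" "w' = ev (map (apsnd S) l')" unfolding Gr_def by blast
    then show "(v + v', w + w') \<in> Gr" using GrI[of "l @ l'"] by (simp add: image_Un)
  next
    fix v w c assume "(v, w) \<in> Gr"
    then obtain l where l: "fst ` set l \<subseteq> ?F" "v = ev l" "w = ev (map (apsnd S) l)" unfolding Gr_def by blast
    have "map (apsnd S) (map (apsnd (scaleC c)) l) = map (apsnd (scaleC c)) (map (apsnd S) l)"
      by (simp add: bounded_ops_scaleC[OF commutantD(1)[OF S]] apsnd_def map_prod_def split_def)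
    then show "(c *\<^sub>C v, c *\<^sub>C w) \<in> Gr"
      using GrI[of "map (apsnd (scaleC c)) l"] ev_scale[OF l(1)] ev_scale[of "map (apsnd S) l"] l
      by (simp add: image_image del: map_map)
  next
    show "(0, 0) \<in> Gr" using GrI[of "[]"] by simp
    show "norm w \<le> K * norm v" if "(v, w) \<in> Gr" for v w
      using that ev_map_bound[OF s S K] unfolding Gr_def by blast
  qed (rule K)
  then obtain T where T: "T \<in> bounded_ops" "\<And>v w. (v, w) \<in> Gr \<Longrightarrow> T v = w"
      "\<And>k. (\<And>v w. (v, w) \<in> Gr \<Longrightarrow> cinner v k = 0) \<Longrightarrow> T k = 0" "\<And>k. norm (T k) \<le> K * norm k"
      "\<And>z k. (\<And>v w. (v, w) \<in> Gr \<Longrightarrow> cinner w z = 0) \<Longrightarrow> cinner (T k) z = 0" by blast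
  have "T k = 0" if k: "\<forall>x\<in>?F. \<forall>h. cinner (\<psi> x h) k = 0" for k
  proof (rule T(3))
    fix v w assume "(v, w) \<in> Gr"
    then obtain l where "fst ` set l \<subseteq> ?F" "v = ev l" unfolding Gr_def by blast
    then show "cinner v k = 0" using k by (auto intro!: perp_ev)
  qed
  moreover have "cinner (T k) z = 0" if z: "\<forall>x\<in>?F. \<forall>h. cinner (\<psi> x (S h)) z = 0" for k z
  proof (rule T(5))
    fix v w assume "(v, w) \<in> Gr"
    then obtain l where "fst ` set l \<subseteq> ?F" "w = ev (map (apsnd S) l)" unfolding Gr_def by blast
    then show "cinner w z = 0" using z by (force intro!: perp_ev)
  qed
  ultimately show ?thesis using T(1,2,4) Gr1 unfolding induced_def by blast
qed

text \<open>The left action keeps the span of the vectors \<open>\<psi> x h\<close> invariant under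
  the image of \<open>A\<close>. As that image is closed under adjoints, the orthogonal complement
  is invariant too.\<close>

lemma induced_commutant:
  assumes s: "s \<in> P" and S: "S \<in> commutant X \<psi>" and T: "induced s S T"
  shows "T \<in> commutant X \<psi>"
proof (rule commutantI)
  show TB: "T \<in> bounded_ops" using T by (simp add: induced_def)
  fix a h
  have "T \<circ> \<pi> a = \<pi> a \<circ> T"
  proof (rule op_eqI[where W = "{\<psi> x h | x h. x \<in> carrier (fibre X s)}"])
    show "T \<circ> \<pi> a \<in> bounded_ops" "\<pi> a \<circ> T \<in> bounded_ops"
      by (simp_all add: comp_bounded_ops TB \<pi>_bounded_ops)
    fix w assume "w \<in> {\<psi> x h | x h. x \<in> carrier (fibre X s)}"
    then obtain x h where x: "x \<in> carrier (fibre X s)" "w = \<psi> x h" by blast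
    then show "(T \<circ> \<pi> a) w = (\<pi> a \<circ> T) w"
      using T lact_fibre[OF s x(1)] by (simp add: induced_def \<psi>_lact[OF s x(1), symmetric])
  next
    fix k assume k: "\<And>w. w \<in> {\<psi> x h | x h. x \<in> carrier (fibre X s)} \<Longrightarrow> cinner w k = 0"
    have "cinner (\<psi> x h) (\<pi> a k) = 0" if x: "x \<in> carrier (fibre X s)" for x h
    proof -
      have "cinner (\<psi> x h) (\<pi> a k) = cinner (\<pi> (star a) (\<psi> x h)) k"
        by (simp add: \<pi>_star cinner_adj_left[OF \<pi>_bounded_ops])
      then show ?thesis using k lact_fibre[OF s x] unfolding \<psi>_lact[OF s x, symmetric] by auto
    qed
    then have "T (\<pi> a k) = 0" using T unfolding induced_def by blast
    moreover have "T k = 0" using T k unfolding induced_def by blast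
    ultimately show "(T \<circ> \<pi> a) k = (\<pi> a \<circ> T) k" using bounded_ops_0[OF \<pi>_bounded_ops] by simp
  qed
  then show "T (\<pi> a h) = \<pi> a (T h)" by (metis comp_apply)
qed

lemma induced_add: "\<lbrakk>s \<in> P; induced s S T; induced s S' T'\<rbrakk> \<Longrightarrow> induced s (op_add S S') (op_add T T')"
  unfolding induced_def
  by (auto simp: op_add_bounded_ops) (auto simp: op_add_def bounded_ops_add[OF \<psi>_bounded_ops])

lemma induced_scale: "\<lbrakk>s \<in> P; induced s S T\<rbrakk> \<Longrightarrow> induced s (op_scale c S) (op_scale c T)"
  unfolding induced_def
  by (auto simp: op_scale_bounded_ops) (auto simp: op_scale_def bounded_ops_scaleC[OF \<psi>_bounded_ops])

lemma induced_comp: "\<lbrakk>induced s S T; induced s S' T'\<rbrakk> \<Longrightarrow> induced s (S \<circ> S') (T \<circ> T')"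
  unfolding induced_def by (auto simp: comp_bounded_ops bounded_ops_0)

lemma induced_range:
  assumes s: "s \<in> P" and S: "S \<in> commutant X \<psi>" and T: "induced s S T"
    and z: "\<And>x h. x \<in> carrier (fibre X s) \<Longrightarrow> cinner (\<psi> x (S h)) z = 0"
  shows "cinner (T k) z = 0"
proof -
  obtain K where "K \<ge> 0" "\<And>h. norm (S h) \<le> K * norm h" using bounded_ops_bound[OF commutantD(1)[OF S]] by blast
  then obtain T' where "induced s S T'"
    "\<And>z k. (\<forall>x\<in>carrier (fibre X s). \<forall>h. cinner (\<psi> x (S h)) z = 0) \<Longrightarrow> cinner (T' k) z = 0"
    using induced_exists[OF s S] by meson
  then show ?thesis using induced_unique[OF T] z by blast
qed

lemma induced_bound:
  assumes s: "s \<in> P" and S: "S \<in> commutant X \<psi>" and T: "induced s S T"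
    and "K \<ge> 0" "\<And>h. norm (S h) \<le> K * norm h"
  shows "norm (T k) \<le> K * norm k"
  using induced_exists[OF s S assms(4,5)] induced_unique[OF T] by blast

text \<open>The vanishing condition for \<open>adj T\<close> is that the range of \<open>T\<close>
  lies in the closed span of the vectors \<open>\<psi> x h\<close>.\<close>

lemma induced_adj:
  assumes s: "s \<in> P" and S: "S \<in> commutant X \<psi>" and T: "induced s S T"
  shows "induced s (adj S) (adj T)"
proof -
  let ?F = "carrier (fibre X s)"
  have TB: "T \<in> bounded_ops" using T by (simp add: induced_def)
  have SB: "S \<in> bounded_ops" using commutantD(1)[OF S] .
  have aS: "adj S \<in> commutant X \<psi>" using commutant_adj[OF S] .
  have ker: "adj T k = 0" if k: "\<forall>x\<in>?F. \<forall>h. cinner (\<psi> x h) k = 0" for k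
  proof (rule cinner_eqI)
    fix z
    have "cinner (T z) k = 0" by (rule induced_range[OF s S T]) (use k in auto)
    then show "cinner z (adj T k) = cinner z 0" by (simp add: cinner_adj[OF TB])
  qed
  have "adj T (\<psi> x h) = \<psi> x (adj S h)" if x: "x \<in> ?F" for x h
  proof -
    define d where "d = adj T (\<psi> x h) - \<psi> x (adj S h)"
    \<comment> \<open>Orthogonality of \<open>d\<close> to every \<open>\<psi> y k\<close> makes
      \<open>T d = 0\<close>. Hence \<open>d\<close> is orthogonal to both of its terms, so it is
      orthogonal to itself.\<close>
    have orth: "cinner (\<psi> y k) d = 0" if y: "y \<in> ?F" for y k
    proof -
      have "cinner (\<psi> y k) (adj T (\<psi> x h)) = cinner (\<psi> y (S k)) (\<psi> x h)"
        using T y by (simp add: cinner_adj[OF TB, symmetric] induced_def)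
      also have "\<dots> = cinner (\<psi> y k) (\<psi> x (adj S h))"
        by (simp only: \<psi>_ip[OF s y x] cinner_adj[OF SB] commutantD(2)[OF aS])
      finally show ?thesis by (simp add: d_def cinner_diff_right)
    qed
    have "cinner (\<psi> x (adj S h)) d = 0" using orth[OF x] .
    moreover have "cinner (adj T (\<psi> x h)) d = 0"
    proof -
      have "T d = 0" using T orth unfolding induced_def by blast
      then show ?thesis by (simp add: cinner_adj_left[OF TB])
    qed
    ultimately have "cinner d d = 0" by (simp add: d_def[of] cinner_diff_left)
    then show ?thesis unfolding cinner_self_eq_0_iff d_def by simp
  qed
  then show ?thesis using ker adj_bounded_ops[OF TB] unfolding induced_def by blast
qed

text \<open>The endomorphism is assembled from the uniquely determined \<open>T\<close> at each
  \<open>S\<close>, and uniqueness turns every algebraic rule for \<open>induced\<close> into a rule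
  for it. Conversely any candidate takes induced values.\<close>

lemma alpha_induced:
  assumes s: "s \<in> P"
  shows "S \<in> commutant X \<psi> \<Longrightarrow> induced s S (alpha X \<psi> s S)"
proof -
  define \<alpha> where "\<alpha> = (\<lambda>S\<in>commutant X \<psi>. THE T. induced s S T)"
  have ind: "induced s S (\<alpha> S)" if S: "S \<in> commutant X \<psi>" for S
  proof -
    obtain K where "K \<ge> 0" "\<And>h. norm (S h) \<le> K * norm h" using bounded_ops_bound[OF commutantD(1)[OF S]] by blast
    then obtain T where T: "induced s S T" using induced_exists[OF s S] by meson
    have "induced s S (THE T. induced s S T)" by (rule theI[of "induced s S", OF T]) (rule induced_unique[OF _ T])
    then show ?thesis using S by (simp add: \<alpha>_def)
  qed
  have eq: "\<alpha> S = T" if "S \<in> commutant X \<psi>" "induced s S T" for S T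
    using induced_unique ind that by blast
  let ?spec = "\<lambda>\<alpha>. \<alpha> \<in> extensional (commutant X \<psi>) \<and> commutant_endo X \<psi> \<alpha> \<and>
     (\<forall>S\<in>commutant X \<psi>. \<forall>x\<in>carrier (fibre X s). \<alpha> S \<circ> \<psi> x = \<psi> x \<circ> S) \<and>
     (\<forall>k. (\<forall>x\<in>carrier (fibre X s). \<forall>h. cinner (\<psi> x h) k = 0) \<longrightarrow> \<alpha> id k = 0)"
  have "alpha X \<psi> s = \<alpha>"
    unfolding alpha_def
  proof (rule the_equality)
    have "\<alpha> ` commutant X \<psi> \<subseteq> commutant X \<psi>" using ind induced_commutant[OF s] by blast
    moreover have "star_rep (commutant X \<psi>) op_add op_scale (\<circ>) adj \<alpha>"
      unfolding star_rep_def
    proof (intro conjI ballI allI)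
      fix S assume S: "S \<in> commutant X \<psi>"
      show "\<alpha> S \<in> bounded_ops" using ind[OF S] by (simp add: induced_def)
      show "\<alpha> (op_scale c S) = op_scale c (\<alpha> S)" for c
        by (rule eq[OF commutant_scale[OF S] induced_scale[OF s ind[OF S]]])
      show "\<alpha> (adj S) = adj (\<alpha> S)" by (rule eq[OF commutant_adj[OF S] induced_adj[OF s S ind[OF S]]])
      fix S' assume S': "S' \<in> commutant X \<psi>"
      show "\<alpha> (op_add S S') = op_add (\<alpha> S) (\<alpha> S')"
        by (rule eq[OF commutant_add[OF S S'] induced_add[OF s ind[OF S] ind[OF S']]])
      show "\<alpha> (S \<circ> S') = \<alpha> S \<circ> \<alpha> S'"
        by (rule eq[OF commutant_comp[OF S S'] induced_comp[OF ind[OF S] ind[OF S']]])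
    qed
    moreover have "\<alpha> S \<circ> \<psi> x = \<psi> x \<circ> S" if "S \<in> commutant X \<psi>" "x \<in> carrier (fibre X s)" for S x
      using ind[OF that(1)] that(2) by (simp add: induced_def fun_eq_iff)
    moreover have "\<alpha> id k = 0" if "\<forall>x\<in>carrier (fibre X s). \<forall>h. cinner (\<psi> x h) k = 0" for k
      using ind[OF commutant_id] that unfolding induced_def by blast
    ultimately show "?spec \<alpha>" unfolding commutant_endo_def \<alpha>_def by blast
  next
    fix \<beta> assume \<beta>: "?spec \<beta>"
    have \<beta>_induced: "induced s S (\<beta> S)" if S: "S \<in> commutant X \<psi>" for S
      unfolding induced_def
    proof (intro conjI ballI allI impI)
      show B: "\<beta> S \<in> bounded_ops" using \<beta> S by (auto simp: commutant_endo_def star_rep_def)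
      show "\<beta> S (\<psi> x h) = \<psi> x (S h)" if "x \<in> carrier (fibre X s)" for x h
        using \<beta> S that by (metis comp_apply)
      fix k assume "\<forall>x\<in>carrier (fibre X s). \<forall>h. cinner (\<psi> x h) k = 0"
      then have "\<beta> id k = 0" using \<beta> by blast
      \<comment> \<open>Multiplicativity spreads the vanishing condition from \<open>id\<close> to
        every \<open>S\<close>.\<close>
      moreover have "\<beta> (S \<circ> id) = \<beta> S \<circ> \<beta> id"
        using \<beta> S commutant_id unfolding commutant_endo_def star_rep_def by blast
      then have "\<beta> S k = \<beta> S (\<beta> id k)" by (metis comp_apply comp_id)
      ultimately show "\<beta> S k = 0" using bounded_ops_0[OF B] by simp
    qed
    have "\<beta> S = \<alpha> S" if "S \<in> commutant X \<psi>" for S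
      using eq[OF that \<beta>_induced[OF that]] by simp
    moreover have "\<alpha> \<in> extensional (commutant X \<psi>)" by (simp add: \<alpha>_def)
    moreover have "\<beta> \<in> extensional (commutant X \<psi>)" using \<beta> by blast
    ultimately show "\<beta> = \<alpha>" by (intro extensionalityI[of \<beta> "commutant X \<psi>" \<alpha>])
  qed
  then show "S \<in> commutant X \<psi> \<Longrightarrow> induced s S (alpha X \<psi> s S)" using ind by simp
qed

lemma alpha_eqI: "\<lbrakk>s \<in> P; S \<in> commutant X \<psi>; induced s S T\<rbrakk> \<Longrightarrow> alpha X \<psi> s S = T"
  using alpha_induced induced_unique by blast

section \<open>Range projections and the relation between degrees\<close>

definition range_proj :: "'g \<Rightarrow> 'h \<Rightarrow> 'h" where
  "range_proj s = alpha X \<psi> s id"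

lemma range_proj_induced: "s \<in> P \<Longrightarrow> induced s id (range_proj s)"
  unfolding range_proj_def by (rule alpha_induced[OF _ commutant_id])

lemma range_proj_eqI: "\<lbrakk>s \<in> P; induced s id T\<rbrakk> \<Longrightarrow> range_proj s = T"
  using range_proj_induced induced_unique by blast

lemma range_proj_commutant: "s \<in> P \<Longrightarrow> range_proj s \<in> commutant X \<psi>"
  using range_proj_induced induced_commutant[OF _ commutant_id] by blast

lemma range_proj_selfadjoint:
  assumes "s \<in> P" shows "cinner (range_proj s x) y = cinner x (range_proj s y)"
proof -
  have "adj (range_proj s) = range_proj s"
    using range_proj_eqI[OF assms induced_adj[OF assms commutant_id range_proj_induced[OF assms], unfolded adj_id]]
    by simp
  then show ?thesis
    using cinner_adj[OF commutantD(1)[OF range_proj_commutant[OF assms]], of x y] by simp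
qed

text \<open>Since \<open>U\<close> preserves inner products, an approximation in the module norm of
  \<open>M\<close> becomes one of vectors by \<open>\<psi>_norm_le\<close>. It is used with
  \<open>U\<close> the identity of a fibre, for essentiality, and with \<open>U\<close> the
  isomorphism from a tensor product onto a fibre.\<close>

lemma \<psi>_hclosure:
  fixes M :: "('a, 'w) hbimod"
  assumes M: "right_hilbert_module M" and s: "s \<in> P" and SM: "S \<subseteq> carrier M"
    and U: "\<And>x. x \<in> carrier M \<Longrightarrow> U x \<in> carrier (fibre X s)"
    and add: "\<And>x y. \<lbrakk>x \<in> carrier M; y \<in> carrier M\<rbrakk> \<Longrightarrow> U (hadd M x y) = hadd (fibre X s) (U x) (U y)"
    and scale: "\<And>c x. x \<in> carrier M \<Longrightarrow> U (hscale M c x) = hscale (fibre X s) c (U x)"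
    and ip: "\<And>x. x \<in> carrier M \<Longrightarrow> ip (fibre X s) (U x) (U x) = ip M x x"
    and W: "\<And>x h. x \<in> S \<Longrightarrow> \<psi> (U x) h \<in> cspan W"
    and z: "z \<in> hclosure M (hspan M S)"
  shows "\<psi> (U z) h \<in> closure (cspan W)"
proof -
  interpret right_hilbert_module M by (rule M)
  have add': "\<psi> (U (hadd M x (hscale M c y))) h = \<psi> (U x) h + c *\<^sub>C \<psi> (U y) h"
    if "x \<in> carrier M" "y \<in> carrier M" for x y c
    using that by (simp add: add scale scale_closed \<psi>_add[OF s] \<psi>_scale[OF s] U hilbert_bimodule.axioms
        right_hilbert_module.scale_closed[OF hilbert_bimodule.axioms(1)[OF fibre_bimodule[OF s]]])
  have span: "y \<in> carrier M \<and> \<psi> (U y) h \<in> cspan W" if "y \<in> hspan M S" for y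
    using that
  proof induction
    case zero
    have "\<psi> (U (hzero M)) h = 0"
      using scale[OF zero_closed, of 0] scale_zero[OF zero_closed] \<psi>_scale[OF s U[OF zero_closed], of 0 h] by simp
    then show ?case using zero_closed by (simp add: complex_vs.span_zero)
  next
    case (step x y c)
    have x: "x \<in> carrier M" using step SM by blast
    have "\<psi> (U (hadd M y (hscale M c x))) h \<in> cspan W"
      using step x W by (simp add: add' complex_vs.span_add complex_vs.span_scale)
    then show ?case using step x by (simp add: add_closed scale_closed add_comm)
  qed
  have zM: "z \<in> carrier M" using z by (simp add: hclosure_def)
  show ?thesis unfolding closure_approachable
  proof (intro allI impI)
    fix e :: real assume e: "e > 0"
    then have "e / (norm h + 1) > 0" by (simp add: add_nonneg_pos)
    then obtain y where y: "y \<in> hspan M S" "hdist M z y < e / (norm h + 1)"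
      using z unfolding hclosure_def by blast
    have yM: "y \<in> carrier M" and yW: "\<psi> (U y) h \<in> cspan W" using span[OF y(1)] by auto
    let ?d = "hadd M z (hscale M (-1) y)"
    have dM: "?d \<in> carrier M" using zM yM by (simp add: add_closed scale_closed)
    have "\<psi> (U z) h - \<psi> (U y) h = \<psi> (U ?d) h" using add'[OF zM yM, of "-1"] by simp
    then have "dist (\<psi> (U z) h) (\<psi> (U y) h) \<le> hdist M z y * norm h"
      using \<psi>_norm_le[OF s U[OF dM], of h] by (simp add: dist_norm hdist_def Let_def ip[OF dM])
    also have "\<dots> \<le> e / (norm h + 1) * norm h" using y(2) by (intro mult_right_mono) auto
    also have "\<dots> < e" using e by (simp add: divide_less_eq add_nonneg_pos)
    finally show "\<exists>w\<in>cspan W. dist w (\<psi> (U z) h) < e" using yW by (auto simp: dist_commute)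
  qed
qed

text \<open>Nondegeneracy concerns the image of all of \<open>X\<close>. Essential fibres place
  every \<open>\<psi> x h\<close> in the closed span of the vectors \<open>\<pi> a h\<close>, so a
  vector orthogonal to the latter is zero.\<close>

lemma range_proj_one:
  assumes ess: "\<And>s. s \<in> P \<Longrightarrow> essential (fibre X s)" and nd: "nondegenerate (\<psi> ` carrier X)"
  shows "range_proj \<one> = id"
proof (rule range_proj_eqI[OF one_closed], unfold induced_def, intro conjI ballI allI impI)
  fix k assume k: "\<forall>x\<in>carrier (fibre X \<one>). \<forall>h. cinner (\<psi> x h) k = 0"
  let ?W = "{\<pi> a h | a h. True}"
  have *: "\<psi> x h \<in> closure (cspan ?W)" if x: "x \<in> carrier X" for x h
  proof -
    define s where "s = deg X x"
    have s: "s \<in> P" and xs: "x \<in> carrier (fibre X s)"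
      using deg_closed[OF x] fibre_carrier x by (auto simp: s_def)
    interpret hilbert_bimodule "fibre X s" by (rule fibre_bimodule[OF s])
    show ?thesis
    proof (rule \<psi>_hclosure[OF right_hilbert_module_axioms s, where U = "\<lambda>x. x"])
      show "x \<in> hclosure (fibre X s) (hspan (fibre X s) {lact (fibre X s) a y | a y. y \<in> carrier (fibre X s)})"
        using ess[OF s] xs by (simp add: essential_def)
      fix z h assume "z \<in> {lact (fibre X s) a y | a y. y \<in> carrier (fibre X s)}"
      then obtain a y where "z = lact (fibre X s) a y" "y \<in> carrier (fibre X s)" by blast
      then have "\<psi> z h = \<pi> a (\<psi> y h)" by (simp add: \<psi>_lact[OF s])
      then show "\<psi> z h \<in> cspan ?W" by (intro complex_vs.span_base) blast
    qed (auto intro: lact_closed)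
  qed
  have "cinner w k = 0" if "w \<in> ?W" for w using that k emb_fibre by blast
  then have "cinner (\<psi> x h) k = 0" if "x \<in> carrier X" for x h
    using orthogonal_span_closure[OF _ *[OF that]] by blast
  then have "cinner v k = 0" if "v \<in> closure (cspan {T h | T h. T \<in> \<psi> ` carrier X})" for v
    using orthogonal_span_closure[OF _ that] by blast
  then have "cinner k k = 0" using nd unfolding nondegenerate_def by blast
  then show "id k = 0" by simp
qed auto

text \<open>The fibre at the identity is \<open>A\<close>, so membership in the commutant is the
  intertwining condition. The vanishing condition concerns only the zero vector because the
  projection there is \<open>id\<close>.\<close>

lemma alpha_one:
  assumes one: "range_proj \<one> = id" and S: "S \<in> commutant X \<psi>"
  shows "alpha X \<psi> \<one> S = S"
proof (rule alpha_eqI[OF one_closed S], unfold induced_def, intro conjI ballI allI impI)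
  show "S \<in> bounded_ops" using commutantD(1)[OF S] .
  show "S (\<psi> x h) = \<psi> x (S h)" if "x \<in> carrier (fibre X \<one>)" for x h
    using fibre_one_emb[OF that] commutantD(2)[OF S] by auto
  fix k assume "\<forall>x\<in>carrier (fibre X \<one>). \<forall>h. cinner (\<psi> x h) k = 0"
  then have "range_proj \<one> k = 0"
    using range_proj_induced[OF one_closed] unfolding induced_def by blast
  then show "S k = 0" using one bounded_ops_0[OF commutantD(1)[OF S]] by simp
qed

text \<open>Both sides project onto the closed span of the vectors
  \<open>\<psi> x (\<psi> y h)\<close>. On the right this uses that products are dense in the fibre
  at \<open>s \<otimes> t\<close>, which is the content of the tensor product isomorphism.\<close>

lemma alpha_range_proj_nontrivial:
  assumes s: "s \<in> P" and t: "t \<in> P" and ne: "s \<noteq> \<one>" "t \<noteq> \<one>"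
  shows "alpha X \<psi> s (range_proj t) = range_proj (s \<otimes> t)"
proof -
  let ?p = "range_proj t" and ?T = "alpha X \<psi> s (range_proj t)"
  have st: "s \<otimes> t \<in> P" using s t by simp
  have pC: "?p \<in> commutant X \<psi>" by (rule range_proj_commutant[OF t])
  have Ti: "induced s ?p ?T" by (rule alpha_induced[OF s pC])
  have pi: "induced t id ?p" by (rule range_proj_induced[OF t])
  have TB: "?T \<in> bounded_ops" using Ti by (simp add: induced_def)
  let ?W = "{\<psi> x (\<psi> y h) | x y h. x \<in> carrier (fibre X s) \<and> y \<in> carrier (fibre X t)}"
  have ptimes_st: "ptimes X x y \<in> carrier (fibre X (s \<otimes> t))" "\<psi> (ptimes X x y) h = \<psi> x (\<psi> y h)"
    if "x \<in> carrier (fibre X s)" "y \<in> carrier (fibre X t)" for x y h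
    using fibre_carrierD[OF s that(1)] fibre_carrierD[OF t that(2)]
    by (simp_all add: fibre_carrier[OF st] ptimes_closed deg_ptimes \<psi>_ptimes)
  have dense: "\<psi> z h \<in> closure (cspan ?W)" if z: "z \<in> carrier (fibre X (s \<otimes> t))" for z h
  proof -
    obtain M :: "('a, 'x) hbimod" and j U where
      M: "interior_tensor_product (fibre X s) (fibre X t) M j"
      and U: "bimod_iso M (fibre X (s \<otimes> t)) U"
      and jU: "\<And>x y. \<lbrakk>x \<in> carrier (fibre X s); y \<in> carrier (fibre X t)\<rbrakk> \<Longrightarrow> U (j x y) = ptimes X x y"
      using fibre_tensor[OF s t ne] by blast
    let ?S = "{j x y | x y. x \<in> carrier (fibre X s) \<and> y \<in> carrier (fibre X t)}"
    have "U ` carrier M = carrier (fibre X (s \<otimes> t))"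
      using U by (simp add: bimod_iso_def bij_betw_def)
    with z obtain w where w: "w \<in> carrier M" "z = U w" by blast
    have "hilbert_bimodule M" using M by (simp add: interior_tensor_product_def)
    then have rM: "right_hilbert_module M" by (rule hilbert_bimodule.axioms(1))
    have "\<psi> (U w) h \<in> closure (cspan ?W)"
    proof (rule \<psi>_hclosure[OF rM st, where S = ?S and U = U and W = ?W])
      show "?S \<subseteq> carrier M" using M by (auto simp: interior_tensor_product_def)
      show "w \<in> hclosure M (hspan M ?S)" using M w(1) by (simp add: interior_tensor_product_def)
      fix v h assume "v \<in> ?S"
      then obtain x y where "v = j x y" "x \<in> carrier (fibre X s)" "y \<in> carrier (fibre X t)" by blast
      then show "\<psi> (U v) h \<in> cspan ?W" using jU ptimes_st by (intro complex_vs.span_base) auto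
    next
      show "U x \<in> carrier (fibre X (s \<otimes> t))" if "x \<in> carrier M" for x
        using that \<open>U ` carrier M = _\<close> by blast
    qed (use U in \<open>auto simp: bimod_iso_def\<close>)
    then show ?thesis using w(2) by simp
  qed
  have pW: "?p (\<psi> y h) = \<psi> y h" if "y \<in> carrier (fibre X t)" for y h
    using pi that by (simp add: induced_def)
  have "induced (s \<otimes> t) id ?T" unfolding induced_def
  proof (intro conjI ballI allI impI)
    fix z h assume z: "z \<in> carrier (fibre X (s \<otimes> t))"
    have "closure (cspan ?W) \<subseteq> {v. ?T v = id v}"
    proof (rule closure_minimal)
      show "cspan ?W \<subseteq> {v. ?T v = id v}"
      proof (rule complex_vs.span_minimal)
        show "?W \<subseteq> {v. ?T v = id v}" using Ti pW by (auto simp: induced_def)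
        show "complex_vs.subspace {v. ?T v = id v}"
          by (rule complex_vs.subspaceI)
            (auto simp: bounded_ops_add[OF TB] bounded_ops_scaleC[OF TB] bounded_ops_0[OF TB])
      qed
      show "closed {v. ?T v = id v}"
        using bounded_linear.continuous_on[OF bounded_ops_bounded_linear[OF TB] continuous_on_id]
        by (intro closed_Collect_eq) (auto simp: continuous_on_id)
    qed
    then show "?T (\<psi> z h) = \<psi> z (id h)" using dense[OF z] by auto
  next
    fix k assume k: "\<forall>z\<in>carrier (fibre X (s \<otimes> t)). \<forall>h. cinner (\<psi> z h) k = 0"
    \<comment> \<open>Orthogonality of \<open>k\<close> to the range of \<open>?T\<close> gives
      \<open>?T k = 0\<close> once \<open>?T\<close> is known to be self-adjoint.\<close>
    have "cinner (?T m) k = 0" for m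
    proof (rule induced_range[OF s pC Ti])
      fix x h assume x: "x \<in> carrier (fibre X s)"
      \<comment> \<open>Passing \<open>\<psi> x\<close> to the other side reduces the claim to the
        range of \<open>?p\<close>, tested against the vector
        \<open>adj (\<psi> x) k\<close>.\<close>
      have "cinner (\<psi> x (?p h)) k = cinner (?p h) (adj (\<psi> x) k)"
        by (rule cinner_adj[OF \<psi>_bounded_ops[OF s x]])
      also have "\<dots> = 0"
      proof (rule induced_range[OF t commutant_id pi])
        fix y h' assume y: "y \<in> carrier (fibre X t)"
        have "cinner (\<psi> y (id h')) (adj (\<psi> x) k) = cinner (\<psi> (ptimes X x y) h') k"
          using ptimes_st(2)[OF x y] by (simp add: cinner_adj[OF \<psi>_bounded_ops[OF s x], symmetric])
        then show "cinner (\<psi> y (id h')) (adj (\<psi> x) k) = 0" using k ptimes_st(1)[OF x y] by simp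
      qed
      finally show "cinner (\<psi> x (?p h)) k = 0" .
    qed
    moreover have "adj ?T = ?T"
    proof -
      have "adj ?p = ?p"
        by (rule adj_eqI) (use commutantD(1)[OF pC] range_proj_selfadjoint[OF t] in auto)
      then have "induced s ?p (adj ?T)" using induced_adj[OF s pC Ti] by simp
      then show ?thesis using alpha_eqI[OF s pC] by metis
    qed
    ultimately have "cinner m (?T k) = 0" for m using cinner_adj[OF TB, of m k] by simp
    then show "?T k = 0" by (intro cinner_eqI) simp
  qed (rule TB)
  then show ?thesis using range_proj_eqI[OF st] by simp
qed

text \<open>The trivial degrees, outside the scope of \<open>fibre_tensor\<close>, follow from the
  projection at the identity being \<open>id\<close>.\<close>

lemma alpha_range_proj:
  assumes s: "s \<in> P" and t: "t \<in> P" and one: "range_proj \<one> = id"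
  shows "alpha X \<psi> s (range_proj t) = range_proj (s \<otimes> t)"
proof (cases "s = \<one> \<or> t = \<one>")
  case True
  then show ?thesis
    using one alpha_one[OF one range_proj_commutant[OF t]] s t P_carrier range_proj_def[of s] by auto
next
  case False
  then show ?thesis using alpha_range_proj_nontrivial[OF s t] by simp
qed

end

section \<open>Covariant representations\<close>

lemma (in quasi_lattice_ordered) covariant_rep_nica:
  fixes X :: "('a, 'c::cstar_algebra, 'x) prodsys" and \<psi> :: "'x \<Rightarrow> 'h::complex_hilbert \<Rightarrow> 'h"
  assumes cov: "covariant_rep G P X L \<psi>"
  shows "nica_covariant G P X \<psi>" "s \<in> P \<Longrightarrow> L (one_P G P s) = alpha X \<psi> s id"
proof -
  have rep: "B_P_rep G P L" and nd: "nondegenerate (L ` B_P G P)"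
    and tau: "\<And>s f. \<lbrakk>s \<in> P; f \<in> B_P G P\<rbrakk> \<Longrightarrow> L (tau G P s f) = alpha X \<psi> s (L f)"
    using cov by (auto simp: covariant_rep_def)
  have mult: "L (\<lambda>r. f r * g r) = L f \<circ> L g" if "f \<in> B_P G P" "g \<in> B_P G P" for f g
    using rep that by (simp add: B_P_rep_def star_rep_def)
  let ?e = "one_P G P \<one>"
  have e: "?e \<in> B_P G P" using one_P_B_P[OF one_closed] .
  have one: "L ?e = id"
  proof (rule op_eqI[where W = "{T h | T h. T \<in> L ` B_P G P}"])
    show "L ?e \<in> bounded_ops" using rep e by (simp add: B_P_rep_def star_rep_def)
    fix w assume "w \<in> {T h | T h. T \<in> L ` B_P G P}"
    then obtain f h where f: "f \<in> B_P G P" "w = L f h" by blast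
    then show "L ?e w = id w" using mult[OF e f(1)] one_P_one[OF f(1)] by (metis comp_apply id_apply)
  next
    fix k assume k: "\<And>w. w \<in> {T h | T h. T \<in> L ` B_P G P} \<Longrightarrow> cinner w k = 0"
    have "k \<in> closure (cspan {T h | T h. T \<in> L ` B_P G P})"
      unfolding nd[unfolded nondegenerate_def] by (rule UNIV_I)
    then have "cinner k k = 0" by (rule orthogonal_span_closure[rotated]) (rule k)
    then have "k = 0" by simp
    moreover have "L ?e \<in> bounded_ops" using rep e by (simp add: B_P_rep_def star_rep_def)
    ultimately show "L ?e k = id k" by (simp add: bounded_ops_0)
  qed simp
  have L1: "L (one_P G P s) = alpha X \<psi> s id" if s: "s \<in> P" for s
    using tau[OF s e] tau_one_P[OF s one_closed] one s P_carrier by simp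
  then show "s \<in> P \<Longrightarrow> L (one_P G P s) = alpha X \<psi> s id" .
  show "nica_covariant G P X \<psi>" unfolding nica_covariant_def
  proof (intro ballI)
    fix s t assume s: "s \<in> P" and t: "t \<in> P"
    have eq: "alpha X \<psi> s id \<circ> alpha X \<psi> t id = L (\<lambda>r. one_P G P s r * one_P G P t r)"
      using L1 s t mult[OF one_P_B_P[OF s] one_P_B_P[OF t]] by simp
    show "alpha X \<psi> s id \<circ> alpha X \<psi> t id =
        (case join_P G P s t of Some u \<Rightarrow> alpha X \<psi> u id | None \<Rightarrow> (\<lambda>_. 0))"
    proof (cases "join_P G P s t")
      case None
      \<comment> \<open>The zero function is written as a multiple of an element of
        \<open>B_P\<close>, so that the scaling rule yields \<open>L 0 = 0\<close>.\<close>
      have "L (\<lambda>r. 0 * ?e r) = op_scale 0 (L ?e)"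
        using rep e unfolding B_P_rep_def star_rep_def by blast
      then have "L (\<lambda>r. 0) = (\<lambda>_. 0)" by (simp add: op_scale_def)
      then show ?thesis using None eq one_P_mult[OF s t] by simp
    next
      case (Some u)
      then have "u \<in> P" using join_P_cosets[OF s t] by simp
      moreover have "(\<lambda>r. one_P G P s r * one_P G P t r) = one_P G P u"
        using Some one_P_mult[OF s t] by (simp add: fun_eq_iff)
      ultimately show ?thesis using Some eq L1 by simp
    qed
  qed
qed

locale nica_toeplitz_representation = toeplitz_representation G P X \<psi>
  for G :: "('g, 'm) monoid_scheme" (structure) and P
    and X :: "('g, 'a::cstar_algebra, 'x) prodsys" and \<psi> :: "'x \<Rightarrow> 'h::complex_hilbert \<Rightarrow> 'h" +
  assumes essential_fibres: "\<And>s. s \<in> P \<Longrightarrow> essential (fibre X s)"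
    and nondegenerate_rep: "nondegenerate (\<psi> ` carrier X)"
    and nica: "nica_covariant G P X \<psi>"
begin

sublocale nica_projections G P range_proj
proof
  show "range_proj \<one> = id" using range_proj_one[OF essential_fibres nondegenerate_rep] .
  fix t assume t: "t \<in> P"
  show "range_proj t \<in> bounded_ops" using commutantD(1)[OF range_proj_commutant[OF t]] .
  show "cinner (range_proj t x) y = cinner x (range_proj t y)" for x y
    by (rule range_proj_selfadjoint[OF t])
  fix s x assume s: "s \<in> P"
  have "range_proj s \<circ> range_proj t =
      (case join_P G P s t of Some u \<Rightarrow> range_proj u | None \<Rightarrow> (\<lambda>_. 0))"
    using nica s t unfolding nica_covariant_def range_proj_def by blast
  then show "range_proj s (range_proj t x) =
      (case join_P G P s t of Some u \<Rightarrow> range_proj u x | None \<Rightarrow> 0)"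
    by (auto simp: fun_eq_iff split: option.splits)
qed

section \<open>Covariance of the extended representation\<close>

lemma step_op_commutant: "snd ` set l \<subseteq> P \<Longrightarrow> step_op l \<in> commutant X \<psi>"
proof (induction l)
  case Nil
  show ?case by (rule commutantI) (simp_all add: step_op_bounded_ops bounded_ops_0[OF \<pi>_bounded_ops])
next
  case (Cons a l)
  obtain c t where a: "a = (c, t)" by force
  have "step_op (a # l) = op_add (op_scale c (range_proj t)) (step_op l)"
    by (simp add: a op_add_def op_scale_def fun_eq_iff)
  then show ?case using Cons a range_proj_commutant[OF _] commutant_add commutant_scale by simp
qed

lemma ext_op_commutant:
  assumes f: "f \<in> B_P G P"
  shows "ext_op f \<in> commutant X \<psi>"
proof (rule commutantI)
  note ap = B_P_approximable[OF f]
  obtain K where K: "\<And>r. cmod (f r) \<le> K" using B_P_bounded[OF f] by blast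
  show "ext_op f \<in> bounded_ops" by (rule ext_op_bounded_ops[OF ap K])
  fix a h
  obtain M where M: "M \<ge> 0" "\<And>h. norm (\<pi> a h) \<le> M * norm h" using bounded_ops_bound[OF \<pi>_bounded_ops] by blast
  show "ext_op f (\<pi> a h) = \<pi> a (ext_op f h)"
  proof (rule eq_if_norm_diff_le)
    fix \<epsilon> :: real assume e: "\<epsilon> > 0"
    obtain l where l: "snd ` set l \<subseteq> P" "\<And>r. r \<in> P \<Longrightarrow> cmod (f r - step_fun l r) \<le> \<epsilon>"
      by (rule approximableD[OF ap e]) blast
    have "ext_op f (\<pi> a h) - \<pi> a (ext_op f h) =
        (ext_op f (\<pi> a h) - step_op l (\<pi> a h)) - \<pi> a (ext_op f h - step_op l h)"
      by (simp add: bounded_ops_diff[OF \<pi>_bounded_ops] commutantD(2)[OF step_op_commutant[OF l(1)]])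
    also have "norm \<dots> \<le> \<epsilon> * norm (\<pi> a h) + M * (\<epsilon> * norm h)"
    proof (rule order_trans[OF norm_triangle_ineq4 add_mono])
      show "norm (ext_op f (\<pi> a h) - step_op l (\<pi> a h)) \<le> \<epsilon> * norm (\<pi> a h)"
        by (rule ext_op_approx[OF ap l])
      show "norm (\<pi> a (ext_op f h - step_op l h)) \<le> M * (\<epsilon> * norm h)"
        by (rule order_trans[OF M(2) mult_left_mono[OF ext_op_approx[OF ap l] M(1)]])
    qed
    finally show "norm (ext_op f (\<pi> a h) - \<pi> a (ext_op f h)) \<le> \<epsilon> * (norm (\<pi> a h) + M * norm h)"
      by (simp add: algebra_simps)
  qed
qed

lemma tau_step_fun:
  assumes "s \<in> P" "snd ` set l \<subseteq> P"
  shows "tau G P s (step_fun l) r = step_fun (map (\<lambda>(c, t). (c, s \<otimes> t)) l) r"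
  using assms(2)
proof (induction l)
  case (Cons a l)
  obtain c t where a: "a = (c, t)" by force
  have "t \<in> P" using Cons.prems a by simp
  then have "one_P G P (s \<otimes> t) r = tau G P s (one_P G P t) r" using tau_one_P[OF assms(1)] by simp
  then show ?case using Cons by (simp add: a tau_def split: if_splits)
qed (simp add: tau_def)

text \<open>Linear extension of \<open>alpha_range_proj\<close>: translating the entries of the list
  by \<open>s\<close> implements the endomorphism, just as it implements \<open>tau\<close> on step
  functions.\<close>

lemma induced_step_op:
  assumes s: "s \<in> P" and l: "snd ` set l \<subseteq> P"
  shows "induced s (step_op l) (step_op (map (\<lambda>(c, t). (c, s \<otimes> t)) l))"
  using l
proof (induction l)
  case Nil
  have "step_op [] = (\<lambda>_. 0)" by (simp add: fun_eq_iff)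
  then show ?case using bounded_ops_0[OF \<psi>_bounded_ops[OF s]] by (simp add: induced_def)
next
  case (Cons a l)
  obtain c t where a: "a = (c, t)" by force
  have t: "t \<in> P" using Cons.prems a by simp
  have "induced s (range_proj t) (range_proj (s \<otimes> t))"
    using alpha_induced[OF s range_proj_commutant[OF t]] alpha_range_proj[OF s t p_one] by simp
  moreover have "step_op ((c, t) # m) = op_add (op_scale c (range_proj t)) (step_op m)" for t m
    by (simp add: op_add_def op_scale_def fun_eq_iff)
  ultimately show ?case using Cons a by (simp add: induced_add[OF s] induced_scale[OF s])
qed

text \<open>Both sides agree on step functions, and both maps preserve error bounds:
  \<open>tau\<close> only translates values, and \<open>induced_bound\<close> makes the endomorphism
  contractive.\<close>

lemma ext_op_tau:
  assumes s: "s \<in> P" and f: "f \<in> B_P G P"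
  shows "ext_op (tau G P s f) = alpha X \<psi> s (ext_op f)"
proof
  fix h
  note ap = B_P_approximable[OF f] and apt = B_P_approximable[OF tau_B_P[OF s f]]
  have C: "ext_op f \<in> commutant X \<psi>" by (rule ext_op_commutant[OF f])
  show "ext_op (tau G P s f) h = alpha X \<psi> s (ext_op f) h"
  proof (rule eq_if_norm_diff_le)
    fix \<epsilon> :: real assume e: "\<epsilon> > 0"
    obtain l where l: "snd ` set l \<subseteq> P" "\<And>r. r \<in> P \<Longrightarrow> cmod (f r - step_fun l r) \<le> \<epsilon>"
      by (rule approximableD[OF ap e]) blast
    let ?l = "map (\<lambda>(c, t). (c, s \<otimes> t)) l"
    have 1: "norm (ext_op (tau G P s f) h - step_op ?l h) \<le> \<epsilon> * norm h"
    proof (rule ext_op_approx[OF apt])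
      show "snd ` set ?l \<subseteq> P" using l(1) s by auto
      fix r assume "r \<in> P"
      have "tau G P s f r - tau G P s (step_fun l) r =
          (if r \<in> s <# P then f (inv s \<otimes> r) - step_fun l (inv s \<otimes> r) else 0)"
        by (simp add: tau_def)
      then show "cmod (tau G P s f r - step_fun ?l r) \<le> \<epsilon>"
        using l(2)[of "inv s \<otimes> r"] e mem_coset_iff[OF s, of r] by (simp add: tau_step_fun[OF s l(1)])
    qed
    \<comment> \<open>The error of the step operator as one element of the commutant; its induced
      operator is the difference of the two induced operators, so the bound
      \<open>\<epsilon>\<close> carries over.\<close>
    let ?D = "op_add (ext_op f) (op_scale (-1) (step_op l))"
    have DC: "?D \<in> commutant X \<psi>" by (intro commutant_add commutant_scale C step_op_commutant l)
    have DI: "induced s ?D (op_add (alpha X \<psi> s (ext_op f)) (op_scale (-1) (step_op ?l)))"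
      by (intro induced_add induced_scale induced_step_op alpha_induced s C l)
    have "norm (?D k) \<le> \<epsilon> * norm k" for k
      using ext_op_approx[OF ap l, of k] by (simp add: op_add_def op_scale_def)
    then have "norm (op_add (alpha X \<psi> s (ext_op f)) (op_scale (-1) (step_op ?l)) h) \<le> \<epsilon> * norm h"
      by (rule induced_bound[OF s DC DI less_imp_le[OF e]])
    then have "norm (alpha X \<psi> s (ext_op f) h - step_op ?l h) \<le> \<epsilon> * norm h"
      by (simp add: op_add_def op_scale_def)
    with 1 show "norm (ext_op (tau G P s f) h - alpha X \<psi> s (ext_op f) h) \<le> \<epsilon> * (2 * norm h)"
      using norm_triangle_ineq4[of "ext_op (tau G P s f) h - step_op ?l h" "alpha X \<psi> s (ext_op f) h - step_op ?l h"]
      by simp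
  qed
qed

lemma ext_op_covariant_rep: "covariant_rep G P X ext_op \<psi>"
  unfolding covariant_rep_def
proof (intro conjI ballI)
  show "B_P_rep G P ext_op" by (rule ext_op_B_P_rep)
  \<comment> \<open>The indicator of \<open>P\<close> is sent to \<open>id\<close>, so nondegeneracy
    is immediate.\<close>
  have "id \<in> ext_op ` B_P G P"
    using ext_op_one_P[OF one_closed] p_one one_P_B_P[OF one_closed] by force
  then have "{T h | T h. T \<in> ext_op ` B_P G P} = UNIV" by (auto, metis id_apply)
  then show "nondegenerate (ext_op ` B_P G P)"
    by (simp add: nondegenerate_def complex_vs.span_UNIV)
  show "nondegenerate_toeplitz_rep P X \<psi>"
    using toeplitz nondegenerate_rep by (simp add: nondegenerate_toeplitz_rep_def)
  show "ext_op ` B_P G P \<subseteq> commutant X \<psi>" using ext_op_commutant by blast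
qed (rule ext_op_tau)

end

theorem proposition6p1:
  fixes G :: "('g, 'm) monoid_scheme" and P :: "'g set"
    and X :: "('g, 'a::cstar_algebra, 'x) prodsys"
  assumes "quasi_lattice_ordered G P" and "countable P"
    and "separable_space (euclidean :: 'a topology)"
    and "product_system G P X"
    and "\<And>s. s \<in> P \<Longrightarrow> essential (fibre X s)"
  shows "(\<forall>L (\<psi> :: 'x \<Rightarrow> 'h::complex_hilbert \<Rightarrow> 'h). covariant_rep G P X L \<psi> \<longrightarrow>
            nondegenerate_toeplitz_rep P X \<psi> \<and> nica_covariant G P X \<psi> \<and>
            (\<forall>s\<in>P. L (one_P G P s) = alpha X \<psi> s id)) \<and>
         (\<forall>\<psi> :: 'x \<Rightarrow> 'h \<Rightarrow> 'h.
            nondegenerate_toeplitz_rep P X \<psi> \<and> nica_covariant G P X \<psi> \<longrightarrow>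
            (\<exists>L. B_P_rep G P L \<and> (\<forall>s\<in>P. L (one_P G P s) = alpha X \<psi> s id) \<and>
                 covariant_rep G P X L \<psi>))"
proof (intro conjI allI impI)
  fix L and \<psi> :: "'x \<Rightarrow> 'h \<Rightarrow> 'h"
  assume cov: "covariant_rep G P X L \<psi>"
  show "nondegenerate_toeplitz_rep P X \<psi>" using cov by (simp add: covariant_rep_def)
  show "nica_covariant G P X \<psi>" "\<forall>s\<in>P. L (one_P G P s) = alpha X \<psi> s id"
    using quasi_lattice_ordered.covariant_rep_nica[OF assms(1) cov] by auto
next
  fix \<psi> :: "'x \<Rightarrow> 'h \<Rightarrow> 'h"
  assume \<psi>: "nondegenerate_toeplitz_rep P X \<psi> \<and> nica_covariant G P X \<psi>"
  then have rep: "toeplitz_rep P X \<psi>" and nd: "nondegenerate (\<psi> ` carrier X)"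
    and nica: "nica_covariant G P X \<psi>"
    by (auto simp: nondegenerate_toeplitz_rep_def)
  interpret nica_toeplitz_representation G P X \<psi>
    by (intro nica_toeplitz_representation.intro toeplitz_representation.intro
        toeplitz_representation_axioms.intro nica_toeplitz_representation_axioms.intro
        assms(1,4,5) rep nd nica)
  show "\<exists>L. B_P_rep G P L \<and> (\<forall>s\<in>P. L (one_P G P s) = alpha X \<psi> s id) \<and> covariant_rep G P X L \<psi>"
    using ext_op_B_P_rep ext_op_one_P ext_op_covariant_rep unfolding range_proj_def by blast
qed

end
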